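(* Let $G_1,G_2$ be unimodular locally compact second countable non-compact groups, let $K_i\subset G_i$ be compact subgroups such that $(G_i,K_i)$ is a Gelfand pair ($i=1,2$), and let $D_i$ be a proper $G_i$-invariant metric on $X_i:=G_i/K_i$. Let $\Gamma$ be a uniform irreducible lattice in $G=G_1\times G_2$ and let $\mathbf r:(1,\infty)\to(0,1)$ be a non-increasing function. Assume the following two conditions. (SG) There exist $\mathfrak w>0$, a constant $C>0$, and, for $R\in(1,\infty)$, non-negative $K_2$-bi-invariant functions $\psi_{2,R}\in C_c(G_2)$ such that $$\operatorname{supp}(\psi_{2,R})\subset \widetilde B^{G_2}_R,\qquad \int_{G_2}\psi_{2,R}\,dm_{G_2}=1,\qquad \big\|\lambda_{\Gamma\backslash G}(\psi_{2,R})|_{L^2_0(\Gamma\backslash G)}\big\|\le C e^{-\mathfrak w R},$$ where $C$ is independent of $R$. (T) There is a constant $c$ such that for every $\delta>0$ there exist, for $R\in(1,\infty)$, $(K_1\times K_2)$-bi-invariant functions $F_{\mathbf r(R),R}=f_{1,\mathbf r(R)}\otimes f_{2,R}\in C_c(G)$ with $f_{1,\mathbf r(R)}\in C_c(G_1)$ and $f_{2,R}\in C_c(G_2)$ satisfying $$\operatorname{supp}(f_{1,\mathbf r(R)})\subset\widetilde B^{G_1}_{\mathbf r(R)},\qquad \operatorname{supp}(f_{2,R})\subset\widetilde B^{G_2}_R,\qquad \int_G F_{\mathbf r(R),R}\,dm_G=1,$$ and there is a constant $C_\delta>0$ such that $$\operatorname{Tr}\Big(\lambda_{\Gamma\backslash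 G}\big(F_{\mathbf r(R),R}^{*}*F_{\mathbf r(R),R}\big)\Big)\le C_\delta\, e^{c\delta R}$$ for all sufficiently large $R$ (here $c$ is independent of $\delta$ and $R$). Then for every $\delta>0$ and almost every $(x_1,y_1)\in G_1\times G_1$ (with respect to $m_{G_1}\times m_{G_1}$) there exists $R_0=R_0(x_1,y_1,\delta)$ such that for all $R>R_0$ the inequalities $$D_1(\gamma_1x_1K_1,\,y_1K_1)\le 2\,\mathbf r(R),\qquad D_2(\gamma_2K_2,\,K_2)\le(1+\delta)R$$ have a solution $\gamma=(\gamma_1,\gamma_2)\in\Gamma$.
   Context: $(G_i,K_i)$ is a Gelfand pair if the convolution algebra of $K_i$-bi-invariant functions in $L^1(G_i)$ is commutative. The metrics $D_i$ are compatible with the topology of $G_i/K_i$, have compact closed balls (proper), and are invariant under left translation by $G_i$. A lattice $\Gamma\subset G_1\times G_2$ is uniform if $\Gamma\backslash G$ is compact, and irreducible if its projections to $G_1$ and to $G_2$ are dense. $m_{G_i}$ are Haar measures and $m_G=m_{G_1}\times m_{G_2}$, normalized so that the induced $G$-invariant measure $m_{\Gamma\backslash G}$, given by $\int_{\Gamma\backslash G}\big(\sum_{\gamma\in\Gamma}\phi(\gamma g)\big)dm_{\Gamma\backslash G}(\Gamma g)=\int_G\phi\,dm_G$ for $\phi\in C_c(G)$, is a probability measure. $L^2_0(\Gamma\backslash G)$ is the subspace of functions in $L^2(\Gamma\backslash G)$ with zero integral. For $r,R>0$: $\widetilde B^{G_1}_r=\{g\in G_1: D_1(gK_1,K_1)\le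 r\}$ and $\widetilde B^{G_2}_R=\{g\in G_2: D_2(gK_2,K_2)\le R\}$. For $F\in C_c(G)$ and $\phi\in L^2(\Gamma\backslash G)$: $\lambda_{\Gamma\backslash G}(F)\phi(\Gamma x)=\int_G F(g)\phi(\Gamma xg)\,dm_G(g)$; for $\psi\in C_c(G_2)$: $\lambda_{\Gamma\backslash G}(\psi)\phi(\Gamma x)=\int_{G_2}\psi(g)\phi(\Gamma x(e,g))\,dm_{G_2}(g)$. $(f_1\otimes f_2)(g_1,g_2)=f_1(g_1)f_2(g_2)$, $F^*(g)=\overline{F(g^{-1})}$, $*$ is convolution on $G$, and $\operatorname{Tr}$ is the operator trace (the operator $\lambda_{\Gamma\backslash G}(F^**F)$ is non-negative and of trace class since $\Gamma$ is uniform). *)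

theory Defs
  imports "HOL-Probability.Probability_Measure"
begin

text \<open>
  Groups are written additively: the library's class \<^class>\<open>topological_group_add\<close> is the class of
  (not necessarily commutative) topological groups, so \<^term>\<open>x + y\<close>, \<^term>\<open>- x\<close> and \<^term>\<open>0\<close> stand
  for the product, the inverse and the identity.  The order of the summands therefore matters
  everywhere below.
\<close>


section \<open>Subgroups, cosets and quotients\<close>

definition subgroup_add :: "'g::group_add set \<Rightarrow> bool" where
  "subgroup_add H \<longleftrightarrow> 0 \<in> H \<and> (\<forall>x\<in>H. \<forall>y\<in>H. x + y \<in> H) \<and> (\<forall>x\<in>H. - x \<in> H)"

definition lcoset :: "'g::group_add set \<Rightarrow> 'g \<Rightarrow> 'g set" where
  "lcoset K g = (\<lambda>k. g + k) ` K"

definition rcoset :: "'g::group_add set \<Rightarrow> 'g \<Rightarrow> 'g set" where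
  "rcoset \<Gamma> g = (\<lambda>\<gamma>. \<gamma> + g) ` \<Gamma>"

text \<open>The actions of \<open>G\<close> on \<open>G/K\<close> from the left and on \<open>\<Gamma>\G\<close> from the right, on cosets as sets.\<close>

definition lshift :: "'g::group_add \<Rightarrow> 'g set \<Rightarrow> 'g set" where
  "lshift h A = (\<lambda>x. h + x) ` A"

definition rshift :: "'g::group_add \<Rightarrow> 'g set \<Rightarrow> 'g set" where
  "rshift h A = (\<lambda>x. x + h) ` A"

definition quotient_topology :: "('a::topological_space \<Rightarrow> 'b) \<Rightarrow> 'b topology" where
  "quotient_topology f = topology (\<lambda>U. U \<subseteq> range f \<and> open (f -` U))"

lemma openin_quotient_topology:
  "openin (quotient_topology f) U \<longleftrightarrow> U \<subseteq> range f \<and> open (f -` U)"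
proof -
  have "istopology (\<lambda>U. U \<subseteq> range f \<and> open (f -` U))"
    unfolding istopology_def by (auto simp: vimage_Union)
  then show ?thesis
    unfolding quotient_topology_def by (simp add: topology_inverse')
qed

lemma topspace_quotient_topology [simp]: "topspace (quotient_topology f) = range f"
proof
  show "topspace (quotient_topology f) \<subseteq> range f"
    using openin_topspace[of "quotient_topology f"] openin_quotient_topology[of f] by blast
  have "openin (quotient_topology f) (range f)"
    by (simp add: openin_quotient_topology vimage_def)
  then show "range f \<subseteq> topspace (quotient_topology f)"
    by (rule openin_subset)
qed

lemma quotient_map_quotient_topology:
  "quotient_map euclidean (quotient_topology f) f"
  by (auto simp: quotient_map_def openin_quotient_topology vimage_def)


section \<open>Haar measure, convolution, Gelfand pairs\<close>

text \<open>
  Left Haar measures.  On a locally compact second countable Hausdorff group a Borel measure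
  that is finite on compact sets is automatically regular.
\<close>

definition haar_measure :: "'g::{topological_space,group_add} measure \<Rightarrow> bool" where
  "haar_measure m \<longleftrightarrow>
     sets m = sets borel \<and>
     emeasure m UNIV \<noteq> 0 \<and>
     (\<forall>C. compact C \<longrightarrow> emeasure m C < \<infinity>) \<and>
     (\<forall>g. \<forall>A\<in>sets borel. emeasure m ((\<lambda>x. g + x) ` A) = emeasure m A)"

definition unimodular :: "'g::{topological_space,group_add} itself \<Rightarrow> bool" where
  "unimodular _ \<longleftrightarrow>
     (\<forall>m::'g measure. haar_measure m \<longrightarrow>
        (\<forall>g. \<forall>A\<in>sets borel. emeasure m ((\<lambda>x. x + g) ` A) = emeasure m A))"

definition convolve ::
  "'g::group_add measure \<Rightarrow> ('g \<Rightarrow> complex) \<Rightarrow> ('g \<Rightarrow> complex) \<Rightarrow> 'g \<Rightarrow> complex" where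
  "convolve m f h = (\<lambda>x. LINT y|m. f y * h (- y + x))"

definition star :: "('g::group_add \<Rightarrow> complex) \<Rightarrow> 'g \<Rightarrow> complex" where
  "star f = (\<lambda>g. cnj (f (- g)))"

definition bi_invariant :: "'g::group_add set \<Rightarrow> ('g \<Rightarrow> 'c) \<Rightarrow> bool" where
  "bi_invariant K f \<longleftrightarrow> (\<forall>k\<in>K. \<forall>l\<in>K. \<forall>g. f (k + g + l) = f g)"

text \<open>
  Elements of \<open>L\<^sup>1(G)\<close> are integrable functions up to equality almost everywhere, so here both
  bi-invariance and the commutation of convolutions are understood almost everywhere.
\<close>

definition gelfand_pair :: "'g::group_add measure \<Rightarrow> 'g set \<Rightarrow> bool" where
  "gelfand_pair m K \<longleftrightarrow>
     (\<forall>f h :: 'g \<Rightarrow> complex.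
        integrable m f \<and> (\<forall>k\<in>K. \<forall>l\<in>K. AE g in m. f (k + g + l) = f g) \<and>
        integrable m h \<and> (\<forall>k\<in>K. \<forall>l\<in>K. AE g in m. h (k + g + l) = h g) \<longrightarrow>
        (AE x in m. convolve m f h x = convolve m h f x))"

definition supp :: "('g::topological_space \<Rightarrow> 'c::zero) \<Rightarrow> 'g set" where
  "supp f = closure {x. f x \<noteq> 0}"

definition Cc :: "('g::topological_space \<Rightarrow> 'c::{topological_space,zero}) set" where
  "Cc = {f. continuous_on UNIV f \<and> compact (supp f)}"

definition tensor :: "('a \<Rightarrow> complex) \<Rightarrow> ('b \<Rightarrow> complex) \<Rightarrow> 'a \<times> 'b \<Rightarrow> complex" where
  "tensor f1 f2 = (\<lambda>(x, y). f1 x * f2 y)"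


section \<open>Proper invariant metrics on \<open>G/K\<close>\<close>

definition proper_invariant_metric ::
  "'g::{topological_space,group_add} set \<Rightarrow> ('g set \<Rightarrow> 'g set \<Rightarrow> real) \<Rightarrow> bool" where
  "proper_invariant_metric K D \<longleftrightarrow>
     Metric_space (range (lcoset K)) D \<and>
     Metric_space.mtopology (range (lcoset K)) D = quotient_topology (lcoset K) \<and>
     (\<forall>x\<in>range (lcoset K). \<forall>r.
        compactin (quotient_topology (lcoset K)) (Metric_space.mcball (range (lcoset K)) D x r)) \<and>
     (\<forall>g. \<forall>x\<in>range (lcoset K). \<forall>y\<in>range (lcoset K). D (lshift g x) (lshift g y) = D x y)"

definition lifted_ball ::
  "'g::group_add set \<Rightarrow> ('g set \<Rightarrow> 'g set \<Rightarrow> real) \<Rightarrow> real \<Rightarrow> 'g set" where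
  "lifted_ball K D r = {g. D (lcoset K g) K \<le> r}"


section \<open>Lattices and the space \<open>\<Gamma>\G\<close>\<close>

definition invariant_measure ::
  "'g::{topological_space,group_add} set \<Rightarrow> 'g set measure \<Rightarrow> bool" where
  "invariant_measure \<Gamma> \<mu> \<longleftrightarrow>
     space \<mu> = range (rcoset \<Gamma>) \<and>
     sets \<mu> = sigma_sets (range (rcoset \<Gamma>)) {U. openin (quotient_topology (rcoset \<Gamma>)) U} \<and>
     (\<forall>h. \<forall>A\<in>sets \<mu>. emeasure \<mu> (rshift h ` A) = emeasure \<mu> A)"

definition lattice_subgroup :: "'g::{topological_space,group_add} set \<Rightarrow> bool" where
  "lattice_subgroup \<Gamma> \<longleftrightarrow>
     subgroup_add \<Gamma> \<and> discrete \<Gamma> \<and>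
     (\<exists>\<mu>. invariant_measure \<Gamma> \<mu> \<and> emeasure \<mu> (space \<mu>) \<noteq> 0 \<and> emeasure \<mu> (space \<mu>) < \<infinity>)"

definition uniform_lattice :: "'g::{topological_space,group_add} set \<Rightarrow> bool" where
  "uniform_lattice \<Gamma> \<longleftrightarrow>
     lattice_subgroup \<Gamma> \<and> compact_space (quotient_topology (rcoset \<Gamma>))"

definition irreducible_in_product ::
  "('a::topological_space \<times> 'b::topological_space) set \<Rightarrow> bool" where
  "irreducible_in_product \<Gamma> \<longleftrightarrow> closure (fst ` \<Gamma>) = UNIV \<and> closure (snd ` \<Gamma>) = UNIV"

text \<open>
  The measure induced on \<open>\<Gamma>\G\<close> by a Haar measure \<open>m\<close> of \<open>G\<close>.  A point \<open>c\<close> of \<open>\<Gamma>\G\<close> is a right coset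
  \<open>\<Gamma>g = {\<gamma>g | \<gamma> \<in> \<Gamma>}\<close>, so the sum of \<open>\<phi>(x)\<close> over \<open>x \<in> c\<close> is the sum of \<open>\<phi>(\<gamma>g)\<close> over \<open>\<gamma> \<in> \<Gamma>\<close>;
  it has only finitely many non-zero terms.
\<close>

definition induced_measure ::
  "'g::{topological_space,group_add} set \<Rightarrow> 'g measure \<Rightarrow> 'g set measure \<Rightarrow> bool" where
  "induced_measure \<Gamma> m \<mu> \<longleftrightarrow>
     invariant_measure \<Gamma> \<mu> \<and>
     (\<forall>\<phi>::'g \<Rightarrow> complex. \<phi> \<in> Cc \<longrightarrow> (LINT c|\<mu>. (\<Sum>\<^sub>\<infinity>x\<in>c. \<phi> x)) = (LINT g|m. \<phi> g))"

text \<open>The operators \<open>\<lambda>(F)\<close> for \<open>F\<close> on \<open>G\<close> and \<open>\<lambda>(\<psi>)\<close> for \<open>\<psi>\<close> on the second factor.\<close>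

definition lam ::
  "'g::group_add measure \<Rightarrow> ('g \<Rightarrow> complex) \<Rightarrow> ('g set \<Rightarrow> complex) \<Rightarrow> 'g set \<Rightarrow> complex" where
  "lam m F \<phi> = (\<lambda>c. LINT g|m. F g * \<phi> (rshift g c))"

definition lam2 ::
  "'b::group_add measure \<Rightarrow> ('b \<Rightarrow> complex) \<Rightarrow>
     (('a::group_add \<times> 'b) set \<Rightarrow> complex) \<Rightarrow> ('a \<times> 'b) set \<Rightarrow> complex" where
  "lam2 m2 \<psi> \<phi> = (\<lambda>c. LINT g|m2. \<psi> g * \<phi> (rshift (0, g) c))"


section \<open>Operators on \<open>L\<^sup>2\<close>\<close>

text \<open>
  \<open>L\<^sup>2\<close> is handled through representatives: its elements are the members of \<open>L2 \<mu>\<close> up to equality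
  almost everywhere.
\<close>

definition L2 :: "'x measure \<Rightarrow> ('x \<Rightarrow> complex) set" where
  "L2 \<mu> = {\<phi>. \<phi> \<in> borel_measurable \<mu> \<and> integrable \<mu> (\<lambda>x. (norm (\<phi> x))\<^sup>2)}"

definition L2_0 :: "'x measure \<Rightarrow> ('x \<Rightarrow> complex) set" where
  "L2_0 \<mu> = {\<phi> \<in> L2 \<mu>. (LINT x|\<mu>. \<phi> x) = 0}"

definition l2_inner :: "'x measure \<Rightarrow> ('x \<Rightarrow> complex) \<Rightarrow> ('x \<Rightarrow> complex) \<Rightarrow> complex" where
  "l2_inner \<mu> \<phi> \<theta> = (LINT x|\<mu>. \<phi> x * cnj (\<theta> x))"

definition l2_norm :: "'x measure \<Rightarrow> ('x \<Rightarrow> complex) \<Rightarrow> real" where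
  "l2_norm \<mu> \<phi> = sqrt (LINT x|\<mu>. (norm (\<phi> x))\<^sup>2)"

text \<open>
  Norm of the restriction to \<open>V\<close> of an operator \<open>T\<close> that maps \<open>L\<^sup>2\<close> to itself (possibly infinite).
\<close>

definition op_norm_on ::
  "'x measure \<Rightarrow> ('x \<Rightarrow> complex) set \<Rightarrow> (('x \<Rightarrow> complex) \<Rightarrow> 'x \<Rightarrow> complex) \<Rightarrow> ennreal" where
  "op_norm_on \<mu> V T = (SUP \<phi>\<in>{\<phi>\<in>V. l2_norm \<mu> \<phi> \<le> 1}. ennreal (l2_norm \<mu> (T \<phi>)))"

text \<open>
  Orthonormal bases.  Two members that agree almost everywhere have inner product 1, hence are
  equal as functions by the first clause; so \<open>E\<close> contains one representative per basis vector.
\<close>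

definition orthonormal_basis :: "'x measure \<Rightarrow> ('x \<Rightarrow> complex) set \<Rightarrow> bool" where
  "orthonormal_basis \<mu> E \<longleftrightarrow>
     E \<subseteq> L2 \<mu> \<and>
     (\<forall>e\<in>E. \<forall>f\<in>E. l2_inner \<mu> e f = (if e = f then 1 else 0)) \<and>
     (\<forall>\<phi>\<in>L2 \<mu>. \<forall>\<epsilon>>0. \<exists>A a. finite A \<and> A \<subseteq> E \<and>
        l2_norm \<mu> (\<lambda>x. \<phi> x - (\<Sum>e\<in>A. a e * e x)) < \<epsilon>)"

text \<open>
  \<open>T\<close> is of trace class with trace \<open>t\<close>: in every orthonormal basis the diagonal series converges
  unconditionally, with sum \<open>t\<close>.  The first clause excludes a vacuous truth; it holds in every
  \<open>L\<^sup>2\<close> space.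
\<close>

definition has_trace ::
  "'x measure \<Rightarrow> (('x \<Rightarrow> complex) \<Rightarrow> 'x \<Rightarrow> complex) \<Rightarrow> complex \<Rightarrow> bool" where
  "has_trace \<mu> T t \<longleftrightarrow>
     (\<exists>E. orthonormal_basis \<mu> E) \<and>
     (\<forall>E. orthonormal_basis \<mu> E \<longrightarrow> ((\<lambda>e. l2_inner \<mu> (T e) e) has_sum t) E)"

end

theory Submission
  imports Defs
begin

text \<open>
  Let \<open>G = G\<^sub>1 \<times> G\<^sub>2\<close> and \<open>F = f\<^sub>1 \<otimes> f\<^sub>2\<close>.  The operator \<open>\<lambda>(F)\<close> on \<open>L\<^sup>2(\<Gamma>\G)\<close> has the kernel
  \<open>k\<^sub>x(c) = \<Sum>\<^bsub>h \<in> c\<^esub> F(x\<inverse>h)\<close>, that is, \<open>(\<lambda>(F)\<phi>)(\<Gamma>x) = \<integral> k\<^sub>x \<phi>\<close>.  Each \<open>k\<^sub>x\<close> has integral 1, and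
  \<open>\<integral> \<parallel>k\<^sub>x\<parallel>\<^sup>2\<close> over \<open>\<Gamma>x \<in> \<Gamma>\G\<close> is the squared Hilbert-Schmidt norm of \<open>\<lambda>(F)\<close>, which is the
  trace of \<open>\<lambda>(F\<^sup>* * F)\<close>; the upper bound is \<open>trace_dominates_kernel\<close>.

  Suppose now that no \<open>\<gamma> \<in> \<Gamma>\<close> connects \<open>x\<^sub>1\<close> to \<open>y\<^sub>1\<close> at scale \<open>R\<close>, and let \<open>x = (x\<^sub>1, x\<^sub>2)\<close>,
  \<open>y = (y\<^sub>1, y\<^sub>2)\<close> with \<open>x\<^sub>2\<close>, \<open>y\<^sub>2\<close> in a fixed neighbourhood of the identity of \<open>G\<^sub>2\<close>.  By the
  triangle inequality, all \<open>g\<close> in the support of a function \<open>\<psi>\<close> with a radius that is a small multiple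
  of \<open>\<delta>R\<close> satisfy \<open>k\<^sub>y(\<Gamma>x(e, g)) = 0\<close> (\<open>unconnected_kernel_zero\<close>).  Therefore
  \<open>\<lambda>(\<psi>)(k\<^sub>y - 1)\<close> has the value \<open>-1\<close> at \<open>\<Gamma>x\<close>.  But \<open>k\<^sub>y - 1\<close> lies in \<open>L\<^sup>2\<^sub>0\<close>, so by the spectral gap
  this function has squared norm at most \<open>C\<^sup>2 e\<^bsup>-2w'R\<^esup> \<parallel>k\<^sub>y\<parallel>\<^sup>2\<close> for some \<open>w' > 0\<close>, and the set of
  \<open>\<Gamma>x\<close> where it has the value \<open>-1\<close> has at most this measure.  Integrating over \<open>y\<close> in
  a compact set bounds the measure of the unconnected pairs \<open>(x\<^sub>1, y\<^sub>1)\<close> by a constant times \<open>e\<^bsup>-2w'R\<^esup>\<close> times the trace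
  (\<open>unconnected_pairs_measure\<close>).  The trace grows at an exponential rate which can be made as
  small as desired, so these measures are summable over integer \<open>R\<close>, and the Borel-Cantelli lemma shows
  that almost every pair is connected at all large integer scales (\<open>eventually_connected\<close>).  Rounding
  \<open>R\<close> up to an integer costs only a bounded amount in the second radius.

  The passage between \<open>G\<close> and \<open>\<Gamma>\G\<close> uses the unfolding formula
  \<open>\<integral>\<^bsub>G\<^esub> f = \<integral>\<^bsub>\<Gamma>\G\<^esub> \<Sum>\<^bsub>h \<in> c\<^esub> f(h)\<close>.  It is given for continuous functions with compact support and extended
  to all non-negative Borel functions (\<open>unfolds_nn_integral\<close>).
\<close>


section \<open>Locally compact second countable groups and Haar measure\<close>

instance prod :: (topological_group_add, topological_group_add) topological_group_add
proof
  fix a b :: "'a \<times> 'b"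
  have 1: "((\<lambda>x. fst (fst x) + fst (snd x)) \<longlongrightarrow> fst a + fst b) (nhds a \<times>\<^sub>F nhds b)"
    by (intro tendsto_intros) (auto intro!: tendsto_fst filterlim_fst filterlim_snd)
  have 2: "((\<lambda>x. snd (fst x) + snd (snd x)) \<longlongrightarrow> snd a + snd b) (nhds a \<times>\<^sub>F nhds b)"
    by (intro tendsto_intros) (auto intro!: tendsto_snd filterlim_fst filterlim_snd)
  show "((\<lambda>x. fst x + snd x) \<longlongrightarrow> a + b) (nhds a \<times>\<^sub>F nhds b)"
    using tendsto_Pair[OF 1 2] by (simp add: plus_prod_def case_prod_beta)
  have "((\<lambda>x. (- fst x, - snd x)) \<longlongrightarrow> (- fst a, - snd a)) (nhds a)"
    by (intro tendsto_intros) (auto simp: tendsto_ident_at filterlim_ident)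
  moreover have "uminus = (\<lambda>x::'a \<times> 'b. (- fst x, - snd x))"
    by (simp add: fun_eq_iff uminus_prod_def)
  ultimately show "(uminus \<longlongrightarrow> - a) (nhds a)"
    by (simp add: uminus_prod_def[of a])
qed

lemma Cc_bump:
  fixes x :: "'g::{t2_space}"
  assumes lc: "locally_compact_space (euclidean :: 'g topology)" and "open U" "x \<in> U"
  obtains f :: "'g \<Rightarrow> real"
  where "f \<in> Cc" "\<And>y. 0 \<le> f y" "f x > 0" "{y. f y \<noteq> 0} \<subseteq> U"
proof -
  obtain V L where V: "open V" "compact L" "x \<in> V" "V \<subseteq> L"
  proof -
    have "\<forall>x::'g. \<exists>V L. open V \<and> compact L \<and> x \<in> V \<and> V \<subseteq> L"
      using lc unfolding locally_compact_space_def by simp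
    then show thesis using that by metis
  qed
  have haus: "Hausdorff_space (euclidean :: 'g topology)"
    unfolding Hausdorff_space_def disjnt_def topspace_euclidean open_openin[symmetric]
    using hausdorff by blast
  have "completely_regular_space (euclidean :: 'g topology)"
    using lc haus locally_compact_regular_imp_completely_regular_space
      locally_compact_Hausdorff_imp_regular_space by blast
  moreover have "closedin euclidean (- (U \<inter> V))" "x \<in> topspace euclidean - (- (U \<inter> V))"
    using assms V by auto
  ultimately obtain h :: "'g \<Rightarrow> real" where h: "continuous_map euclidean (top_of_set {0..1}) h"
      "h x = 0" "h ` (- (U \<inter> V)) \<subseteq> {1}"
    unfolding completely_regular_space_def by blast
  have cont: "continuous_on UNIV h"
    using h(1) by (simp add: continuous_map_in_subtopology)
  have le1: "h y \<le> 1" for y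
    using h(1) by (auto simp: continuous_map_def)
  let ?f = "\<lambda>y. 1 - h y"
  have sub: "{y. ?f y \<noteq> 0} \<subseteq> U \<inter> V"
    using h(3) by fastforce
  have "closed L"
    using V(2) by (rule compact_imp_closed)
  then have "supp ?f \<subseteq> L"
    unfolding supp_def using sub V(4) by (intro closure_minimal) auto
  then have "compact (supp ?f)"
    using V(2) unfolding supp_def
    by (metis closed_closure compact_Int_closed inf.absorb_iff2)
  then have "?f \<in> Cc"
    unfolding Cc_def using cont by (auto intro!: continuous_intros)
  then show ?thesis
    using that[of ?f] le1 h(2) sub by auto
qed

lemma Cc_bounded:
  fixes f :: "'g::t2_space \<Rightarrow> 'c::real_normed_vector"
  assumes "f \<in> Cc"
  obtains B where "B \<ge> 0" "\<And>x. norm (f x) \<le> B"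
proof -
  have "compact (f ` supp f)"
    using assms unfolding Cc_def by (auto intro: compact_continuous_image continuous_on_subset)
  then obtain B where B: "\<And>y. y \<in> f ` supp f \<Longrightarrow> norm y \<le> B"
    using compact_imp_bounded bounded_iff by metis
  have "norm (f x) \<le> max B 0" for x
  proof (cases "f x = 0")
    case False
    then have "x \<in> supp f" using closure_subset[of "{x. f x \<noteq> 0}"] unfolding supp_def by blast
    then show ?thesis using B by fastforce
  qed simp
  then show ?thesis using that[of "max B 0"] by simp
qed

lemma zero_outside_supp: "x \<notin> supp f \<Longrightarrow> f x = 0"
  using closure_subset[of "{x. f x \<noteq> 0}"] unfolding supp_def by blast

lemma compact_exhaustion:
  assumes lc: "locally_compact_space (euclidean :: 'g::second_countable_topology topology)"
  obtains L :: "nat \<Rightarrow> 'g::second_countable_topology set" where "\<And>n. compact (L n)" "(\<Union>n. L n) = UNIV"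
    "\<And>n. L n \<subseteq> L (Suc n)"
proof -
  have "\<forall>x::'g. \<exists>V L. open V \<and> compact L \<and> x \<in> V \<and> V \<subseteq> L"
    using lc unfolding locally_compact_space_def by simp
  then obtain V L where VL: "\<And>x::'g. open (V x) \<and> compact (L x) \<and> x \<in> V x \<and> V x \<subseteq> L x"
    by metis
  obtain \<F> where F: "\<F> \<subseteq> range V" "countable \<F>" "\<Union>\<F> = \<Union>(range V)"
    using Lindelof[of "range V"] VL by blast
  obtain I where I: "countable I" "\<F> = V ` I"
    using F(1,2) by (metis countable_subset_image)
  have U: "(\<Union>x\<in>I. L x) = UNIV"
  proof -
    have "y \<in> (\<Union>x\<in>I. L x)" for y
    proof -
      have "y \<in> \<Union>\<F>" unfolding F(3) using VL[of y] by blast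
      then obtain x where "x \<in> I" "y \<in> V x" unfolding I(2) by blast
      then show ?thesis using VL[of x] by blast
    qed
    then show ?thesis by (rule UNIV_eq_I[symmetric])
  qed
  then have "I \<noteq> {}" by auto
  define M where "M n = (\<Union>k\<le>n. L (from_nat_into I k))" for n
  have "\<And>n. compact (M n)" unfolding M_def using VL by auto
  moreover have "(\<Union>n. M n) = UNIV"
  proof (intro UNIV_eq_I[symmetric])
    fix y :: 'g
    have "y \<in> (\<Union>x\<in>I. L x)" unfolding U by simp
    then obtain x where "x \<in> I" "y \<in> L x" by blast
    then obtain k where "from_nat_into I k = x"
      using from_nat_into_to_nat_on[OF I(1)] by blast
    then have "y \<in> M k" using \<open>y \<in> L x\<close> unfolding M_def by blast
    then show "y \<in> (\<Union>n. M n)" by blast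
  qed
  moreover have "M n \<subseteq> M (Suc n)" for n
    unfolding M_def by force
  ultimately show ?thesis using that by blast
qed

locale unimodular_haar =
  fixes m :: "'g::{topological_group_add,t2_space,second_countable_topology} measure"
  assumes lc: "locally_compact_space (euclidean :: 'g topology)"
    and sets_m [simp, measurable_cong]: "sets m = sets borel"
    and nonzero: "emeasure m UNIV \<noteq> 0"
    and emeasure_compact: "compact C \<Longrightarrow> emeasure m C < \<infinity>"
    and distr_left: "distr m borel ((+) g) = m"
    and distr_right: "distr m borel (\<lambda>x. x + g) = m"
begin

lemma space_m [simp]: "space m = UNIV"
  using sets_eq_imp_space_eq[OF sets_m] by simp

lemma measurable_add_group [measurable]:
  assumes "f \<in> borel_measurable M" "h \<in> borel_measurable M"
  shows "(\<lambda>x. f x + h x :: 'g) \<in> borel_measurable M"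
  using assms by (rule borel_measurable_continuous_Pair) (intro continuous_intros)

lemma measurable_uminus_group [measurable]:
  assumes "f \<in> borel_measurable M"
  shows "(\<lambda>x. - f x :: 'g) \<in> borel_measurable M"
proof -
  have "(\<lambda>x::'g. - x) \<in> borel_measurable borel"
    by (intro borel_measurable_continuous_onI continuous_intros)
  then show ?thesis using assms by (rule measurable_compose_rev)
qed

lemma sigma_finite: "sigma_finite_measure m"
proof -
  obtain L :: "nat \<Rightarrow> 'g set" where L: "\<And>n. compact (L n)" "(\<Union>n. L n) = UNIV"
    using compact_exhaustion[OF lc] by metis
  show ?thesis
  proof
    have "emeasure m (L n) \<noteq> \<infinity>" for n
      using emeasure_compact[OF L(1)[of n]] by auto
    then show "\<exists>A. countable A \<and> A \<subseteq> sets m \<and> \<Union> A = space m \<and> (\<forall>a\<in>A. emeasure m a \<noteq> \<infinity>)"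
      using L by (intro exI[of _ "range L"]) (auto simp: borel_compact)
  qed
qed

sublocale sigma_finite_measure m by (rule sigma_finite)

lemma nn_integral_left:
  assumes [measurable]: "f \<in> borel_measurable borel"
  shows "(\<integral>\<^sup>+x. f (g + x) \<partial>m) = (\<integral>\<^sup>+x. f x \<partial>m)"
proof -
  have "(\<integral>\<^sup>+x. f x \<partial>m) = (\<integral>\<^sup>+x. f x \<partial>distr m borel ((+) g))" by (simp add: distr_left)
  also have "\<dots> = (\<integral>\<^sup>+x. f (g + x) \<partial>m)" by (intro nn_integral_distr) auto
  finally show ?thesis by simp
qed

lemma nn_integral_right:
  assumes [measurable]: "f \<in> borel_measurable borel"
  shows "(\<integral>\<^sup>+x. f (x + g) \<partial>m) = (\<integral>\<^sup>+x. f x \<partial>m)"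
proof -
  have "(\<integral>\<^sup>+x. f x \<partial>m) = (\<integral>\<^sup>+x. f x \<partial>distr m borel (\<lambda>x. x + g))" by (simp add: distr_right)
  also have "\<dots> = (\<integral>\<^sup>+x. f (x + g) \<partial>m)" by (intro nn_integral_distr) auto
  finally show ?thesis by simp
qed

lemma integral_left:
  fixes f :: "'g \<Rightarrow> complex"
  assumes [measurable]: "f \<in> borel_measurable borel"
  shows "(LINT x|m. f (g + x)) = (LINT x|m. f x)"
proof -
  have "(LINT x|m. f x) = (LINT x|distr m borel ((+) g). f x)" by (simp add: distr_left)
  also have "\<dots> = (LINT x|m. f (g + x))" by (intro integral_distr) auto
  finally show ?thesis by simp
qed

text \<open>The translates of a non-empty open null set would cover the group, and countably many of them
  suffice for that.\<close>

lemma emeasure_open_pos: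
  assumes "open U" "U \<noteq> {}"
  shows "emeasure m U > 0"
proof (rule ccontr)
  assume "\<not> 0 < emeasure m U"
  then have 0: "emeasure m U = 0" by simp
  obtain u where u: "u \<in> U" using assms by blast
  let ?T = "\<lambda>g. (\<lambda>x. - g + x) -` U"
  have op: "open (?T g)" for g
    using assms(1) by (intro open_vimage continuous_intros)
  have null: "?T g \<in> null_sets m" for g
  proof -
    have "emeasure m U = emeasure (distr m borel ((+) (- g))) U" by (simp add: distr_left)
    also have "\<dots> = emeasure m (?T g)"
      using assms(1) by (subst emeasure_distr) auto
    finally show ?thesis using 0 op by (auto simp: null_sets_def)
  qed
  obtain \<F> where F: "\<F> \<subseteq> range ?T" "countable \<F>" "\<Union>\<F> = \<Union>(range ?T)"
    using Lindelof[of "range ?T"] op by blast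
  have "y \<in> ?T (y - u)" for y using u by simp
  then have "\<Union>\<F> = UNIV" using F(3) by blast
  moreover have "\<Union>\<F> \<in> null_sets m"
    using F(1,2) null null_sets_UN'[of \<F> "\<lambda>x. x" m] by auto
  ultimately show False using nonzero by (auto simp: null_sets_def)
qed

lemma integrable_Cc:
  fixes f :: "'g \<Rightarrow> 'c::{banach,second_countable_topology}"
  assumes "f \<in> Cc"
  shows "integrable m f"
proof -
  obtain B where B: "\<And>x. norm (f x) \<le> B" using Cc_bounded[OF assms] by metis
  have c: "compact (supp f)" and meas: "f \<in> borel_measurable m"
    using assms unfolding Cc_def measurable_cong_sets[OF sets_m refl] by (auto intro: borel_measurable_continuous_onI)
  show ?thesis
  proof (rule integrableI_bounded_set[where A="supp f"])
    show "supp f \<in> sets m" using c by (simp add: borel_compact)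
    show "emeasure m (supp f) < \<infinity>" using c by (rule emeasure_compact)
    show "AE x in m. x \<in> supp f \<longrightarrow> norm (f x) \<le> B" using B by simp
  qed (use meas zero_outside_supp[of _ f] in auto)
qed

text \<open>Both integrals appear when \<open>\<integral>\<integral> f(x + y) g(-y)\<close> is evaluated in two ways: right invariance in \<open>x\<close>
  gives \<open>\<integral>f\<close> times the left-hand side, and the substitution \<open>y \<mapsto> -x + y\<close> gives \<open>\<integral>f\<close> times the right-hand
  side.\<close>

lemma nn_integral_inverse:
  assumes g [measurable]: "g \<in> borel_measurable borel"
  shows "(\<integral>\<^sup>+x. g (- x) \<partial>m) = (\<integral>\<^sup>+x. g x \<partial>m)"
proof -
  interpret P: pair_sigma_finite m m ..
  obtain f :: "'g \<Rightarrow> real" where f: "f \<in> Cc" "\<And>y. 0 \<le> f y" "f 0 > 0"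
    using Cc_bump[OF lc open_UNIV UNIV_I] by metis
  have contf: "continuous_on UNIV f" using f(1) by (simp add: Cc_def)
  then have [measurable]: "f \<in> borel_measurable borel"
    by (rule borel_measurable_continuous_onI)
  let ?I = "\<integral>\<^sup>+x. ennreal (f x) \<partial>m"
  have fin: "?I < \<infinity>"
    using integrable_Cc[OF f(1)] f(2) by (simp add: integrable_iff_bounded)
  have "emeasure m {x. f x > 0} > 0"
    using f(3) by (intro emeasure_open_pos open_Collect_less continuous_intros contf) auto
  then have "?I \<noteq> 0"
    using f(2) by (subst nn_integral_0_iff) (auto simp: less_le)
  have "?I * (\<integral>\<^sup>+y. g (- y) \<partial>m) = (\<integral>\<^sup>+y. (\<integral>\<^sup>+x. f x \<partial>m) * g (- y) \<partial>m)"
    by (simp add: nn_integral_cmult)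
  also have "\<dots> = (\<integral>\<^sup>+y. (\<integral>\<^sup>+x. f (x + y) \<partial>m) * g (- y) \<partial>m)"
    by (subst nn_integral_right[of "\<lambda>x. ennreal (f x)"]) auto
  also have "\<dots> = (\<integral>\<^sup>+y. (\<integral>\<^sup>+x. f (x + y) * g (- y) \<partial>m) \<partial>m)"
    by (simp add: nn_integral_multc)
  also have "\<dots> = (\<integral>\<^sup>+x. (\<integral>\<^sup>+y. f (x + y) * g (- y) \<partial>m) \<partial>m)"
    by (rule P.Fubini') measurable
  also have "\<dots> = (\<integral>\<^sup>+x. (\<integral>\<^sup>+y. f y * g (- y + x) \<partial>m) \<partial>m)"
  proof (rule nn_integral_cong)
    fix x
    have "(\<integral>\<^sup>+y. f (x + y) * g (- y) \<partial>m) = (\<integral>\<^sup>+y. f (x + y) * g (- (x + y) + x) \<partial>m)"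
      by (simp add: minus_add add.assoc)
    also have "\<dots> = (\<integral>\<^sup>+y. f y * g (- y + x) \<partial>m)"
      by (rule nn_integral_left[where f="\<lambda>y. f y * g (- y + x)"]) measurable
    finally show "(\<integral>\<^sup>+y. f (x + y) * g (- y) \<partial>m) = (\<integral>\<^sup>+y. f y * g (- y + x) \<partial>m)" .
  qed
  also have "\<dots> = (\<integral>\<^sup>+y. (\<integral>\<^sup>+x. f y * g (- y + x) \<partial>m) \<partial>m)"
    by (rule P.Fubini') measurable
  also have "\<dots> = (\<integral>\<^sup>+y. f y * (\<integral>\<^sup>+x. g x \<partial>m) \<partial>m)"
    by (simp add: nn_integral_cmult nn_integral_left)
  also have "\<dots> = ?I * (\<integral>\<^sup>+x. g x \<partial>m)"
    by (simp add: nn_integral_multc)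
  finally show ?thesis
    using \<open>?I \<noteq> 0\<close> fin by (auto simp: ennreal_mult_cancel_left)
qed

lemma distr_inverse: "distr m borel uminus = m"
proof (rule measure_eqI)
  fix A assume "A \<in> sets (distr m borel uminus)"
  then have [measurable]: "A \<in> sets borel" by simp
  have "emeasure (distr m borel uminus) A = (\<integral>\<^sup>+x. indicator A x \<partial>distr m borel uminus)" by simp
  also have "\<dots> = (\<integral>\<^sup>+x. indicator A (- x) \<partial>m)" by (intro nn_integral_distr) auto
  also have "\<dots> = emeasure m A" by (subst nn_integral_inverse) auto
  finally show "emeasure (distr m borel uminus) A = emeasure m A" .
qed simp

lemma integral_inverse:
  fixes f :: "'g \<Rightarrow> complex"
  assumes [measurable]: "f \<in> borel_measurable borel"
  shows "(LINT x|m. f (- x)) = (LINT x|m. f x)"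
proof -
  have "(LINT x|m. f x) = (LINT x|distr m borel uminus. f x)" by (simp add: distr_inverse)
  also have "\<dots> = (LINT x|m. f (- x))" by (intro integral_distr) auto
  finally show ?thesis by simp
qed

end

lemma haar_distr_left:
  fixes m :: "'g::topological_group_add measure"
  assumes "haar_measure m"
  shows "distr m borel ((+) g) = m"
proof (rule measure_eqI)
  have s: "sets m = sets borel" using assms by (simp add: haar_measure_def)
  then have sp: "space m = UNIV" using sets_eq_imp_space_eq by fastforce
  show "sets (distr m borel ((+) g)) = sets m" using s by simp
  fix A assume "A \<in> sets (distr m borel ((+) g))"
  then have A: "A \<in> sets borel" by simp
  have [measurable]: "(+) g \<in> measurable m borel"
    unfolding measurable_cong_sets[OF s refl]
    by (intro borel_measurable_continuous_onI continuous_intros)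
  have eq: "(+) g -` A = (+) (- g) ` A"
    by (force simp: image_iff add.assoc[symmetric])
  have "emeasure (distr m borel ((+) g)) A = emeasure m ((+) g -` A)"
    using A by (subst emeasure_distr) (auto simp: sp)
  also have "\<dots> = emeasure m A"
    unfolding eq using assms A by (simp add: haar_measure_def)
  finally show "emeasure (distr m borel ((+) g)) A = emeasure m A" .
qed

lemma haar_distr_right:
  fixes m :: "'g::topological_group_add measure"
  assumes "haar_measure m" "unimodular TYPE('g)"
  shows "distr m borel (\<lambda>x. x + g) = m"
proof (rule measure_eqI)
  have s: "sets m = sets borel" using assms by (simp add: haar_measure_def)
  then have sp: "space m = UNIV" using sets_eq_imp_space_eq by fastforce
  show "sets (distr m borel (\<lambda>x. x + g)) = sets m" using s by simp
  fix A assume "A \<in> sets (distr m borel (\<lambda>x. x + g))"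
  then have A: "A \<in> sets borel" by simp
  have [measurable]: "(\<lambda>x. x + g) \<in> measurable m borel"
    unfolding measurable_cong_sets[OF s refl]
    by (intro borel_measurable_continuous_onI continuous_intros)
  have eq: "(\<lambda>x. x + g) -` A = (\<lambda>x. x + - g) ` A"
    by (force simp: image_iff add.assoc)
  have "emeasure (distr m borel (\<lambda>x. x + g)) A = emeasure m ((\<lambda>x. x + g) -` A)"
    using A by (subst emeasure_distr) (auto simp: sp)
  also have "\<dots> = emeasure m A"
    unfolding eq using assms A unfolding unimodular_def by blast
  finally show "emeasure (distr m borel (\<lambda>x. x + g)) A = emeasure m A" .
qed

lemma unimodular_haarI:
  fixes m :: "'g::{topological_group_add,t2_space,second_countable_topology} measure"
  assumes "locally_compact_space (euclidean :: 'g topology)" "haar_measure m" "unimodular TYPE('g)"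
  shows "unimodular_haar m"
  using assms haar_distr_left haar_distr_right
  by unfold_locales (auto simp: haar_measure_def)

lemma unimodular_haar_pair:
  assumes "unimodular_haar m1" "unimodular_haar m2"
  shows "unimodular_haar (m1 \<Otimes>\<^sub>M m2)"
proof -
  interpret A: unimodular_haar m1 by fact
  interpret B: unimodular_haar m2 by fact
  interpret pair_sigma_finite m1 m2 ..
  show ?thesis
  proof
    show "locally_compact_space (euclidean :: ('a \<times> 'b) topology)"
      using A.lc B.lc locally_compact_space_prod_topology[of "euclidean :: 'a topology" "euclidean :: 'b topology"]
      by (simp add: euclidean_product_topology)
    show sets: "sets (m1 \<Otimes>\<^sub>M m2) = sets borel"
      using sets_pair_measure_cong[OF A.sets_m B.sets_m] unfolding borel_prod .
    show "emeasure (m1 \<Otimes>\<^sub>M m2) UNIV \<noteq> 0"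
      using B.emeasure_pair_measure_Times[of UNIV m1 UNIV] A.nonzero B.nonzero
      by simp
    show "emeasure (m1 \<Otimes>\<^sub>M m2) C < \<infinity>" if "compact C" for C
    proof -
      have c: "compact (fst ` C)" "compact (snd ` C)"
        using that by (auto intro!: compact_continuous_image continuous_intros)
      have "emeasure (m1 \<Otimes>\<^sub>M m2) C \<le> emeasure (m1 \<Otimes>\<^sub>M m2) (fst ` C \<times> snd ` C)"
        using c by (intro emeasure_mono) (auto simp: borel_compact subset_fst_snd)
      also have "\<dots> = emeasure m1 (fst ` C) * emeasure m2 (snd ` C)"
        using c by (intro B.emeasure_pair_measure_Times) (auto simp: borel_compact)
      also have "\<dots> < \<infinity>"
        using A.emeasure_compact[OF c(1)] B.emeasure_compact[OF c(2)] by (simp add: ennreal_mult_less_top)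
      finally show ?thesis .
    qed
    show "distr (m1 \<Otimes>\<^sub>M m2) borel ((+) g) = m1 \<Otimes>\<^sub>M m2" for g
    proof -
      have "m1 \<Otimes>\<^sub>M m2 = distr m1 borel ((+) (fst g)) \<Otimes>\<^sub>M distr m2 borel ((+) (snd g))"
        by (simp add: A.distr_left B.distr_left)
      also have "\<dots> = distr (m1 \<Otimes>\<^sub>M m2) (borel \<Otimes>\<^sub>M borel) (\<lambda>(x, y). (fst g + x, snd g + y))"
        by (intro pair_measure_distr) (auto simp: B.distr_left B.sigma_finite)
      also have "(\<lambda>(x, y). (fst g + x, snd g + y)) = (+) g"
        by (auto simp: fun_eq_iff plus_prod_def)
      finally show ?thesis by (simp add: borel_prod)
    qed
    show "distr (m1 \<Otimes>\<^sub>M m2) borel (\<lambda>x. x + g) = m1 \<Otimes>\<^sub>M m2" for g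
    proof -
      have "m1 \<Otimes>\<^sub>M m2 = distr m1 borel (\<lambda>x. x + fst g) \<Otimes>\<^sub>M distr m2 borel (\<lambda>x. x + snd g)"
        by (simp add: A.distr_right B.distr_right)
      also have "\<dots> = distr (m1 \<Otimes>\<^sub>M m2) (borel \<Otimes>\<^sub>M borel) (\<lambda>(x, y). (x + fst g, y + snd g))"
        by (intro pair_measure_distr) (auto simp: B.distr_right B.sigma_finite)
      also have "(\<lambda>(x, y). (x + fst g, y + snd g)) = (\<lambda>x. x + g)"
        by (auto simp: fun_eq_iff plus_prod_def)
      finally show ?thesis by (simp add: borel_prod)
    qed
  qed
qed

section \<open>Unfolding integrals over the group along the cosets of a lattice\<close>

lemma diff_add_diff: "(a - b) + (b - c) = a - (c :: 'g::group_add)"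
  by (simp only: diff_conv_add_uminus add.assoc minus_add_cancel)

lemma diff_diff_diff: "(a - b) - (c - b) = a - (c :: 'g::group_add)"
  by (simp only: minus_diff_eq diff_conv_add_uminus[of _ "c - b"] diff_add_diff)

locale lattice_quotient = unimodular_haar m
  for m :: "'g::{topological_group_add,t2_space,second_countable_topology} measure" +
  fixes \<Gamma> :: "'g set" and \<mu> :: "'g set measure"
  assumes subgroup: "subgroup_add \<Gamma>" and discrete: "discrete \<Gamma>"
    and induced: "induced_measure \<Gamma> m \<mu>" and prob: "prob_space \<mu>"
begin

abbreviation pr :: "'g \<Rightarrow> 'g set" where "pr \<equiv> rcoset \<Gamma>"

sublocale prob_space \<mu> by (rule prob)

lemma space_mu [simp]: "space \<mu> = range pr"
  using induced by (simp add: induced_measure_def invariant_measure_def)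

lemma mem_pr: "h \<in> pr x \<longleftrightarrow> h - x \<in> \<Gamma>"
  unfolding rcoset_def by (force simp: image_iff)

lemma pr_eq: "h \<in> pr x \<Longrightarrow> pr h = pr x"
proof -
  assume "h \<in> pr x"
  then have h: "h - x \<in> \<Gamma>" by (simp add: mem_pr)
  show "pr h = pr x"
  proof (intro set_eqI iffI)
    fix y assume "y \<in> pr h"
    then have "(y - h) + (h - x) \<in> \<Gamma>"
      using h subgroup unfolding mem_pr subgroup_add_def by blast
    then show "y \<in> pr x" by (simp add: mem_pr diff_add_diff)
  next
    fix y assume "y \<in> pr x"
    then have "(y - x) + - (h - x) \<in> \<Gamma>"
      using h subgroup unfolding mem_pr subgroup_add_def by blast
    then have "(y - x) + (x - h) \<in> \<Gamma>" by (simp only: minus_diff_eq)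
    then show "y \<in> pr h" by (simp add: mem_pr diff_add_diff)
  qed
qed

lemma self_mem_pr [simp]: "x \<in> pr x"
  using subgroup by (simp add: mem_pr subgroup_add_def)

lemma pr_mem_fibre: "c \<in> range pr \<Longrightarrow> h \<in> c \<Longrightarrow> pr h = c"
  using pr_eq by blast

lemma rshift_pr: "rshift u (pr x) = pr (x + u)"
  unfolding rshift_def rcoset_def by (auto simp: image_iff add.assoc)

lemma rshift_in_space [simp]: "c \<in> range pr \<Longrightarrow> rshift u c \<in> range pr"
  by (auto simp: rshift_pr)

lemma rshift_rshift: "rshift v (rshift u c) = rshift (u + v) (c :: 'g set)"
  unfolding rshift_def by (force simp: image_iff add.assoc)

lemma rshift_0 [simp]: "rshift 0 c = (c :: 'g set)"
  unfolding rshift_def by simp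

text \<open>A neighbourhood of the identity whose difference set meets \<open>\<Gamma>\<close> only in the identity has the
  property that each of its right translates meets every coset at most once; finitely many such
  translates cover a compact set.\<close>

lemma fibre_card_bound:
  assumes "compact L"
  shows "\<exists>n. \<forall>c\<in>range pr. finite (c \<inter> L) \<and> card (c \<inter> L) \<le> n"
proof -
  have "0 \<in> \<Gamma>" using subgroup by (simp add: subgroup_add_def)
  then obtain T where T: "open T" "T \<inter> \<Gamma> = {0}"
    using discrete unfolding discrete_def isolated_in_def by blast
  have "open ((\<lambda>p::'g\<times>'g. fst p - snd p) -` T)"
    using T(1) by (intro open_vimage continuous_intros)
  moreover have "(0,0) \<in> (\<lambda>p::'g\<times>'g. fst p - snd p) -` T" using T(2) by auto
  ultimately obtain A B where AB: "open A" "open B" "0 \<in> A" "0 \<in> B"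
      "A \<times> B \<subseteq> (\<lambda>p::'g\<times>'g. fst p - snd p) -` T"
    by (auto elim!: open_prod_elim)
  define V where "V = A \<inter> B"
  have V: "open V" "0 \<in> V" "\<And>a b. a \<in> V \<Longrightarrow> b \<in> V \<Longrightarrow> a - b \<in> T"
    using AB unfolding V_def by auto
  define W where "W x = (\<lambda>y. y - x) -` V" for x
  have one: "h = h'" if "c \<in> range pr" "h \<in> c" "h' \<in> c" "h \<in> W x" "h' \<in> W x" for c h h' x
  proof -
    have "h' \<in> pr h" using that pr_mem_fibre self_mem_pr by blast
    then have "h' - h \<in> \<Gamma>" by (simp add: mem_pr)
    moreover have "(h' - x) - (h - x) \<in> T" using that V(3) by (auto simp: W_def)
    then have "h' - h \<in> T" by (simp add: diff_diff_diff)
    ultimately have "h' - h = 0" using T(2) by blast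
    then show ?thesis by simp
  qed
  have op: "open (W x)" for x
    unfolding W_def using V(1) by (intro open_vimage continuous_intros)
  have cov: "L \<subseteq> (\<Union>x\<in>L. W x)" using V(2) by (auto simp: W_def)
  obtain I where I: "I \<subseteq> L" "finite I" "L \<subseteq> (\<Union>x\<in>I. W x)"
    by (rule compactE_image[OF assms op cov])
  have "finite (c \<inter> L) \<and> card (c \<inter> L) \<le> card I" if c: "c \<in> range pr" for c
  proof -
    define k where "k h = (SOME x. x \<in> I \<and> h \<in> W x)" for h
    have k: "k h \<in> I \<and> h \<in> W (k h)" if "h \<in> L" for h
    proof -
      have "\<exists>x. x \<in> I \<and> h \<in> W x" using I(3) that by blast
      then show ?thesis unfolding k_def by (rule someI_ex)
    qed
    have inj: "inj_on k (c \<inter> L)"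
    proof (rule inj_onI)
      fix h h' assume "h \<in> c \<inter> L" "h' \<in> c \<inter> L" "k h = k h'"
      then show "h = h'" using one[OF c, of h h' "k h"] k[of h] k[of h'] by auto
    qed
    have sub: "k ` (c \<inter> L) \<subseteq> I" using k by blast
    show ?thesis
      using inj_on_finite[OF inj sub I(2)] card_inj_on_le[OF inj sub I(2)] by blast
  qed
  then show ?thesis by blast
qed

lemma fibre_finite: "compact L \<Longrightarrow> c \<in> range pr \<Longrightarrow> finite (c \<inter> L)"
  using fibre_card_bound by blast

lemma sets_mu: "sets \<mu> = sigma_sets (range pr) {U. openin (quotient_topology pr) U}"
  using induced by (simp add: induced_measure_def invariant_measure_def)

lemma measurable_muI:
  assumes "f \<in> space M \<rightarrow> range pr"
    and "\<And>U. U \<subseteq> range pr \<Longrightarrow> open (pr -` U) \<Longrightarrow> f -` U \<inter> space M \<in> sets M"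
  shows "f \<in> measurable M \<mu>"
  using assms by (intro measurable_sigma_sets[OF sets_mu]) (auto simp: openin_quotient_topology)

lemma open_in_sets_mu: "U \<subseteq> range pr \<Longrightarrow> open (pr -` U) \<Longrightarrow> U \<in> sets \<mu>"
  unfolding sets_mu by (rule sigma_sets.Basic) (simp add: openin_quotient_topology)

lemma measurable_pr [measurable]: "pr \<in> measurable borel \<mu>"
  by (rule measurable_muI) auto

lemma open_pr_image:
  assumes "open W"
  shows "open (pr -` (pr ` W))"
proof -
  have "pr -` (pr ` W) = (\<Union>\<gamma>\<in>\<Gamma>. (\<lambda>x. - \<gamma> + x) -` W)"
  proof (intro set_eqI iffI)
    fix x assume "x \<in> pr -` (pr ` W)"
    then obtain w where w: "w \<in> W" "pr x = pr w" by auto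
    then have "x \<in> pr w" using self_mem_pr[of x] by simp
    then have "x - w \<in> \<Gamma>" by (simp add: mem_pr)
    moreover have "- (x - w) + x = w" by (simp add: minus_diff_eq)
    ultimately show "x \<in> (\<Union>\<gamma>\<in>\<Gamma>. (\<lambda>x. - \<gamma> + x) -` W)" using w(1) by (metis UN_I vimage_eq)
  next
    fix x assume "x \<in> (\<Union>\<gamma>\<in>\<Gamma>. (\<lambda>x. - \<gamma> + x) -` W)"
    then obtain \<gamma> where g: "\<gamma> \<in> \<Gamma>" "- \<gamma> + x \<in> W" by auto
    have "x \<in> pr (- \<gamma> + x)" using g(1) unfolding rcoset_def
      by (auto simp: image_iff add.assoc[symmetric] intro!: bexI[of _ \<gamma>])
    then have "pr x = pr (- \<gamma> + x)" by (rule pr_eq)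
    then show "x \<in> pr -` (pr ` W)" using g(2) by auto
  qed
  moreover have "open (\<Union>\<gamma>\<in>\<Gamma>. (\<lambda>x. - \<gamma> + x) -` W)"
    using assms by (intro open_UN ballI open_vimage continuous_intros)
  ultimately show ?thesis by simp
qed

text \<open>Preimages of open sets under the action are countable unions of products \<open>\<Gamma>W \<times> W'\<close> with \<open>W\<close>,
  \<open>W'\<close> from a countable basis, hence measurable for the product \<open>\<sigma>\<close>-algebra.\<close>

lemma measurable_action [measurable]:
  "(\<lambda>p. rshift (snd p) (fst p)) \<in> measurable (\<mu> \<Otimes>\<^sub>M borel) \<mu>"
proof (rule measurable_muI)
  show "(\<lambda>p. rshift (snd p) (fst p)) \<in> space (\<mu> \<Otimes>\<^sub>M borel) \<rightarrow> range pr"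
    by (auto simp: space_pair_measure rshift_pr)
  fix U assume U: "U \<subseteq> range pr" "open (pr -` U)"
  obtain B :: "'g set set" where B: "countable B" "topological_basis B"
    using ex_countable_basis by blast
  define I where "I = {(W, W'). W \<in> B \<and> W' \<in> B \<and> (\<forall>x\<in>W. \<forall>y\<in>W'. pr (x + y) \<in> U)}"
  have "countable I"
    by (rule countable_subset[of _ "B \<times> B"]) (use B(1) in \<open>auto simp: I_def\<close>)
  have opB: "open W" if "W \<in> B" for W using B(2) that by (simp add: topological_basis_open)
  have eq: "(\<lambda>p. rshift (snd p) (fst p)) -` U \<inter> space (\<mu> \<Otimes>\<^sub>M borel)
      = (\<Union>(W, W')\<in>I. (pr ` W) \<times> W')"
  proof (intro set_eqI iffI)
    fix p assume "p \<in> (\<lambda>p. rshift (snd p) (fst p)) -` U \<inter> space (\<mu> \<Otimes>\<^sub>M borel)"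
    then obtain x u where p: "p = (pr x, u)" "pr (x + u) \<in> U"
      by (auto simp: space_pair_measure rshift_pr)
    have "open ((\<lambda>q::'g\<times>'g. fst q + snd q) -` (pr -` U))"
      using U(2) by (intro open_vimage continuous_intros)
    moreover have "(x,u) \<in> (\<lambda>q::'g\<times>'g. fst q + snd q) -` (pr -` U)" using p by auto
    ultimately obtain S T where ST: "open S" "open T" "x \<in> S" "u \<in> T"
        "S \<times> T \<subseteq> (\<lambda>q::'g\<times>'g. fst q + snd q) -` (pr -` U)"
      by (auto elim!: open_prod_elim)
    obtain W where W: "W \<in> B" "x \<in> W" "W \<subseteq> S"
      using topological_basisE[OF B(2) ST(1,3)] .
    obtain W' where W': "W' \<in> B" "u \<in> W'" "W' \<subseteq> T"
      using topological_basisE[OF B(2) ST(2,4)] .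
    have "pr (y + z) \<in> U" if "y \<in> W" "z \<in> W'" for y z
    proof -
      have "(y, z) \<in> S \<times> T" using that W W' by auto
      then show ?thesis using ST(5) by auto
    qed
    then have "(W, W') \<in> I" unfolding I_def using W W' by auto
    then show "p \<in> (\<Union>(W, W')\<in>I. (pr ` W) \<times> W')" using p(1) W(2) W'(2) by blast
  next
    fix p assume "p \<in> (\<Union>(W, W')\<in>I. (pr ` W) \<times> W')"
    then obtain W W' x u where p: "(W, W') \<in> I" "p = (pr x, u)" "x \<in> W" "u \<in> W'" by blast
    then have "pr (x + u) \<in> U" unfolding I_def by blast
    then show "p \<in> (\<lambda>p. rshift (snd p) (fst p)) -` U \<inter> space (\<mu> \<Otimes>\<^sub>M borel)"
      using p by (auto simp: space_pair_measure rshift_pr)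
  qed
  have "(case p of (W, W') \<Rightarrow> (pr ` W) \<times> W') \<in> sets (\<mu> \<Otimes>\<^sub>M borel)" if "p \<in> I" for p
    using that open_in_sets_mu[OF _ open_pr_image] opB
    by (auto simp: I_def intro!: pair_measureI)
  then have "(\<Union>p\<in>I. case p of (W, W') \<Rightarrow> (pr ` W) \<times> W') \<in> sets (\<mu> \<Otimes>\<^sub>M borel)"
    using \<open>countable I\<close> by (intro sets.countable_UN') auto
  then show "(\<lambda>p. rshift (snd p) (fst p)) -` U \<inter> space (\<mu> \<Otimes>\<^sub>M borel) \<in> sets (\<mu> \<Otimes>\<^sub>M borel)"
    unfolding eq .
qed

lemma measurable_rshift [measurable]:
  assumes "f \<in> measurable M \<mu>" "h \<in> borel_measurable M"
  shows "(\<lambda>x. rshift (h x) (f x)) \<in> measurable M \<mu>"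
proof -
  have "(\<lambda>x. (f x, h x)) \<in> measurable M (\<mu> \<Otimes>\<^sub>M borel)" using assms by (rule measurable_Pair)
  from measurable_compose[OF this measurable_action] show ?thesis by simp
qed

lemma distr_rshift: "distr \<mu> \<mu> (rshift u) = \<mu>"
proof (rule measure_eqI)
  fix A assume "A \<in> sets (distr \<mu> \<mu> (rshift u))"
  then have A: "A \<in> sets \<mu>" by simp
  then have sub: "A \<subseteq> range pr" using sets.sets_into_space by fastforce
  have [measurable]: "rshift u \<in> measurable \<mu> \<mu>" by measurable
  have eq: "rshift u -` A \<inter> space \<mu> = rshift (- u) ` A"
  proof (intro set_eqI iffI)
    fix c assume "c \<in> rshift u -` A \<inter> space \<mu>"
    then have "rshift u c \<in> A" "c = rshift (- u) (rshift u c)" by (auto simp: rshift_rshift)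
    then show "c \<in> rshift (- u) ` A" by blast
  next
    fix c assume "c \<in> rshift (- u) ` A"
    then show "c \<in> rshift u -` A \<inter> space \<mu>" using sub by (auto simp: rshift_rshift)
  qed
  show "emeasure (distr \<mu> \<mu> (rshift u)) A = emeasure \<mu> A"
    using A induced
    by (subst emeasure_distr) (auto simp: eq[simplified] induced_measure_def invariant_measure_def)
qed simp

lemma nn_integral_rshift:
  assumes [measurable]: "f \<in> borel_measurable \<mu>"
  shows "(\<integral>\<^sup>+c. f (rshift u c) \<partial>\<mu>) = (\<integral>\<^sup>+c. f c \<partial>\<mu>)"
proof -
  have "(\<integral>\<^sup>+c. f c \<partial>\<mu>) = (\<integral>\<^sup>+c. f c \<partial>distr \<mu> \<mu> (rshift u))" by (simp add: distr_rshift)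
  also have "\<dots> = (\<integral>\<^sup>+c. f (rshift u c) \<partial>\<mu>)" by (intro nn_integral_distr) auto
  finally show ?thesis by simp
qed

lemma integral_rshift:
  fixes f :: "'g set \<Rightarrow> complex"
  assumes [measurable]: "f \<in> borel_measurable \<mu>"
  shows "(LINT c|\<mu>. f (rshift u c)) = (LINT c|\<mu>. f c)"
proof -
  have "(LINT c|\<mu>. f c) = (LINT c|distr \<mu> \<mu> (rshift u). f c)" by (simp add: distr_rshift)
  also have "\<dots> = (LINT c|\<mu>. f (rshift u c))" by (intro integral_distr) auto
  finally show ?thesis by simp
qed

text \<open>The unfolding formula and the measurability that it presupposes are carried through the
  approximation arguments together.\<close>

definition unfolds :: "('g \<Rightarrow> ennreal) \<Rightarrow> bool" where
  "unfolds f \<longleftrightarrow> (\<lambda>c. \<integral>\<^sup>+h. f h \<partial>count_space c) \<in> borel_measurable \<mu> \<and>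
     (\<integral>\<^sup>+c. (\<integral>\<^sup>+h. f h \<partial>count_space c) \<partial>\<mu>) = (\<integral>\<^sup>+x. f x \<partial>m)"

lemma fibre_sum_Cc:
  fixes f :: "'g \<Rightarrow> real"
  assumes f: "f \<in> Cc" "\<And>y. 0 \<le> f y" and c: "c \<in> range pr"
  shows "(\<integral>\<^sup>+h. ennreal (f h) \<partial>count_space c) = ennreal (\<Sum>h\<in>c \<inter> supp f. f h)"
proof -
  have "finite (c \<inter> supp f)" using f(1) c by (intro fibre_finite) (auto simp: Cc_def)
  then have "(\<integral>\<^sup>+h. ennreal (f h) \<partial>count_space c) = (\<Sum>h\<in>c \<inter> supp f. ennreal (f h))"
    using zero_outside_supp[of _ f] by (intro nn_integral_count_space') auto
  also have "\<dots> = ennreal (\<Sum>h\<in>c \<inter> supp f. f h)"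
    using f(2) by (intro sum_ennreal) auto
  finally show ?thesis .
qed

text \<open>Measurability comes for free here: a Bochner integral with a non-zero value can only be that of
  a measurable function.\<close>

lemma unfolds_Cc:
  fixes f :: "'g \<Rightarrow> real"
  assumes f: "f \<in> Cc" "\<And>y. 0 \<le> f y"
  shows "unfolds (\<lambda>x. ennreal (f x))"
proof (cases "\<forall>x. f x = 0")
  case True
  then show ?thesis by (simp add: unfolds_def)
next
  case False
  then obtain x where x: "f x > 0" using f(2) by (metis less_eq_real_def)
  have contf: "continuous_on UNIV f" and cs: "compact (supp f)" using f(1) by (auto simp: Cc_def)
  have [measurable]: "f \<in> borel_measurable borel"
    using contf by (rule borel_measurable_continuous_onI)
  define s where "s c = (\<Sum>h\<in>c \<inter> supp f. f h)" for c
  let ?F = "\<lambda>x. complex_of_real (f x)"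
  have supp_eq: "supp ?F = supp f" by (simp add: supp_def)
  have "?F \<in> Cc"
    using cs contf unfolding Cc_def mem_Collect_eq supp_eq by (auto intro!: continuous_intros)
  then have eq: "(LINT c|\<mu>. (\<Sum>\<^sub>\<infinity>x\<in>c. ?F x)) = (LINT g|m. ?F g)"
    using induced by (simp add: induced_measure_def)
  have inf: "(\<Sum>\<^sub>\<infinity>x\<in>c. ?F x) = complex_of_real (s c)" if "c \<in> range pr" for c
  proof -
    have "(\<Sum>\<^sub>\<infinity>x\<in>c. ?F x) = (\<Sum>\<^sub>\<infinity>x\<in>c \<inter> supp f. ?F x)"
      using zero_outside_supp[of _ f] by (intro infsum_cong_neutral) auto
    also have "\<dots> = (\<Sum>x\<in>c \<inter> supp f. ?F x)"
      using fibre_finite[OF cs that] by (rule infsum_finite)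
    finally show ?thesis by (simp add: s_def)
  qed
  have "(LINT c|\<mu>. (\<Sum>\<^sub>\<infinity>x\<in>c. ?F x)) = (LINT c|\<mu>. complex_of_real (s c))"
    by (intro Bochner_Integration.integral_cong refl) (simp add: inf)
  then have eq2: "complex_of_real (LINT c|\<mu>. s c) = complex_of_real (LINT g|m. f g)"
    using eq by simp
  then have eq3: "(LINT c|\<mu>. s c) = (LINT g|m. f g)" using of_real_eq_iff by blast
  have nn: "(\<integral>\<^sup>+x. ennreal (f x) \<partial>m) = ennreal (LINT g|m. f g)"
    using integrable_Cc[OF f(1)] f(2) by (intro nn_integral_eq_integral) auto
  have "emeasure m {x. f x > 0} > 0"
    using x by (intro emeasure_open_pos open_Collect_less continuous_intros contf) auto
  then have "(\<integral>\<^sup>+x. ennreal (f x) \<partial>m) \<noteq> 0"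
    using f(2) by (subst nn_integral_0_iff) (auto simp: less_le)
  then have "(LINT c|\<mu>. s c) \<noteq> 0" using nn eq3 by auto
  then have int: "integrable \<mu> s" using not_integrable_integral_eq by blast
  have s0: "0 \<le> s c" for c unfolding s_def using f(2) by (simp add: sum_nonneg)
  have fs: "(\<integral>\<^sup>+h. ennreal (f h) \<partial>count_space c) = ennreal (s c)" if "c \<in> space \<mu>" for c
    using fibre_sum_Cc[OF f, of c] that by (simp add: s_def)
  have "(\<integral>\<^sup>+c. (\<integral>\<^sup>+h. ennreal (f h) \<partial>count_space c) \<partial>\<mu>) = (\<integral>\<^sup>+c. ennreal (s c) \<partial>\<mu>)"
    by (intro nn_integral_cong fs)
  also have "\<dots> = ennreal (LINT c|\<mu>. s c)"
    using int s0 by (intro nn_integral_eq_integral) auto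
  finally have "(\<integral>\<^sup>+c. (\<integral>\<^sup>+h. ennreal (f h) \<partial>count_space c) \<partial>\<mu>) = (\<integral>\<^sup>+x. ennreal (f x) \<partial>m)"
    using nn eq3 by simp
  moreover have "(\<lambda>c. \<integral>\<^sup>+h. ennreal (f h) \<partial>count_space c) \<in> borel_measurable \<mu>"
    using int by (subst measurable_cong[OF fs]) auto
  ultimately show ?thesis by (simp add: unfolds_def)
qed

lemma unfolds_SUP:
  assumes "\<And>n. unfolds (f n)" "\<And>n. f n \<in> borel_measurable m" "incseq f"
  shows "unfolds (\<lambda>x. SUP n::nat. f n x)"
proof -
  have inc: "incseq (\<lambda>n c. \<integral>\<^sup>+h. f n h \<partial>count_space c)"
    using assms(3) by (auto simp: incseq_def le_fun_def intro!: nn_integral_mono)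
  have eq: "(\<integral>\<^sup>+h. (SUP n. f n h) \<partial>count_space c) = (SUP n. \<integral>\<^sup>+h. f n h \<partial>count_space c)" for c
    using assms(3) by (intro nn_integral_monotone_convergence_SUP) auto
  have [measurable]: "\<And>n. (\<lambda>c. \<integral>\<^sup>+h. f n h \<partial>count_space c) \<in> borel_measurable \<mu>"
    using assms(1) by (simp add: unfolds_def)
  have "(\<integral>\<^sup>+c. (\<integral>\<^sup>+h. (SUP n. f n h) \<partial>count_space c) \<partial>\<mu>)
      = (SUP n. \<integral>\<^sup>+c. (\<integral>\<^sup>+h. f n h \<partial>count_space c) \<partial>\<mu>)"
    unfolding eq using inc by (intro nn_integral_monotone_convergence_SUP) auto
  also have "\<dots> = (SUP n. \<integral>\<^sup>+x. f n x \<partial>m)"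
    using assms(1) by (simp add: unfolds_def)
  also have "\<dots> = (\<integral>\<^sup>+x. (SUP n. f n x) \<partial>m)"
    using assms(2,3) by (intro nn_integral_monotone_convergence_SUP[symmetric]) auto
  finally show ?thesis by (simp add: unfolds_def eq)
qed

lemma unfolds_suminf:
  assumes "\<And>n. unfolds (f n)" "\<And>n. f n \<in> borel_measurable m"
  shows "unfolds (\<lambda>x. \<Sum>n::nat. f n x)"
proof -
  have [measurable]: "\<And>n. (\<lambda>c. \<integral>\<^sup>+h. f n h \<partial>count_space c) \<in> borel_measurable \<mu>"
    using assms(1) by (simp add: unfolds_def)
  have eq: "(\<integral>\<^sup>+h. (\<Sum>n. f n h) \<partial>count_space c) = (\<Sum>n. \<integral>\<^sup>+h. f n h \<partial>count_space c)" for c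
    by (intro nn_integral_suminf) auto
  have "(\<integral>\<^sup>+c. (\<integral>\<^sup>+h. (\<Sum>n. f n h) \<partial>count_space c) \<partial>\<mu>)
      = (\<Sum>n. \<integral>\<^sup>+c. (\<integral>\<^sup>+h. f n h \<partial>count_space c) \<partial>\<mu>)"
    unfolding eq by (intro nn_integral_suminf) auto
  also have "\<dots> = (\<Sum>n. \<integral>\<^sup>+x. f n x \<partial>m)"
    using assms(1) by (simp add: unfolds_def)
  also have "\<dots> = (\<integral>\<^sup>+x. (\<Sum>n. f n x) \<partial>m)"
    using assms(2) by (intro nn_integral_suminf[symmetric]) auto
  finally show ?thesis by (simp add: unfolds_def eq)
qed

lemma unfolds_Cc_positive_set:
  fixes f :: "'g \<Rightarrow> real"
  assumes f: "f \<in> Cc" "\<And>y. 0 \<le> f y"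
  shows "unfolds (indicator {x. f x > 0})"
proof -
  define g where "g n x = min 1 (real n * f x)" for n x
  have g0: "0 \<le> g n x" for n x using f(2) by (simp add: g_def)
  have contf: "continuous_on UNIV f" and cs: "compact (supp f)" using f(1) by (auto simp: Cc_def)
  have "g n \<in> Cc" for n
  proof -
    have "supp (g n) \<subseteq> supp f"
      unfolding supp_def g_def by (intro closure_mono) auto
    then have "compact (supp (g n))"
      using cs unfolding supp_def by (metis closed_closure compact_Int_closed inf.absorb_iff2)
    moreover have "continuous_on UNIV (g n)"
      unfolding g_def using contf by (intro continuous_intros)
    ultimately show ?thesis by (simp add: Cc_def)
  qed
  then have gu: "unfolds (\<lambda>x. ennreal (g n x))" and
      gm: "(\<lambda>x. ennreal (g n x)) \<in> borel_measurable m" for n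
    using g0 by (auto intro!: unfolds_Cc borel_measurable_continuous_onI measurable_compose[OF _ measurable_ennreal]
        simp: Cc_def measurable_cong_sets[OF sets_m refl])
  have "incseq (\<lambda>n x. ennreal (g n x))"
  proof (rule incseq_SucI, rule le_funI)
    fix n x
    have "real n * f x \<le> real (Suc n) * f x" using f(2) by (intro mult_right_mono) auto
    then show "ennreal (g n x) \<le> ennreal (g (Suc n) x)" unfolding g_def by (intro ennreal_leI) linarith
  qed
  then have "unfolds (\<lambda>x. SUP n. ennreal (g n x))"
    by (rule unfolds_SUP[OF gu gm])
  moreover have "(SUP n. ennreal (g n x)) = indicator {x. f x > 0} x" for x
  proof (cases "f x > 0")
    case True
    then obtain n where "1 < real n * f x" using reals_Archimedean3 by blast
    then have "ennreal (g n x) = 1" by (simp add: g_def)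
    moreover have "ennreal (g k x) \<le> 1" for k by (simp add: g_def)
    ultimately have "(SUP n. ennreal (g n x)) = 1"
      by (intro antisym SUP_least) (auto intro: SUP_upper2[of n])
    then show ?thesis using True by simp
  next
    case False
    then have "f x = 0" using f(2)[of x] by simp
    then show ?thesis by (simp add: g_def)
  qed
  ultimately show ?thesis by (simp add: fun_eq_iff[symmetric] cong: if_cong)
qed

end

text \<open>A finite sum whenever \<open>\<Phi>\<close> vanishes outside a compact set; restricting the summation to the support
  allows plain finite sums instead of infinite ones.\<close>

definition periodize :: "('g \<Rightarrow> complex) \<Rightarrow> 'g set \<Rightarrow> complex" where
  "periodize \<Phi> c = (\<Sum>h\<in>{h\<in>c. \<Phi> h \<noteq> 0}. \<Phi> h)"

lemma Cc_mult:
  fixes f g :: "'g::t2_space \<Rightarrow> real"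
  assumes "f \<in> Cc" "g \<in> Cc"
  shows "(\<lambda>x. f x * g x) \<in> Cc"
proof -
  have c: "continuous_on UNIV f" "continuous_on UNIV g" "compact (supp f)"
    using assms by (auto simp: Cc_def)
  have "supp (\<lambda>x. f x * g x) \<subseteq> supp f" unfolding supp_def by (intro closure_mono) auto
  then have "supp (\<lambda>x. f x * g x) = supp f \<inter> supp (\<lambda>x. f x * g x)" by blast
  also have "compact \<dots>" using c(3) by (intro compact_Int_closed) (auto simp: supp_def)
  finally show ?thesis using c(1,2) by (simp add: Cc_def continuous_on_mult)
qed

lemma positive_Int:
  fixes f g :: "'a \<Rightarrow> real"
  assumes "\<And>x. 0 \<le> f x" "\<And>x. 0 \<le> g x"
  shows "{x. f x > 0} \<inter> {x. g x > 0} = {x. f x * g x > 0}"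
proof -
  have "0 < f x \<and> 0 < g x \<longleftrightarrow> 0 < f x * g x" for x
    using assms(1)[of x] assms(2)[of x] by (simp add: zero_less_mult_iff)
  then show ?thesis by blast
qed

context lattice_quotient
begin

lemma sigma_sets_Cc_positive_sets:
  "sigma_sets UNIV {{x. f x > 0} | f :: 'g \<Rightarrow> real. f \<in> Cc \<and> (\<forall>y. 0 \<le> f y)} = sets borel"
  (is "sigma_sets UNIV ?G = _")
proof
  have op: "open U" if "U \<in> ?G" for U
    using that by (auto simp: Cc_def intro!: open_Collect_less continuous_intros)
  then have "?G \<subseteq> sets borel" by (intro subsetI borel_open)
  from sets.sigma_sets_subset[OF this] show "sigma_sets UNIV ?G \<subseteq> sets borel" by simp
  have "U \<in> sigma_sets UNIV ?G" if "open U" for U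
  proof -
    define \<F> where "\<F> = {V \<in> ?G. V \<subseteq> U}"
    have "\<exists>V\<in>\<F>. x \<in> V" if "x \<in> U" for x
    proof -
      obtain f :: "'g \<Rightarrow> real" where f: "f \<in> Cc" "\<And>y. 0 \<le> f y" "f x > 0" "{y. f y \<noteq> 0} \<subseteq> U"
        using Cc_bump[OF lc \<open>open U\<close> \<open>x \<in> U\<close>] by metis
      have "{x. f x > 0} \<in> ?G" using f(1,2) by blast
      moreover have "{x. f x > 0} \<subseteq> U" using f(4) by (intro order_trans[OF _ f(4)]) auto
      ultimately have "{x. f x > 0} \<in> \<F>" by (simp only: \<F>_def mem_Collect_eq)
      then show ?thesis by (rule bexI[rotated]) (simp add: f(3))
    qed
    then have "U \<subseteq> \<Union>\<F>" by (intro subsetI) (simp only: Union_iff)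
    moreover have "\<Union>\<F> \<subseteq> U" by (rule Union_least) (simp add: \<F>_def)
    ultimately have un: "\<Union>\<F> = U" by (intro equalityI)
    have FG: "\<F> \<subseteq> ?G" unfolding \<F>_def by (rule Collect_subset)
    have "open S" if "S \<in> \<F>" for S using op subsetD[OF FG that] .
    then obtain \<F>' where F: "\<F>' \<subseteq> \<F>" "countable \<F>'" "\<Union>\<F>' = \<Union>\<F>"
      by (rule Lindelof)
    have "\<Union>\<F>' \<in> sigma_sets UNIV ?G"
    proof (rule sigma_algebra.countable_Union[OF sigma_algebra_sigma_sets])
      show "?G \<subseteq> Pow UNIV" by simp
      show "\<F>' \<subseteq> sigma_sets UNIV ?G"
        using order_trans[OF F(1) FG] by (rule order_trans) (rule sigma_sets_superset_generator)
    qed (rule F(2))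
    then show ?thesis using F(3) un by simp
  qed
  then have "{S. open S} \<subseteq> sigma_sets UNIV ?G" by (intro subsetI) simp
  then have "sigma_sets UNIV {S::'g set. open S} \<subseteq> sigma_sets UNIV ?G"
    by (intro sigma_algebra.sigma_sets_subset[OF sigma_algebra_sigma_sets]) auto
  then show "sets borel \<subseteq> sigma_sets UNIV ?G"
    unfolding borel_def by (simp add: sets_measure_of)
qed

lemma fibre_indicator_finite:
  assumes "compact L" "A \<subseteq> L" "c \<in> range pr"
  shows "(\<integral>\<^sup>+h. indicator A h \<partial>count_space c) < top"
proof -
  have fin: "finite (c \<inter> L)" using assms by (intro fibre_finite)
  have "(\<integral>\<^sup>+h. indicator A h \<partial>count_space c) = (\<Sum>h\<in>c \<inter> L. indicator A h :: ennreal)"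
    using fin assms(2) by (intro nn_integral_count_space') (auto simp: indicator_def)
  also have "\<dots> = ennreal (\<Sum>h\<in>c \<inter> L. indicator A h)"
    by (subst sum_ennreal[symmetric]) (auto simp: ennreal_indicator)
  finally show ?thesis by simp
qed

text \<open>The Dynkin argument needs complements, hence subtraction of fibre sums, which is possible only
  where these are finite.  It is therefore carried out inside a relatively compact open set.\<close>

lemma unfolds_indicator_Int:
  fixes g :: "'g \<Rightarrow> real"
  assumes g: "g \<in> Cc" "\<And>y. 0 \<le> g y" and A: "A \<in> sets borel"
  shows "unfolds (indicator (A \<inter> {x. g x > 0}))"
proof -
  let ?W = "{x. g x > 0}"
  let ?G = "{{x. f x > 0} | f :: 'g \<Rightarrow> real. f \<in> Cc \<and> (\<forall>y. 0 \<le> f y)}"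
  have cg: "continuous_on UNIV g" "compact (supp g)" using g(1) by (auto simp: Cc_def)
  have W: "open ?W" by (intro open_Collect_less continuous_intros cg)
  then have [measurable]: "?W \<in> sets borel" by simp
  have Wsub: "?W \<subseteq> supp g" using zero_outside_supp[of _ g] by force
  have stable: "Int_stable ?G"
  proof (rule Int_stableI)
    fix a b assume "a \<in> ?G" "b \<in> ?G"
    then obtain f1 f2 :: "'g \<Rightarrow> real" where f: "a = {x. f1 x > 0}" "f1 \<in> Cc" "\<forall>y. 0 \<le> f1 y"
      "b = {x. f2 x > 0}" "f2 \<in> Cc" "\<forall>y. 0 \<le> f2 y" by blast
    have "a \<inter> b = {x. f1 x * f2 x > 0}"
      unfolding f(1,4) using f(3,6) by (intro positive_Int) auto
    moreover have "\<forall>y. 0 \<le> f1 y * f2 y" using f(3,6) by simp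
    ultimately show "a \<inter> b \<in> ?G"
      using Cc_mult[OF f(2,5)] by (intro CollectI exI[of _ "\<lambda>x. f1 x * f2 x"] conjI)
  qed
  have base: "unfolds (indicator ({x. f x > 0} \<inter> ?W))"
    if "f \<in> Cc" "\<forall>y. 0 \<le> f y" for f :: "'g \<Rightarrow> real"
  proof -
    have "{x. f x > 0} \<inter> ?W = {x. f x * g x > 0}"
      using that(2) g(2) by (intro positive_Int) auto
    then show ?thesis
      using that(2) g(2) by (auto intro!: unfolds_Cc_positive_set Cc_mult that(1) g(1))
  qed
  have WW: "unfolds (indicator ?W)" by (rule unfolds_Cc_positive_set[OF g])
  have closed: "?G \<subseteq> Pow UNIV" by simp
  from A have mem: "A \<in> sigma_sets UNIV ?G" by (simp add: sigma_sets_Cc_positive_sets)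
  from stable closed mem show ?thesis
  proof (induction rule: sigma_sets_induct_disjoint)
    case (basic A)
    then show ?case using base by blast
  next
    case empty
    then show ?case by (simp add: unfolds_def)
  next
    case (compl A)
    have [measurable]: "A \<in> sets borel" using compl(1) by (simp add: sigma_sets_Cc_positive_sets)
    have ind: "indicator ((UNIV - A) \<inter> ?W) x = (indicator ?W x - indicator (A \<inter> ?W) x :: ennreal)" for x
      by (auto simp: indicator_def)
    have m1 [measurable]: "(\<lambda>c. \<integral>\<^sup>+h. indicator ?W h \<partial>count_space c) \<in> borel_measurable \<mu>"
      and m2 [measurable]: "(\<lambda>c. \<integral>\<^sup>+h. indicator (A \<inter> ?W) h \<partial>count_space c) \<in> borel_measurable \<mu>"
      using WW compl by (auto simp: unfolds_def)
    have eq: "(\<integral>\<^sup>+h. indicator ((UNIV - A) \<inter> ?W) h \<partial>count_space c) =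
        (\<integral>\<^sup>+h. indicator ?W h \<partial>count_space c) - (\<integral>\<^sup>+h. indicator (A \<inter> ?W) h \<partial>count_space c)"
      if "c \<in> space \<mu>" for c
    proof -
      have "A \<inter> ?W \<subseteq> supp g" using Wsub by blast
      then have "(\<integral>\<^sup>+h. indicator (A \<inter> ?W) h \<partial>count_space c) < top"
        using that by (intro fibre_indicator_finite[OF cg(2)]) simp_all
      then show ?thesis
        unfolding ind by (intro nn_integral_diff) (auto simp: indicator_def)
    qed
    have "emeasure m (A \<inter> ?W) \<le> emeasure m (supp g)"
      using Wsub cg(2) by (intro emeasure_mono) (auto simp: borel_compact)
    then have fin: "emeasure m (A \<inter> ?W) < top"
      using emeasure_compact[OF cg(2)] by (auto simp: less_top[symmetric] top_unique)
    have iA: "(\<integral>\<^sup>+c. (\<integral>\<^sup>+h. indicator (A \<inter> ?W) h \<partial>count_space c) \<partial>\<mu>) = emeasure m (A \<inter> ?W)"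
      using compl by (simp add: unfolds_def)
    have iW: "(\<integral>\<^sup>+c. (\<integral>\<^sup>+h. indicator ?W h \<partial>count_space c) \<partial>\<mu>) = emeasure m ?W"
      using WW by (simp add: unfolds_def)
    have "(\<integral>\<^sup>+c. (\<integral>\<^sup>+h. indicator ((UNIV - A) \<inter> ?W) h \<partial>count_space c) \<partial>\<mu>)
       = (\<integral>\<^sup>+c. (\<integral>\<^sup>+h. indicator ?W h \<partial>count_space c) - (\<integral>\<^sup>+h. indicator (A \<inter> ?W) h \<partial>count_space c) \<partial>\<mu>)"
      by (intro nn_integral_cong eq)
    also have "\<dots> = emeasure m ?W - emeasure m (A \<inter> ?W)"
      unfolding iA[symmetric] iW[symmetric] using iA fin
      by (intro nn_integral_diff AE_I2 nn_integral_mono m1 m2) (auto split: split_indicator)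
    also have "\<dots> = emeasure m (?W - A \<inter> ?W)"
      using fin by (intro emeasure_Diff[symmetric]) auto
    also have "?W - A \<inter> ?W = (UNIV - A) \<inter> ?W" by auto
    finally have i: "(\<integral>\<^sup>+c. (\<integral>\<^sup>+h. indicator ((UNIV - A) \<inter> ?W) h \<partial>count_space c) \<partial>\<mu>)
        = (\<integral>\<^sup>+x. indicator ((UNIV - A) \<inter> ?W) x \<partial>m)" by simp
    have "(\<lambda>c. \<integral>\<^sup>+h. indicator ((UNIV - A) \<inter> ?W) h \<partial>count_space c) \<in> borel_measurable \<mu>"
      by (subst measurable_cong[OF eq]) auto
    with i show ?case unfolding unfolds_def by blast
  next
    case (union A)
    have [measurable]: "A i \<in> sets borel" for i
      using union(2) by (auto simp: sigma_sets_Cc_positive_sets)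
    have "disjoint_family (\<lambda>i. A i \<inter> ?W)" using union(1) by (auto simp: disjoint_family_on_def)
    from suminf_indicator[OF this]
    have "indicator ((\<Union>i. A i) \<inter> ?W) = (\<lambda>x. \<Sum>i. indicator (A i \<inter> ?W) x :: ennreal)"
      by (simp add: fun_eq_iff)
    then show ?case using union(3) by (simp add: unfolds_suminf)
  qed
qed

lemma unfolds_indicator:
  assumes [measurable]: "A \<in> sets borel"
  shows "unfolds (indicator A)"
proof -
  have "\<forall>x. \<exists>f :: 'g \<Rightarrow> real. f \<in> Cc \<and> (\<forall>y. 0 \<le> f y) \<and> f x > 0"
    using Cc_bump[OF lc open_UNIV UNIV_I] by metis
  then obtain f :: "'g \<Rightarrow> 'g \<Rightarrow> real" where
    f: "\<And>x. f x \<in> Cc" "\<And>x y. 0 \<le> f x y" "\<And>x. f x x > 0" by metis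
  let ?W = "\<lambda>x. {y. f x y > 0}"
  have op: "open (?W x)" for x
    using f(1)[of x] by (auto simp: Cc_def intro!: open_Collect_less continuous_intros)
  obtain \<F> where F: "\<F> \<subseteq> range ?W" "countable \<F>" "\<Union>\<F> = \<Union>(range ?W)"
    using Lindelof[of "range ?W"] op by (metis (no_types, lifting) imageE)
  have un: "\<Union>\<F> = UNIV" unfolding F(3) using f(3) by blast
  then have "\<F> \<noteq> {}" by auto
  define V where "V = from_nat_into \<F>"
  have rV: "range V = \<F>" unfolding V_def using \<open>\<F> \<noteq> {}\<close> F(2) by (simp add: range_from_nat_into)
  have V: "\<exists>x. V i = ?W x" for i using F(1) rV by blast
  have Vm [measurable]: "V i \<in> sets borel" for i using V[of i] op by auto
  let ?D = "\<lambda>i. A \<inter> disjointed V i"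
  have "range (disjointed V) \<subseteq> sets borel"
    using Vm by (intro sets.range_disjointed_sets) auto
  then have Dm [measurable]: "disjointed V i \<in> sets borel" for i by blast
  have "unfolds (indicator (?D i))" for i
  proof -
    obtain x where "V i = ?W x" using V by blast
    then have "?D i = ?D i \<inter> ?W x" using disjointed_subset[of V i] by blast
    then show ?thesis using unfolds_indicator_Int[OF f(1) f(2), of "?D i" x] by simp
  qed
  then have "unfolds (\<lambda>x. \<Sum>i. indicator (?D i) x)" by (rule unfolds_suminf) auto
  moreover have "disjoint_family ?D"
    using disjoint_family_disjointed[of V] by (auto simp: disjoint_family_on_def)
  from suminf_indicator[OF this] have "(\<lambda>x. \<Sum>i. indicator (?D i) x :: ennreal) = indicator A"
    using un rV UN_disjointed_eq[of V] by (simp add: fun_eq_iff Int_UN_distrib[symmetric])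
  ultimately show ?thesis by simp
qed

theorem unfolds_nn_integral:
  assumes "f \<in> borel_measurable m"
  shows "unfolds f"
  using assms
proof (induction rule: borel_measurable_induct)
  case (cong f g)
  then have "f = g" by auto
  then show ?case using cong by simp
next
  case (set A)
  then show ?case by (simp add: unfolds_indicator)
next
  case (mult u c)
  then have [measurable]: "(\<lambda>c. \<integral>\<^sup>+h. u h \<partial>count_space c) \<in> borel_measurable \<mu>"
    by (simp add: unfolds_def)
  show ?case using mult by (simp add: unfolds_def nn_integral_cmult)
next
  case (add u v)
  then have [measurable]: "(\<lambda>c. \<integral>\<^sup>+h. u h \<partial>count_space c) \<in> borel_measurable \<mu>"
      "(\<lambda>c. \<integral>\<^sup>+h. v h \<partial>count_space c) \<in> borel_measurable \<mu>"
    by (auto simp: unfolds_def)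
  show ?case using add by (simp add: unfolds_def nn_integral_add)
next
  case (seq U)
  then have "unfolds (\<lambda>x. SUP n. U n x)" by (intro unfolds_SUP)
  then show ?case by (simp add: image_image SUP_apply[abs_def])
qed

lemma measurable_fibre_integral [measurable]:
  "f \<in> borel_measurable borel \<Longrightarrow> (\<lambda>c. \<integral>\<^sup>+h. f h \<partial>count_space c) \<in> borel_measurable \<mu>"
  using unfolds_nn_integral[of f] by (simp add: unfolds_def measurable_cong_sets[OF sets_m refl])

lemma nn_unfold:
  "f \<in> borel_measurable borel \<Longrightarrow>
    (\<integral>\<^sup>+x. f x \<partial>m) = (\<integral>\<^sup>+c. (\<integral>\<^sup>+h. f h \<partial>count_space c) \<partial>\<mu>)"
  using unfolds_nn_integral[of f] by (simp add: unfolds_def measurable_cong_sets[OF sets_m refl])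

text \<open>A function that factors through the quotient is constant on the fibres, and each fibre meets a
  compact set in a bounded number of points.\<close>

lemma nn_unfold_compact:
  assumes L: "compact L"
  obtains n :: nat where "\<And>f :: 'g set \<Rightarrow> ennreal. f \<in> borel_measurable \<mu> \<Longrightarrow>
    (\<integral>\<^sup>+x. f (pr x) * indicator L x \<partial>m) \<le> of_nat n * (\<integral>\<^sup>+c. f c \<partial>\<mu>)"
proof -
  obtain n where n: "\<And>c. c \<in> range pr \<Longrightarrow> finite (c \<inter> L)"
      "\<And>c. c \<in> range pr \<Longrightarrow> card (c \<inter> L) \<le> n"
    using fibre_card_bound[OF L] by blast
  have [measurable]: "L \<in> sets borel" using L by (rule borel_compact)
  show ?thesis
  proof (rule that[of n])
    fix f :: "'g set \<Rightarrow> ennreal" assume [measurable]: "f \<in> borel_measurable \<mu>"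
    have "(\<integral>\<^sup>+x. f (pr x) * indicator L x \<partial>m)
        = (\<integral>\<^sup>+c. (\<integral>\<^sup>+h. f (pr h) * indicator L h \<partial>count_space c) \<partial>\<mu>)"
      by (rule nn_unfold) measurable
    also have "\<dots> \<le> (\<integral>\<^sup>+c. of_nat n * f c \<partial>\<mu>)"
    proof (rule nn_integral_mono)
      fix c assume "c \<in> space \<mu>"
      then have c: "c \<in> range pr" by simp
      have "(\<integral>\<^sup>+h. f (pr h) * indicator L h \<partial>count_space c) = (\<Sum>h\<in>c \<inter> L. f (pr h) * indicator L h)"
        using n(1)[OF c] by (intro nn_integral_count_space') auto
      also have "\<dots> = (\<Sum>h\<in>c \<inter> L. f c)"
        using c by (intro sum.cong) (auto simp: pr_mem_fibre[OF c])
      also have "\<dots> \<le> of_nat n * f c"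
        using n(2)[OF c] by (auto intro!: mult_right_mono)
      finally show "(\<integral>\<^sup>+h. f (pr h) * indicator L h \<partial>count_space c) \<le> of_nat n * f c" .
    qed
    also have "\<dots> = of_nat n * (\<integral>\<^sup>+c. f c \<partial>\<mu>)"
      by (rule nn_integral_cmult) measurable
    finally show "(\<integral>\<^sup>+x. f (pr x) * indicator L x \<partial>m) \<le> of_nat n * (\<integral>\<^sup>+c. f c \<partial>\<mu>)" .
  qed
qed

lemma periodize_eq_sum:
  assumes "compact L" "\<And>x. x \<notin> L \<Longrightarrow> \<Phi> x = 0" "c \<in> range pr"
  shows "periodize \<Phi> c = (\<Sum>h\<in>c \<inter> L. \<Phi> h)"
  unfolding periodize_def using assms fibre_finite[OF assms(1,3)]
  by (intro sum.mono_neutral_left) auto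

lemma has_integral_fibre_sum_nonneg:
  fixes f :: "'g \<Rightarrow> real"
  assumes f: "integrable m f" "\<And>x. 0 \<le> f x" and L: "compact L" "\<And>x. x \<notin> L \<Longrightarrow> f x = 0"
  shows "has_bochner_integral \<mu> (\<lambda>c. \<Sum>h\<in>c \<inter> L. f h) (LINT x|m. f x)"
proof (rule has_bochner_integral_nn_integral)
  have [measurable]: "f \<in> borel_measurable borel"
    using borel_measurable_integrable[OF f(1)] by (simp add: measurable_cong_sets[OF sets_m refl])
  have fib: "(\<integral>\<^sup>+h. ennreal (f h) \<partial>count_space c) = ennreal (\<Sum>h\<in>c \<inter> L. f h)" if "c \<in> space \<mu>" for c
  proof -
    have "(\<integral>\<^sup>+h. ennreal (f h) \<partial>count_space c) = (\<Sum>h\<in>c \<inter> L. ennreal (f h))"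
      using L that fibre_finite[OF L(1)] by (intro nn_integral_count_space') auto
    then show ?thesis using f(2) by simp
  qed
  have "(\<lambda>c. enn2real (\<integral>\<^sup>+h. ennreal (f h) \<partial>count_space c)) \<in> borel_measurable \<mu>" by measurable
  also have "?this \<longleftrightarrow> (\<lambda>c. \<Sum>h\<in>c \<inter> L. f h) \<in> borel_measurable \<mu>"
    using f(2) by (intro measurable_cong) (simp add: fib sum_nonneg)
  finally show "(\<lambda>c. \<Sum>h\<in>c \<inter> L. f h) \<in> borel_measurable \<mu>" .
  have "(\<integral>\<^sup>+c. ennreal (\<Sum>h\<in>c \<inter> L. f h) \<partial>\<mu>) = (\<integral>\<^sup>+c. (\<integral>\<^sup>+h. ennreal (f h) \<partial>count_space c) \<partial>\<mu>)"
    by (intro nn_integral_cong fib[symmetric])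
  also have "\<dots> = (\<integral>\<^sup>+x. ennreal (f x) \<partial>m)" by (rule nn_unfold[symmetric]) measurable
  also have "\<dots> = ennreal (LINT x|m. f x)" using f by (intro nn_integral_eq_integral) auto
  finally show "(\<integral>\<^sup>+c. ennreal (\<Sum>h\<in>c \<inter> L. f h) \<partial>\<mu>) = ennreal (LINT x|m. f x)" .
qed (use f in \<open>auto simp: sum_nonneg\<close>)

lemma has_integral_periodize:
  assumes \<Phi>: "integrable m \<Phi>" and L: "compact L" "\<And>x. x \<notin> L \<Longrightarrow> \<Phi> x = 0"
  shows "has_bochner_integral \<mu> (periodize \<Phi>) (LINT x|m. \<Phi> x)"
proof -
  define C :: "real \<Rightarrow> real \<Rightarrow> real \<Rightarrow> real \<Rightarrow> complex"
    where "C a b c d = of_real a - of_real b + \<i> * (of_real c - of_real d)" for a b c d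
  define P where "P i x = max 0 (if i = (0::nat) then Re (\<Phi> x) else if i = 1 then - Re (\<Phi> x)
      else if i = 2 then Im (\<Phi> x) else - Im (\<Phi> x))" for i x
  have psplit: "C (P 0 x) (P 1 x) (P 2 x) (P 3 x) = \<Phi> x" for x
    by (auto simp: C_def P_def complex_eq_iff max_def)
  have Pint: "integrable m (P i)" for i
    unfolding P_def using \<Phi>
    by (cases "i = 0"; cases "i = 1"; cases "i = 2") (auto intro!: integrable_max)
  have P0: "0 \<le> P i x" "x \<notin> L \<Longrightarrow> P i x = 0" for i x using L by (auto simp: P_def)
  have Cb: "has_bochner_integral M (\<lambda>x. C (a x) (b x) (c x) (d x)) (C a' b' c' d')"
    if "has_bochner_integral M a a'" "has_bochner_integral M b b'"
      "has_bochner_integral M c c'" "has_bochner_integral M d d'"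
    for M :: "'x measure" and a b c d a' b' c' d'
    unfolding C_def using that
    by (intro has_bochner_integral_add has_bochner_integral_diff has_bochner_integral_mult_right
        has_bochner_integral_of_real) auto
  let ?I = "\<lambda>i. LINT x|m. P i x"
  have "has_bochner_integral m (\<lambda>x. C (P 0 x) (P 1 x) (P 2 x) (P 3 x)) (C (?I 0) (?I 1) (?I 2) (?I 3))"
    by (intro Cb has_bochner_integral_integrable Pint)
  then have I: "(LINT x|m. \<Phi> x) = C (?I 0) (?I 1) (?I 2) (?I 3)"
    unfolding psplit by (rule has_bochner_integral_integral_eq)
  let ?S = "\<lambda>i c. \<Sum>h\<in>c \<inter> L. P i h"
  have "has_bochner_integral \<mu> (\<lambda>c. C (?S 0 c) (?S 1 c) (?S 2 c) (?S 3 c)) (LINT x|m. \<Phi> x)"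
    unfolding I by (intro Cb has_integral_fibre_sum_nonneg Pint P0 L)
  moreover have "C (?S 0 c) (?S 1 c) (?S 2 c) (?S 3 c) = periodize \<Phi> c" if "c \<in> space \<mu>" for c
  proof -
    have "C (?S 0 c) (?S 1 c) (?S 2 c) (?S 3 c) = (\<Sum>h\<in>c \<inter> L. C (P 0 h) (P 1 h) (P 2 h) (P 3 h))"
      by (simp add: C_def sum.distrib sum_subtractf sum_distrib_left right_diff_distrib)
    then show ?thesis using that periodize_eq_sum[OF L(1), of \<Phi> c] L(2) by (simp add: psplit del: One_nat_def)
  qed
  ultimately show ?thesis
    by (subst has_bochner_integral_cong[OF refl _ refl]) auto
qed

end

section \<open>The periodized kernel\<close>

lemma L2_D:
  assumes "e \<in> L2 M"
  shows "e \<in> borel_measurable M" "integrable M (\<lambda>x. (norm (e x))\<^sup>2)"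
  using assms by (auto simp: L2_def)

lemma L2_integrable_mult:
  assumes "e \<in> L2 M" "f \<in> L2 M"
  shows "integrable M (\<lambda>x. e x * f x)"
proof (rule Bochner_Integration.integrable_bound)
  show "integrable M (\<lambda>x. (norm (e x))\<^sup>2 + (norm (f x))\<^sup>2)"
    using assms by (intro Bochner_Integration.integrable_add L2_D)
  show "(\<lambda>x. e x * f x) \<in> borel_measurable M"
    using L2_D(1)[OF assms(1)] L2_D(1)[OF assms(2)] by measurable
  have "norm (e x * f x) \<le> norm ((norm (e x))\<^sup>2 + (norm (f x))\<^sup>2)" for x
  proof -
    have "2 * (norm (e x) * norm (f x)) \<le> (norm (e x))\<^sup>2 + (norm (f x))\<^sup>2"
      using sum_squares_bound[of "norm (e x)" "norm (f x)"] by (simp add: mult.assoc)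
    moreover have "0 \<le> norm (e x) * norm (f x)" by simp
    ultimately have "norm (e x) * norm (f x) \<le> (norm (e x))\<^sup>2 + (norm (f x))\<^sup>2" by linarith
    then show ?thesis by (simp add: norm_mult)
  qed
  then show "AE x in M. norm (e x * f x) \<le> norm ((norm (e x))\<^sup>2 + (norm (f x))\<^sup>2)" by simp
qed

lemma (in finite_measure) L2_const: "(\<lambda>x. a) \<in> L2 M"
  by (simp add: L2_def)

lemma (in finite_measure) L2_bounded:
  assumes "f \<in> borel_measurable M" "\<And>x. x \<in> space M \<Longrightarrow> norm (f x) \<le> B"
  shows "f \<in> L2 M"
  unfolding L2_def
proof (intro CollectI conjI)
  show "integrable M (\<lambda>x. (norm (f x))\<^sup>2)"
  proof (rule integrable_const_bound[where B="B\<^sup>2"])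
    show "AE x in M. norm ((norm (f x))\<^sup>2) \<le> B\<^sup>2"
      using assms(2) by (intro AE_I2) (simp add: power_mono)
  qed (use assms(1) in measurable)
qed (use assms in auto)

text \<open>The kernel of \<open>\<lambda>(F)\<close>; see \<open>lam_eq_kern\<close> below.\<close>

definition kern :: "('g::group_add \<Rightarrow> complex) \<Rightarrow> 'g \<Rightarrow> 'g set \<Rightarrow> complex" where
  "kern F x = periodize (\<lambda>h. F (- x + h))"

context lattice_quotient
begin

lemma L2_integrable:
  assumes "e \<in> L2 \<mu>"
  shows "integrable \<mu> e"
  using L2_integrable_mult[OF assms L2_const[of 1]] by simp

context
  fixes F :: "'g \<Rightarrow> complex"
  assumes F: "F \<in> Cc"
begin

lemma measurable_F [measurable]: "F \<in> borel_measurable borel"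
  using F by (auto simp: Cc_def intro: borel_measurable_continuous_onI)

lemma compact_left_translate: "compact ((+) x ` supp F)"
  using F by (auto simp: Cc_def intro!: compact_continuous_image continuous_intros)

lemma zero_off_left_translate: "h \<notin> (+) x ` supp F \<Longrightarrow> F (- x + h) = 0"
proof -
  assume h: "h \<notin> (+) x ` supp F"
  have "- x + h \<notin> supp F"
  proof
    assume "- x + h \<in> supp F"
    then have "x + (- x + h) \<in> (+) x ` supp F" by (rule imageI)
    then show False using h by simp
  qed
  then show ?thesis by (rule zero_outside_supp)
qed

lemma kern_eq_sum:
  "c \<in> range pr \<Longrightarrow> kern F x c = (\<Sum>h\<in>c \<inter> (+) x ` supp F. F (- x + h))"
  unfolding kern_def
  by (rule periodize_eq_sum[OF compact_left_translate zero_off_left_translate])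

lemma integrable_F: "integrable m F"
  using integrable_Cc[OF F] .

lemma integrable_left_translate: "integrable m (\<lambda>h. F (- x + h))"
proof -
  have "integrable (distr m borel ((+) (- x))) F" using integrable_F by (simp add: distr_left)
  then show ?thesis by (simp add: integrable_distr_eq)
qed

lemma has_integral_kern: "has_bochner_integral \<mu> (kern F x) (LINT g|m. F g)"
  using has_integral_periodize[OF integrable_left_translate compact_left_translate zero_off_left_translate, of x]
  by (simp add: kern_def integral_left)

lemma measurable_kern [measurable]: "kern F x \<in> borel_measurable \<mu>"
  using has_integral_kern by (auto elim: has_bochner_integral.cases)

lemma kern_bounded:
  obtains B where "\<And>c. c \<in> range pr \<Longrightarrow> norm (kern F x c) \<le> B"
proof -
  obtain b where b: "b \<ge> 0" "\<And>y. norm (F y) \<le> b" using Cc_bounded[OF F] by metis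
  obtain n where n: "\<And>c. c \<in> range pr \<Longrightarrow> card (c \<inter> (+) x ` supp F) \<le> n"
    using fibre_card_bound[OF compact_left_translate] by blast
  show ?thesis
  proof (rule that[of "real n * b"])
    fix c assume c: "c \<in> range pr"
    have "norm (kern F x c) \<le> (\<Sum>h\<in>c \<inter> (+) x ` supp F. norm (F (- x + h)))"
      unfolding kern_eq_sum[OF c] by (rule norm_sum)
    also have "\<dots> \<le> real (card (c \<inter> (+) x ` supp F)) * b"
      using b by (intro sum_bounded_above)
    also have "\<dots> \<le> real n * b" using n[OF c] b(1) by (intro mult_right_mono) auto
    finally show "norm (kern F x c) \<le> real n * b" .
  qed
qed

lemma kern_L2: "kern F x \<in> L2 \<mu>"
proof -
  obtain B where "\<And>c. c \<in> range pr \<Longrightarrow> norm (kern F x c) \<le> B" 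
    using kern_bounded[where x=x] by metis
  then show ?thesis by (intro L2_bounded[of _ B]) auto
qed

lemma measurable_lam [measurable]:
  assumes [measurable]: "e \<in> borel_measurable \<mu>"
  shows "lam m F e \<in> borel_measurable \<mu>"
  unfolding lam_def by measurable

lemma integrable_compact_support_pr:
  assumes e: "integrable \<mu> e" and L: "compact L"
  shows "integrable m (\<lambda>g. indicator L g * norm (e (pr g) :: complex))"
proof (rule integrableI_bounded)
  have [measurable]: "e \<in> borel_measurable \<mu>" using e by auto
  have [measurable]: "L \<in> sets borel" using L by (rule borel_compact)
  show "(\<lambda>g. indicator L g * norm (e (pr g))) \<in> borel_measurable m" by measurable
  obtain n :: nat where n: "\<And>f :: 'g set \<Rightarrow> ennreal. f \<in> borel_measurable \<mu> \<Longrightarrow>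
    (\<integral>\<^sup>+x. f (pr x) * indicator L x \<partial>m) \<le> of_nat n * (\<integral>\<^sup>+c. f c \<partial>\<mu>)"
    using nn_unfold_compact[OF L] by metis
  have "(\<integral>\<^sup>+g. ennreal (norm (indicator L g * norm (e (pr g)))) \<partial>m)
      = (\<integral>\<^sup>+g. ennreal (norm (e (pr g))) * indicator L g \<partial>m)"
    by (intro nn_integral_cong) (auto simp: indicator_def)
  also have "\<dots> \<le> of_nat n * (\<integral>\<^sup>+c. ennreal (norm (e c)) \<partial>\<mu>)"
    by (rule n) measurable
  also have "\<dots> < \<infinity>"
    using e by (auto simp: integrable_iff_bounded ennreal_mult_less_top of_nat_less_top)
  finally show "(\<integral>\<^sup>+g. ennreal (norm (indicator L g * norm (e (pr g)))) \<partial>m) < \<infinity>" .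
qed

lemma lam_pr:
  assumes [measurable]: "e \<in> borel_measurable \<mu>"
  shows "lam m F e (pr x) = (LINT g|m. F (- x + g) * e (pr g))"
proof -
  have "lam m F e (pr x) = (LINT g|m. F (- x + (x + g)) * e (pr (x + g)))"
    unfolding lam_def by (simp add: rshift_pr)
  also have "\<dots> = (LINT g|m. F (- x + g) * e (pr g))"
    by (rule integral_left[where f="\<lambda>g. F (- x + g) * e (pr g)"]) measurable
  finally show ?thesis .
qed

lemma lam_eq_kern:
  assumes e: "integrable \<mu> e"
  shows "lam m F e (pr x) = (LINT c|\<mu>. kern F x c * e c)"
proof -
  have [measurable]: "e \<in> borel_measurable \<mu>" using e by auto
  obtain b where b: "b \<ge> 0" "\<And>y. norm (F y) \<le> b" using Cc_bounded[OF F] by metis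
  let ?L = "(+) x ` supp F"
  let ?\<Phi> = "\<lambda>g. F (- x + g) * e (pr g)"
  have "integrable m (\<lambda>g. b * (indicator ?L g * norm (e (pr g))))"
    using integrable_compact_support_pr[OF e compact_left_translate[of x]] by (rule integrable_mult_right)
  then have int: "integrable m ?\<Phi>"
  proof (rule Bochner_Integration.integrable_bound)
    show "?\<Phi> \<in> borel_measurable m" by measurable
    have "norm (?\<Phi> g) \<le> norm (b * (indicator ?L g * norm (e (pr g))))" for g
    proof (cases "g \<in> ?L")
      case True
      then show ?thesis using b by (simp add: norm_mult mult_right_mono)
    next
      case False
      then show ?thesis using zero_off_left_translate[OF False] by simp
    qed
    then show "AE g in m. norm (?\<Phi> g) \<le> norm (b * (indicator ?L g * norm (e (pr g))))" by simp
  qed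
  have z: "?\<Phi> g = 0" if "g \<notin> ?L" for g using zero_off_left_translate[OF that] by simp
  have "(LINT g|m. ?\<Phi> g) = (LINT c|\<mu>. periodize ?\<Phi> c)"
    using has_integral_periodize[OF int compact_left_translate[of x] z]
    by (simp add: has_bochner_integral_integral_eq)
  also have "\<dots> = (LINT c|\<mu>. kern F x c * e c)"
  proof (rule Bochner_Integration.integral_cong[OF refl])
    fix c assume "c \<in> space \<mu>"
    then have c: "c \<in> range pr" by simp
    have "periodize ?\<Phi> c = (\<Sum>h\<in>c \<inter> ?L. F (- x + h) * e (pr h))"
      by (rule periodize_eq_sum[OF compact_left_translate z c])
    also have "\<dots> = (\<Sum>h\<in>c \<inter> ?L. F (- x + h) * e c)"
      by (intro sum.cong) (auto simp: pr_mem_fibre[OF c])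
    finally show "periodize ?\<Phi> c = kern F x c * e c"
      by (simp add: kern_eq_sum[OF c] sum_distrib_right)
  qed
  finally show ?thesis by (simp add: lam_pr)
qed

text \<open>The function \<open>x \<mapsto> \<lambda>(F) e (\<Gamma>x)\<close> is continuous, by dominated convergence along sequences, and
  non-empty open sets have positive Haar measure; so vanishing almost everywhere means vanishing
  everywhere.\<close>

lemma lam_continuous:
  assumes e: "integrable \<mu> e"
  shows "continuous_on UNIV (\<lambda>x. lam m F e (pr x))"
proof (rule continuous_on_sequentiallyI)
  fix u :: "nat \<Rightarrow> 'g" and x assume u: "u \<longlonglongrightarrow> x"
  have [measurable]: "e \<in> borel_measurable \<mu>" using e by auto
  obtain b where b: "b \<ge> 0" "\<And>y. norm (F y) \<le> b" using Cc_bounded[OF F] by metis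
  have contF: "continuous_on UNIV F" and cs: "compact (supp F)" using F by (auto simp: Cc_def)
  have "\<exists>V K. open V \<and> compact K \<and> x \<in> V \<and> V \<subseteq> K"
    using lc unfolding locally_compact_space_def by simp
  then obtain V K where V: "open V" "compact K" "x \<in> V" "V \<subseteq> K" by blast
  obtain N where "\<And>n. n \<ge> N \<Longrightarrow> u n \<in> V"
    using topological_tendstoD[OF u V(1,3)] unfolding eventually_sequentially by blast
  then have inK: "u (n + N) \<in> K" for n using V(4) by auto
  have u': "(\<lambda>n. u (n + N)) \<longlonglongrightarrow> x" using u by (rule LIMSEQ_ignore_initial_segment)
  have "compact (K \<times> supp F)" using V(2) cs by (rule compact_Times)
  then have L: "compact ((\<lambda>p. fst p + snd p) ` (K \<times> supp F))" (is "compact ?L")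
    by (intro compact_continuous_image continuous_intros)
  have "(\<lambda>n. LINT g|m. F (- u (n + N) + g) * e (pr g)) \<longlonglongrightarrow> (LINT g|m. F (- x + g) * e (pr g))"
  proof (rule integral_dominated_convergence)
    show "integrable m (\<lambda>g. b * (indicator ?L g * norm (e (pr g))))"
      using integrable_compact_support_pr[OF e L] by (rule integrable_mult_right)
    have "(\<lambda>n. F (- u (n + N) + g)) \<longlonglongrightarrow> F (- x + g)" for g
      using u' by (intro continuous_on_tendsto_compose[OF contF] tendsto_intros) auto
    then show "AE g in m. (\<lambda>n. F (- u (n + N) + g) * e (pr g)) \<longlonglongrightarrow> F (- x + g) * e (pr g)"
      by (intro AE_I2 tendsto_mult tendsto_const)
    fix n
    have "norm (F (- u (n + N) + g) * e (pr g)) \<le> b * (indicator ?L g * norm (e (pr g)))" for g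
    proof (cases "g \<in> ?L")
      case True
      then show ?thesis using b by (simp add: norm_mult mult_right_mono)
    next
      case False
      have "g \<notin> (+) (u (n + N)) ` supp F"
      proof
        assume "g \<in> (+) (u (n + N)) ` supp F"
        then obtain s where "g = fst (u (n + N), s) + snd (u (n + N), s)" "s \<in> supp F" by auto
        then have "g \<in> ?L" using inK by (intro image_eqI[of _ _ "(u (n + N), s)"]) auto
        then show False using False by simp
      qed
      then show ?thesis using zero_off_left_translate b(1) by simp
    qed
    then show "AE g in m. norm (F (- u (n + N) + g) * e (pr g)) \<le> b * (indicator ?L g * norm (e (pr g)))"
      by simp
  qed measurable
  then have "(\<lambda>n. lam m F e (pr (u (n + N)))) \<longlonglongrightarrow> lam m F e (pr x)" by (simp add: lam_pr)
  then show "(\<lambda>n. lam m F e (pr (u n))) \<longlonglongrightarrow> lam m F e (pr x)" by (rule LIMSEQ_offset)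
qed

lemma lam_zero_everywhere:
  assumes e: "integrable \<mu> e" and ae: "AE c in \<mu>. lam m F e c = 0"
  shows "lam m F e (pr x) = 0"
proof (rule ccontr)
  have [measurable]: "e \<in> borel_measurable \<mu>" using e by auto
  define U where "U = {y. lam m F e (pr y) \<noteq> 0}"
  assume "lam m F e (pr x) \<noteq> 0"
  then have "U \<noteq> {}" by (auto simp: U_def)
  have "open U"
    unfolding U_def using lam_continuous[OF e] by (intro open_Collect_neq) auto
  then have [measurable]: "U \<in> sets borel" by simp
  have "emeasure m U = (\<integral>\<^sup>+x. indicator U x \<partial>m)" by simp
  also have "\<dots> = (\<integral>\<^sup>+c. (\<integral>\<^sup>+h. indicator U h \<partial>count_space c) \<partial>\<mu>)"
    by (rule nn_unfold) measurable
  also have "\<dots> = (\<integral>\<^sup>+c. 0 \<partial>\<mu>)"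
  proof (rule nn_integral_cong_AE)
    have "(\<integral>\<^sup>+h. indicator U h \<partial>count_space c) = 0" if c: "c \<in> space \<mu>" and 0: "lam m F e c = 0" for c
    proof -
      have "indicator U h = (0::ennreal)" if "h \<in> c" for h
        using pr_mem_fibre[OF _ that] c 0 by (simp add: U_def)
      then have "(\<integral>\<^sup>+h. indicator U h \<partial>count_space c) = (\<integral>\<^sup>+h. 0 \<partial>count_space c)"
        by (intro nn_integral_cong) simp
      then show ?thesis by simp
    qed
    then show "AE c in \<mu>. (\<integral>\<^sup>+h. indicator U h \<partial>count_space c) = 0"
      using ae by (auto elim: AE_mp)
  qed
  finally have "emeasure m U = 0" by simp
  then show False using emeasure_open_pos[OF \<open>open U\<close> \<open>U \<noteq> {}\<close>] by simp
qed

end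

end

section \<open>The trace bounds the kernel\<close>

lemma borel_measurable_cnj [measurable (raw)]:
  assumes "f \<in> borel_measurable M"
  shows "(\<lambda>x. cnj (f x)) \<in> borel_measurable M"
proof -
  have "cnj \<in> borel_measurable borel"
    by (intro borel_measurable_continuous_onI continuous_intros)
  with assms show ?thesis by (rule measurable_compose)
qed

lemma integrable_norm_sq_complex:
  assumes "f \<in> L2 M"
  shows "integrable M (\<lambda>x. f x * cnj (f x))" "(LINT x|M. f x * cnj (f x)) = of_real (LINT x|M. (norm (f x))\<^sup>2)"
proof -
  have eq: "f x * cnj (f x) = of_real ((norm (f x))\<^sup>2)" for x
    by (rule complex_norm_square[symmetric])
  show "integrable M (\<lambda>x. f x * cnj (f x))"
    unfolding eq by (intro integrable_of_real L2_D(2)[OF assms])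
  show "(LINT x|M. f x * cnj (f x)) = of_real (LINT x|M. (norm (f x))\<^sup>2)"
    unfolding eq by (rule integral_complex_of_real)
qed

lemma L2_cnj: "f \<in> L2 M \<Longrightarrow> (\<lambda>x. cnj (f x)) \<in> L2 M"
  by (auto simp: L2_def intro: borel_measurable_cnj)

lemma l2_inner_commute: "l2_inner M g f = cnj (l2_inner M f g)"
  unfolding l2_inner_def Bochner_Integration.integral_cnj[symmetric] by (simp add: mult.commute)

text \<open>Completing the square: among the linear combinations of finitely many orthonormal vectors, the
  one with the Fourier coefficients of \<open>\<phi>\<close> is closest to \<open>\<phi>\<close>.\<close>

lemma norm_sq_le_fourier_plus_dist:
  assumes A: "finite A" "A \<subseteq> L2 M"
    and orth: "\<And>e f. e \<in> A \<Longrightarrow> f \<in> A \<Longrightarrow> l2_inner M e f = (if e = f then 1 else 0)"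
    and \<phi>: "\<phi> \<in> L2 M"
  shows "(LINT x|M. (norm (\<phi> x))\<^sup>2) \<le>
    (\<Sum>e\<in>A. (norm (l2_inner M \<phi> e))\<^sup>2) + (LINT x|M. (norm (\<phi> x - (\<Sum>e\<in>A. a e * e x)))\<^sup>2)"
proof -
  let ?b = "\<lambda>e. l2_inner M \<phi> e"
  let ?s = "\<lambda>x. \<Sum>e\<in>A. a e * e x"
  have i1: "integrable M (\<lambda>x. \<phi> x * cnj (\<phi> x))" by (rule integrable_norm_sq_complex[OF \<phi>])
  have i2: "integrable M (\<lambda>x. \<phi> x * cnj (e x))" "integrable M (\<lambda>x. e x * cnj (\<phi> x))" if "e \<in> A" for e
    using that A(2) \<phi> by (auto intro!: L2_integrable_mult L2_cnj)
  have i3: "integrable M (\<lambda>x. e x * cnj (f x))" if "e \<in> A" "f \<in> A" for e f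
    using that A(2) by (auto intro!: L2_integrable_mult L2_cnj)
  let ?D = "\<lambda>x. \<phi> x * cnj (\<phi> x) - (\<Sum>e\<in>A. cnj (a e) * (\<phi> x * cnj (e x)))
      - (\<Sum>e\<in>A. a e * (e x * cnj (\<phi> x))) + (\<Sum>e\<in>A. \<Sum>f\<in>A. (a e * cnj (a f)) * (e x * cnj (f x)))"
  have D: "of_real ((norm (\<phi> x - ?s x))\<^sup>2) = ?D x" for x
  proof -
    have "of_real ((norm (\<phi> x - ?s x))\<^sup>2) = (\<phi> x - ?s x) * cnj (\<phi> x - ?s x)"
      by (simp only: complex_norm_square)
    also have "\<dots> = \<phi> x * cnj (\<phi> x) - \<phi> x * cnj (?s x) - ?s x * cnj (\<phi> x) + ?s x * cnj (?s x)"
      by (simp only: complex_cnj_diff) (simp add: algebra_simps)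
    also have "\<phi> x * cnj (?s x) = (\<Sum>e\<in>A. cnj (a e) * (\<phi> x * cnj (e x)))"
      by (simp add: sum_distrib_left mult_ac)
    also have "?s x * cnj (\<phi> x) = (\<Sum>e\<in>A. a e * (e x * cnj (\<phi> x)))"
      by (subst sum_distrib_right) (simp add: mult_ac)
    also have "?s x * cnj (?s x) = (\<Sum>e\<in>A. \<Sum>f\<in>A. (a e * cnj (a f)) * (e x * cnj (f x)))"
      by (simp only: cnj_sum sum_product) (simp add: mult_ac)
    finally show ?thesis .
  qed
  have "of_real (LINT x|M. (norm (\<phi> x - ?s x))\<^sup>2) = (LINT x|M. of_real ((norm (\<phi> x - ?s x))\<^sup>2) :: complex)"
    by (rule integral_complex_of_real[symmetric])
  also have "\<dots> = (LINT x|M. ?D x)" unfolding D ..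
  also have "\<dots> = (LINT x|M. \<phi> x * cnj (\<phi> x)) - (\<Sum>e\<in>A. cnj (a e) * ?b e)
      - (\<Sum>e\<in>A. a e * l2_inner M e \<phi>) + (\<Sum>e\<in>A. \<Sum>f\<in>A. (a e * cnj (a f)) * l2_inner M e f)"
    unfolding l2_inner_def using i1 i2 i3 A(1)
    by (simp add: Bochner_Integration.integral_add Bochner_Integration.integral_diff
        Bochner_Integration.integral_sum)
  also have "(\<Sum>e\<in>A. \<Sum>f\<in>A. (a e * cnj (a f)) * l2_inner M e f) = (\<Sum>e\<in>A. a e * cnj (a e))"
  proof (rule sum.cong[OF refl])
    fix e assume e: "e \<in> A"
    have "(\<Sum>f\<in>A. (a e * cnj (a f)) * l2_inner M e f) = (\<Sum>f\<in>A. if e = f then a e * cnj (a f) else 0)"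
      using e orth by (intro sum.cong) auto
    then show "(\<Sum>f\<in>A. (a e * cnj (a f)) * l2_inner M e f) = a e * cnj (a e)"
      using e A(1) by simp
  qed
  also have "(LINT x|M. \<phi> x * cnj (\<phi> x)) - (\<Sum>e\<in>A. cnj (a e) * ?b e) - (\<Sum>e\<in>A. a e * l2_inner M e \<phi>)
      + (\<Sum>e\<in>A. a e * cnj (a e))
      = (LINT x|M. \<phi> x * cnj (\<phi> x)) - (\<Sum>e\<in>A. ?b e * cnj (?b e)) + (\<Sum>e\<in>A. (a e - ?b e) * cnj (a e - ?b e))"
    unfolding l2_inner_commute[of M _ \<phi>]
    by (simp add: algebra_simps sum.distrib sum_subtractf)
  also have "\<dots> = of_real ((LINT x|M. (norm (\<phi> x))\<^sup>2) - (\<Sum>e\<in>A. (norm (?b e))\<^sup>2) + (\<Sum>e\<in>A. (norm (a e - ?b e))\<^sup>2))"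
    unfolding integrable_norm_sq_complex(2)[OF \<phi>] by (simp only: complex_norm_square[symmetric]) simp
  finally have "(LINT x|M. (norm (\<phi> x - ?s x))\<^sup>2)
      = (LINT x|M. (norm (\<phi> x))\<^sup>2) - (\<Sum>e\<in>A. (norm (?b e))\<^sup>2) + (\<Sum>e\<in>A. (norm (a e - ?b e))\<^sup>2)"
    using of_real_eq_iff by blast
  moreover have "0 \<le> (\<Sum>e\<in>A. (norm (a e - ?b e))\<^sup>2)" by (intro sum_nonneg) auto
  ultimately show ?thesis by linarith
qed

text \<open>The form of Parseval's inequality for a possibly uncountable basis, of which only the part \<open>E0\<close>
  meets \<open>\<phi>\<close>.\<close>

lemma parseval_le:
  assumes E: "orthonormal_basis M E" and \<phi>: "\<phi> \<in> L2 M"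
    and E0: "E0 \<subseteq> E" "\<And>e. e \<in> E - E0 \<Longrightarrow> l2_inner M \<phi> e = 0"
    and bound: "\<And>A. finite A \<Longrightarrow> A \<subseteq> E0 \<Longrightarrow> (\<Sum>e\<in>A. ennreal ((norm (l2_inner M \<phi> e))\<^sup>2)) \<le> B"
  shows "ennreal (LINT x|M. (norm (\<phi> x))\<^sup>2) \<le> B"
proof (rule ennreal_le_epsilon)
  fix \<epsilon> :: real assume \<epsilon>: "0 < \<epsilon>"
  obtain A a where A: "finite A" "A \<subseteq> E" "l2_norm M (\<lambda>x. \<phi> x - (\<Sum>e\<in>A. a e * e x)) < sqrt \<epsilon>"
  proof -
    have "\<forall>\<phi>\<in>L2 M. \<forall>\<epsilon>>0. \<exists>A a. finite A \<and> A \<subseteq> E \<and>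
        l2_norm M (\<lambda>x. \<phi> x - (\<Sum>e\<in>A. a e * e x)) < \<epsilon>"
      using E unfolding orthonormal_basis_def by (elim conjE)
    from this[rule_format, OF \<phi>, of "sqrt \<epsilon>"] \<epsilon>
    have "\<exists>A a. finite A \<and> A \<subseteq> E \<and> l2_norm M (\<lambda>x. \<phi> x - (\<Sum>e\<in>A. a e * e x)) < sqrt \<epsilon>"
      by (simp only: real_sqrt_gt_0_iff)
    then show ?thesis using that by (elim exE conjE)
  qed
  have EL2: "E \<subseteq> L2 M" and orthE: "\<forall>e\<in>E. \<forall>f\<in>E. l2_inner M e f = (if e = f then 1 else 0)"
    using E unfolding orthonormal_basis_def by simp_all
  have Asub: "A \<subseteq> L2 M" using A(2) EL2 by (rule order_trans)
  have orth: "l2_inner M e f = (if e = f then 1 else 0)" if "e \<in> A" "f \<in> A" for e f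
    using orthE[rule_format, OF subsetD[OF A(2) that(1)] subsetD[OF A(2) that(2)]] .
  have d: "(LINT x|M. (norm (\<phi> x - (\<Sum>e\<in>A. a e * e x)))\<^sup>2) < \<epsilon>"
    using A(3) by (simp add: l2_norm_def)
  have "(\<Sum>e\<in>A. (norm (l2_inner M \<phi> e))\<^sup>2) = (\<Sum>e\<in>A \<inter> E0. (norm (l2_inner M \<phi> e))\<^sup>2)"
    using A E0 by (intro sum.mono_neutral_right) auto
  then have "(LINT x|M. (norm (\<phi> x))\<^sup>2) \<le> (\<Sum>e\<in>A \<inter> E0. (norm (l2_inner M \<phi> e))\<^sup>2) + \<epsilon>"
    using norm_sq_le_fourier_plus_dist[OF A(1) Asub orth \<phi>, of a] d by linarith
  then have "ennreal (LINT x|M. (norm (\<phi> x))\<^sup>2) \<le> ennreal ((\<Sum>e\<in>A \<inter> E0. (norm (l2_inner M \<phi> e))\<^sup>2) + \<epsilon>)"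
    by (rule ennreal_leI)
  also have "\<dots> = (\<Sum>e\<in>A \<inter> E0. ennreal ((norm (l2_inner M \<phi> e))\<^sup>2)) + ennreal \<epsilon>"
    using \<epsilon> by (subst ennreal_plus) (auto simp: sum_nonneg)
  also have "\<dots> \<le> B + ennreal \<epsilon>"
    using A(1) by (intro add_right_mono bound) auto
  finally show "ennreal (LINT x|M. (norm (\<phi> x))\<^sup>2) \<le> B + ennreal \<epsilon>" .
qed

context lattice_quotient
begin

text \<open>The diagonal entries \<open>\<langle>\<lambda>(F\<^sup>* * F) e, e\<rangle>\<close> and \<open>\<parallel>\<lambda>(F) e\<parallel>\<^sup>2\<close> are triple integrals of the following
  shape; the shifts \<open>\<alpha>\<close>, \<open>\<beta>\<close> and the weight \<open>w\<close> differ.\<close>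

lemma integrable_matrix_coefficient:
  fixes w :: "'g \<times> 'g \<Rightarrow> complex" and \<alpha> \<beta> :: "'g \<times> 'g \<Rightarrow> 'g"
  assumes e: "e \<in> L2 \<mu>"
    and [measurable]: "w \<in> borel_measurable (m \<Otimes>\<^sub>M m)" "\<alpha> \<in> borel_measurable (m \<Otimes>\<^sub>M m)" "\<beta> \<in> borel_measurable (m \<Otimes>\<^sub>M m)"
    and w: "(\<integral>\<^sup>+p. ennreal (norm (w p)) \<partial>(m \<Otimes>\<^sub>M m)) < \<infinity>"
  shows "integrable (\<mu> \<Otimes>\<^sub>M (m \<Otimes>\<^sub>M m)) (\<lambda>(c, p). w p * (cnj (e (rshift (\<alpha> p) c)) * e (rshift (\<beta> p) c)))"
proof -
  interpret P: pair_sigma_finite m m ..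
  interpret Q: pair_sigma_finite \<mu> "m \<Otimes>\<^sub>M m" ..
  have [measurable]: "e \<in> borel_measurable \<mu>" using e by (rule L2_D)
  let ?H = "\<lambda>(c, p). w p * (cnj (e (rshift (\<alpha> p) c)) * e (rshift (\<beta> p) c))"
  let ?N = "\<integral>\<^sup>+c. ennreal ((norm (e c))\<^sup>2) \<partial>\<mu>"
  have N: "?N < \<infinity>" using L2_D(2)[OF e] by (simp add: integrable_iff_bounded)
  have H [measurable]: "?H \<in> borel_measurable (\<mu> \<Otimes>\<^sub>M (m \<Otimes>\<^sub>M m))" by measurable
  show ?thesis
  proof (rule integrableI_bounded[OF H])
    have "(\<integral>\<^sup>+x. ennreal (norm (?H x)) \<partial>(\<mu> \<Otimes>\<^sub>M (m \<Otimes>\<^sub>M m)))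
        = (\<integral>\<^sup>+p. (\<integral>\<^sup>+c. ennreal (norm (?H (c, p))) \<partial>\<mu>) \<partial>(m \<Otimes>\<^sub>M m))"
      by (rule Q.nn_integral_snd[symmetric]) measurable
    also have "\<dots> \<le> (\<integral>\<^sup>+p. ennreal (norm (w p)) * (?N + ?N) \<partial>(m \<Otimes>\<^sub>M m))"
    proof (rule nn_integral_mono)
      fix p
      have le: "ennreal (norm (?H (c, p))) \<le> ennreal (norm (w p)) *
          (ennreal ((norm (e (rshift (\<alpha> p) c)))\<^sup>2) + ennreal ((norm (e (rshift (\<beta> p) c)))\<^sup>2))" for c
      proof -
        let ?a = "norm (e (rshift (\<alpha> p) c))" and ?b = "norm (e (rshift (\<beta> p) c))"
        have "2 * (?a * ?b) \<le> ?a\<^sup>2 + ?b\<^sup>2" using sum_squares_bound[of ?a ?b] by (simp add: mult.assoc)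
        moreover have "0 \<le> ?a * ?b" by simp
        ultimately have "?a * ?b \<le> ?a\<^sup>2 + ?b\<^sup>2" by linarith
        then have "norm (?H (c, p)) \<le> norm (w p) * (?a\<^sup>2 + ?b\<^sup>2)"
          by (simp add: norm_mult mult_left_mono)
        then have "ennreal (norm (?H (c, p))) \<le> ennreal (norm (w p) * (?a\<^sup>2 + ?b\<^sup>2))"
          by (rule ennreal_leI)
        then show ?thesis by (simp add: ennreal_mult)
      qed
      have "(\<integral>\<^sup>+c. ennreal (norm (?H (c, p))) \<partial>\<mu>) \<le> (\<integral>\<^sup>+c. ennreal (norm (w p)) *
          (ennreal ((norm (e (rshift (\<alpha> p) c)))\<^sup>2) + ennreal ((norm (e (rshift (\<beta> p) c)))\<^sup>2)) \<partial>\<mu>)"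
        by (intro nn_integral_mono le)
      also have "\<dots> = ennreal (norm (w p)) * ((\<integral>\<^sup>+c. ennreal ((norm (e (rshift (\<alpha> p) c)))\<^sup>2) \<partial>\<mu>)
          + (\<integral>\<^sup>+c. ennreal ((norm (e (rshift (\<beta> p) c)))\<^sup>2) \<partial>\<mu>))"
        by (simp add: nn_integral_cmult nn_integral_add)
      also have "\<dots> = ennreal (norm (w p)) * (?N + ?N)"
        by (simp add: nn_integral_rshift[where f="\<lambda>c. ennreal ((norm (e c))\<^sup>2)"])
      finally show "(\<integral>\<^sup>+c. ennreal (norm (?H (c, p))) \<partial>\<mu>) \<le> ennreal (norm (w p)) * (?N + ?N)" .
    qed
    also have "\<dots> = (\<integral>\<^sup>+p. ennreal (norm (w p)) \<partial>(m \<Otimes>\<^sub>M m)) * (?N + ?N)"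
      by (rule nn_integral_multc) measurable
    also have "\<dots> < \<infinity>" using w N by (simp add: ennreal_mult_less_top)
    finally show "(\<integral>\<^sup>+x. ennreal (norm (?H x)) \<partial>(\<mu> \<Otimes>\<^sub>M (m \<Otimes>\<^sub>M m))) < \<infinity>" .
  qed
qed

context
  fixes F :: "'g \<Rightarrow> complex" and e :: "'g set \<Rightarrow> complex"
  assumes F: "F \<in> Cc" and e: "e \<in> L2 \<mu>"
begin

private lemma meas [measurable]: "F \<in> borel_measurable borel" "e \<in> borel_measurable \<mu>"
  using measurable_F[OF F] L2_D(1)[OF e] by auto

private definition \<Psi> :: "'g \<Rightarrow> 'g \<Rightarrow> complex" where
  "\<Psi> y u = (LINT c|\<mu>. cnj (e (rshift y c)) * e (rshift u c))"

private lemma \<Psi>_shift: "\<Psi> (d + y) (d + u) = \<Psi> y u"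
proof -
  have "\<Psi> (d + y) (d + u) = (LINT c|\<mu>. (\<lambda>c. cnj (e (rshift y c)) * e (rshift u c)) (rshift d c))"
    by (simp add: \<Psi>_def rshift_rshift)
  also have "\<dots> = \<Psi> y u" unfolding \<Psi>_def by (rule integral_rshift) measurable
  finally show ?thesis .
qed

private lemma \<Psi>_measurable [measurable (raw)]:
  assumes [measurable]: "f \<in> borel_measurable M" "g \<in> borel_measurable M"
  shows "(\<lambda>p. \<Psi> (f p) (g p)) \<in> borel_measurable M"
  unfolding \<Psi>_def by measurable

private lemma nn_F: "(\<integral>\<^sup>+u. ennreal (norm (F u)) \<partial>m) < \<infinity>"
  using integrable_F[OF F] by (simp add: integrable_iff_bounded)

lemma norm_lam_sq_triple_integral:
  shows "integrable \<mu> (\<lambda>c. (norm (lam m F e c))\<^sup>2)"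
    and "of_real (LINT c|\<mu>. (norm (lam m F e c))\<^sup>2) =
      (LINT y|m. (LINT u|m. cnj (F y) * F u * \<Psi> y u))"
proof -
  interpret P: pair_sigma_finite m m ..
  interpret Q: pair_sigma_finite \<mu> "m \<Otimes>\<^sub>M m" ..
  let ?w = "\<lambda>p. cnj (F (fst p)) * F (snd p)"
  let ?H = "\<lambda>(c, p). ?w p * (cnj (e (rshift (fst p) c)) * e (rshift (snd p) c))"
  have "(\<integral>\<^sup>+p. ennreal (norm (?w p)) \<partial>(m \<Otimes>\<^sub>M m)) = (\<integral>\<^sup>+y. (\<integral>\<^sup>+u. ennreal (norm (?w (y, u))) \<partial>m) \<partial>m)"
    by (rule sigma_finite_measure.nn_integral_fst[OF unimodular_haar.sigma_finite[OF unimodular_haar_axioms], symmetric]) measurable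
  also have "\<dots> = (\<integral>\<^sup>+y. ennreal (norm (F y)) \<partial>m) * (\<integral>\<^sup>+u. ennreal (norm (F u)) \<partial>m)"
    by (simp add: norm_mult ennreal_mult nn_integral_cmult nn_integral_multc)
  also have "\<dots> < \<infinity>" using nn_F by (simp add: ennreal_mult_less_top)
  finally have int: "integrable (\<mu> \<Otimes>\<^sub>M (m \<Otimes>\<^sub>M m)) ?H"
    by (intro integrable_matrix_coefficient[OF e]) measurable
  have "AE c in \<mu>. integrable (m \<Otimes>\<^sub>M m) (\<lambda>p. ?H (c, p))" using int by (rule Q.AE_integrable_fst')
  then have ae: "AE c in \<mu>. (LINT p|(m \<Otimes>\<^sub>M m). ?H (c, p)) = of_real ((norm (lam m F e c))\<^sup>2)"
  proof (rule AE_mp, intro AE_I2 impI)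
    fix c assume "integrable (m \<Otimes>\<^sub>M m) (\<lambda>p. ?H (c, p))"
    then have "(LINT p|(m \<Otimes>\<^sub>M m). ?H (c, p)) = (LINT y|m. (LINT u|m. ?H (c, (y, u))))"
      by (rule P.integral_fst'[symmetric])
    also have "\<dots> = (LINT y|m. (LINT u|m. (cnj (F y * e (rshift y c))) * (F u * e (rshift u c))))"
      by (simp add: mult_ac)
    also have "\<dots> = cnj (lam m F e c) * lam m F e c"
      unfolding lam_def by (simp del: complex_cnj_mult)
    also have "\<dots> = of_real ((norm (lam m F e c))\<^sup>2)"
      by (simp only: complex_norm_square mult.commute)
    finally show "(LINT p|(m \<Otimes>\<^sub>M m). ?H (c, p)) = of_real ((norm (lam m F e c))\<^sup>2)" .
  qed
  have int1: "integrable \<mu> (\<lambda>c. LINT p|(m \<Otimes>\<^sub>M m). ?H (c, p))" using int by (rule Q.integrable_fst')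
  have ml [measurable]: "lam m F e \<in> borel_measurable \<mu>" by (rule measurable_lam[OF F]) measurable
  have "integrable \<mu> (\<lambda>c. of_real ((norm (lam m F e c))\<^sup>2) :: complex)"
    using ae int1 by (subst integrable_cong_AE[symmetric, OF _ _ ae]) (auto intro: borel_measurable_integrable)
  then show "integrable \<mu> (\<lambda>c. (norm (lam m F e c))\<^sup>2)" by (simp only: complex_of_real_integrable_eq)
  have "of_real (LINT c|\<mu>. (norm (lam m F e c))\<^sup>2) = (LINT c|\<mu>. of_real ((norm (lam m F e c))\<^sup>2) :: complex)"
    by (rule integral_complex_of_real[symmetric])
  also have "\<dots> = (LINT c|\<mu>. (LINT p|(m \<Otimes>\<^sub>M m). ?H (c, p)))"
    using int1 by (intro integral_cong_AE[symmetric] ae) auto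
  also have "\<dots> = (LINT p|(m \<Otimes>\<^sub>M m). (LINT c|\<mu>. ?H (c, p)))"
    using Q.Fubini_integral[of "\<lambda>c p. ?H (c, p)"] int by simp
  also have "\<dots> = (LINT p|(m \<Otimes>\<^sub>M m). ?w p * \<Psi> (fst p) (snd p))" by (simp add: \<Psi>_def)
  also have "\<dots> = (LINT y|m. (LINT u|m. ?w (y, u) * \<Psi> y u))"
  proof -
    have "integrable (m \<Otimes>\<^sub>M m) (\<lambda>p. LINT c|\<mu>. ?H (c, p))"
      using Q.integrable_snd[of "\<lambda>c p. ?H (c, p)"] int by simp
    then have "integrable (m \<Otimes>\<^sub>M m) (\<lambda>p. ?w p * \<Psi> (fst p) (snd p))" by (simp add: \<Psi>_def)
    from P.integral_fst'[OF this] show ?thesis by simp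
  qed
  finally show "of_real (LINT c|\<mu>. (norm (lam m F e c))\<^sup>2) =
      (LINT y|m. (LINT u|m. cnj (F y) * F u * \<Psi> y u))" by simp
qed

lemma inner_lam_convolve_triple_integral:
  "l2_inner \<mu> (lam m (convolve m (star F) F) e) e =
      (LINT y|m. (LINT u|m. cnj (F (- y)) * F (- y + u) * \<Psi> 0 u))"
proof -
  interpret P: pair_sigma_finite m m ..
  interpret Q: pair_sigma_finite \<mu> "m \<Otimes>\<^sub>M m" ..
  let ?w = "\<lambda>p. cnj (F (- fst p)) * F (- fst p + snd p)"
  let ?H = "\<lambda>(c, p). ?w p * (cnj (e (rshift 0 c)) * e (rshift (snd p) c))"
  have "(\<integral>\<^sup>+p. ennreal (norm (?w p)) \<partial>(m \<Otimes>\<^sub>M m)) = (\<integral>\<^sup>+y. (\<integral>\<^sup>+u. ennreal (norm (?w (y, u))) \<partial>m) \<partial>m)"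
    by (rule sigma_finite_measure.nn_integral_fst[OF unimodular_haar.sigma_finite[OF unimodular_haar_axioms], symmetric]) measurable
  also have "\<dots> = (\<integral>\<^sup>+y. ennreal (norm (F (- y))) * (\<integral>\<^sup>+u. ennreal (norm (F (- y + u))) \<partial>m) \<partial>m)"
    by (simp add: norm_mult ennreal_mult nn_integral_cmult)
  also have "\<dots> = (\<integral>\<^sup>+y. ennreal (norm (F (- y))) * (\<integral>\<^sup>+u. ennreal (norm (F u)) \<partial>m) \<partial>m)"
    by (simp add: nn_integral_left[where f="\<lambda>u. ennreal (norm (F u))"])
  also have "\<dots> = (\<integral>\<^sup>+y. ennreal (norm (F y)) \<partial>m) * (\<integral>\<^sup>+u. ennreal (norm (F u)) \<partial>m)"
    by (simp add: nn_integral_multc nn_integral_inverse[where g="\<lambda>u. ennreal (norm (F u))"])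
  also have "\<dots> < \<infinity>" using nn_F by (simp add: ennreal_mult_less_top)
  finally have int: "integrable (\<mu> \<Otimes>\<^sub>M (m \<Otimes>\<^sub>M m)) ?H"
    by (intro integrable_matrix_coefficient[OF e]) measurable
  have "AE c in \<mu>. integrable (m \<Otimes>\<^sub>M m) (\<lambda>p. ?H (c, p))" using int by (rule Q.AE_integrable_fst')
  then have ae: "AE c in \<mu>. lam m (convolve m (star F) F) e c * cnj (e c) = (LINT p|(m \<Otimes>\<^sub>M m). ?H (c, p))"
  proof (rule AE_mp, intro AE_I2 impI)
    fix c assume intc: "integrable (m \<Otimes>\<^sub>M m) (\<lambda>p. ?H (c, p))"
    have eq: "case_prod (\<lambda>y u. ?H (c, (y, u))) = (\<lambda>p. ?H (c, p))"
      by (simp add: fun_eq_iff split_beta)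
    have "(LINT p|(m \<Otimes>\<^sub>M m). ?H (c, p)) = (LINT u|m. (LINT y|m. ?H (c, (y, u))))"
      using P.integral_snd[of "\<lambda>y u. ?H (c, (y, u))", unfolded eq, OF intc] by (rule sym)
    also have "\<dots> = (LINT u|m. (LINT y|m. cnj (F (- y)) * F (- y + u)) * e (rshift u c) * cnj (e c))"
      by (simp add: mult_ac integral_mult_right_zero[symmetric] integral_mult_left_zero[symmetric]
          del: integral_mult_right_zero integral_mult_left_zero)
    also have "\<dots> = lam m (convolve m (star F) F) e c * cnj (e c)"
      by (simp add: lam_def convolve_def star_def)
    finally show "lam m (convolve m (star F) F) e c * cnj (e c) = (LINT p|(m \<Otimes>\<^sub>M m). ?H (c, p))" ..
  qed
  have int1: "integrable \<mu> (\<lambda>c. LINT p|(m \<Otimes>\<^sub>M m). ?H (c, p))" using int by (rule Q.integrable_fst')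
  have [measurable]: "convolve m (star F) F \<in> borel_measurable borel"
    unfolding convolve_def star_def by measurable
  have [measurable]: "lam m (convolve m (star F) F) e \<in> borel_measurable \<mu>"
    unfolding lam_def by measurable
  have "l2_inner \<mu> (lam m (convolve m (star F) F) e) e = (LINT c|\<mu>. (LINT p|(m \<Otimes>\<^sub>M m). ?H (c, p)))"
    unfolding l2_inner_def using int1 by (intro integral_cong_AE ae) auto
  also have "\<dots> = (LINT p|(m \<Otimes>\<^sub>M m). (LINT c|\<mu>. ?H (c, p)))"
    using Q.Fubini_integral[of "\<lambda>c p. ?H (c, p)"] int by simp
  also have "\<dots> = (LINT p|(m \<Otimes>\<^sub>M m). ?w p * \<Psi> 0 (snd p))" by (simp add: \<Psi>_def)
  also have "\<dots> = (LINT y|m. (LINT u|m. ?w (y, u) * \<Psi> 0 u))"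
  proof -
    have "integrable (m \<Otimes>\<^sub>M m) (\<lambda>p. LINT c|\<mu>. ?H (c, p))"
      using Q.integrable_snd[of "\<lambda>c p. ?H (c, p)"] int by simp
    then have "integrable (m \<Otimes>\<^sub>M m) (\<lambda>p. ?w p * \<Psi> 0 (snd p))" by (simp add: \<Psi>_def)
    from P.integral_fst'[OF this] show ?thesis by simp
  qed
  finally show ?thesis by simp
qed

text \<open>The two triple integrals agree: the substitutions \<open>u \<mapsto> y + u\<close> and \<open>y \<mapsto> -y\<close> and the invariance of
  \<open>\<mu>\<close> turn one into the other.\<close>

lemma inner_lam_convolve:
  "l2_inner \<mu> (lam m (convolve m (star F) F) e) e = of_real (LINT c|\<mu>. (norm (lam m F e c))\<^sup>2)"
proof -
  define h where "h y = (LINT u|m. cnj (F y) * F u * \<Psi> y u)" for y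
  have [measurable]: "h \<in> borel_measurable borel" unfolding h_def by measurable
  have "(LINT u|m. cnj (F (- y)) * F (- y + u) * \<Psi> 0 u) = h (- y)" for y
  proof -
    have shift: "\<Psi> 0 u = \<Psi> (- y) (- y + u)" for u using \<Psi>_shift[of "- y" 0 u] by simp
    have "(LINT u|m. cnj (F (- y)) * F (- y + u) * \<Psi> 0 u)
        = (LINT u|m. cnj (F (- y)) * F (- y + u) * \<Psi> (- y) (- y + u))"
      by (subst shift) (rule refl)
    also have "\<dots> = h (- y)"
      unfolding h_def by (rule integral_left[where f="\<lambda>u. cnj (F (- y)) * F u * \<Psi> (- y) u"]) measurable
    finally show ?thesis .
  qed
  then have "l2_inner \<mu> (lam m (convolve m (star F) F) e) e = (LINT y|m. h (- y))"
    by (simp add: inner_lam_convolve_triple_integral)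
  also have "\<dots> = (LINT y|m. h y)" by (rule integral_inverse) measurable
  also have "\<dots> = of_real (LINT c|\<mu>. (norm (lam m F e c))\<^sup>2)"
    unfolding h_def by (rule norm_lam_sq_triple_integral(2)[symmetric])
  finally show ?thesis .
qed

end

end

context lattice_quotient
begin

text \<open>In an orthonormal basis with finite diagonal sum all but countably many vectors are killed by
  \<open>\<lambda>(F)\<close>, even pointwise.  Summing \<open>|\<lambda>(F) e|\<^sup>2\<close> over the others therefore gives a function which
  integrates to at most the trace and which, by Parseval, dominates the squared norm of each kernel
  \<open>kern F x\<close>.\<close>

lemma trace_dominates_kernel:
  assumes F: "F \<in> Cc"
    and tr: "has_trace \<mu> (lam m (convolve m (star F) F)) (complex_of_real t)"
  obtains \<Theta> :: "'g set \<Rightarrow> ennreal" where "\<Theta> \<in> borel_measurable \<mu>"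
    "(\<integral>\<^sup>+c. \<Theta> c \<partial>\<mu>) \<le> ennreal t"
    "\<And>x. ennreal (LINT c|\<mu>. (norm (kern F x c))\<^sup>2) \<le> \<Theta> (pr x)"
proof -
  obtain E where E: "orthonormal_basis \<mu> E"
      and sumE: "((\<lambda>e. l2_inner \<mu> (lam m (convolve m (star F) F) e) e) has_sum complex_of_real t) E"
    using tr unfolding has_trace_def by blast
  have EL2: "e \<in> L2 \<mu>" if "e \<in> E" for e
  proof -
    have "E \<subseteq> L2 \<mu>" using E by (simp add: orthonormal_basis_def)
    then show ?thesis using that by (rule subsetD)
  qed
  define g where "g e = (LINT c|\<mu>. (norm (lam m F e c))\<^sup>2)" for e
  have g0: "0 \<le> g e" for e unfolding g_def by (intro Bochner_Integration.integral_nonneg) auto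
  have "((\<lambda>e. complex_of_real (g e)) has_sum complex_of_real t) E"
    using sumE by (subst has_sum_cong[symmetric]) (auto simp: g_def inner_lam_convolve[OF F] dest: EL2)
  then have sumg: "(g has_sum t) E" by (simp only: has_sum_of_real_iff)
  define E0 where "E0 = {e\<in>E. g e \<noteq> 0}"
  have E0: "E0 \<subseteq> E" by (auto simp: E0_def)
  have ctb: "countable E0"
    unfolding E0_def using sumg by (intro summable_countable_real) (auto simp: summable_on_def)
  have lmeas: "lam m F e \<in> borel_measurable \<mu>" and lint: "integrable \<mu> (\<lambda>c. (norm (lam m F e c))\<^sup>2)"
    and eint: "integrable \<mu> e" if "e \<in> E" for e
    using EL2[OF that] measurable_lam[OF F] L2_D(1) norm_lam_sq_triple_integral(1)[OF F] L2_integrable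
    by auto
  have dead: "lam m F e (pr x) = 0" if "e \<in> E - E0" for e x
  proof (rule lam_zero_everywhere[OF F])
    have "e \<in> E" "g e = 0" using that by (auto simp: E0_def)
    then have "AE c in \<mu>. (norm (lam m F e c))\<^sup>2 = 0"
      using lint[of e] by (subst integral_nonneg_eq_0_iff_AE[symmetric]) (auto simp: g_def)
    then show "AE c in \<mu>. lam m F e c = 0" by simp
    show "integrable \<mu> e" using eint \<open>e \<in> E\<close> .
  qed
  define K where "K = to_nat_on E0 ` E0"
  define v where "v = from_nat_into E0"
  have vE: "v n \<in> E0" if "n \<in> K" for n
    using that ctb by (auto simp: K_def v_def)
  have injv: "inj_on v K"
    unfolding K_def v_def using ctb by (auto simp: inj_on_def)
  define f where "f n c = (if n \<in> K then ennreal ((norm (lam m F (v n) c))\<^sup>2) else 0)" for n c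
  have fm [measurable]: "f n \<in> borel_measurable \<mu>" for n
    using lmeas[of "v n"] vE[of n] E0 by (cases "n \<in> K") (auto simp: f_def[abs_def])
  show ?thesis
  proof (rule that[of "\<lambda>c. \<Sum>n. f n c"])
    show "(\<lambda>c. \<Sum>n. f n c) \<in> borel_measurable \<mu>" by measurable
    have fi: "(\<integral>\<^sup>+c. f n c \<partial>\<mu>) = (if n \<in> K then ennreal (g (v n)) else 0)" for n
    proof (cases "n \<in> K")
      case True
      then have "v n \<in> E" using vE E0 by blast
      then show ?thesis using True lint[of "v n"]
        by (auto simp: f_def g_def nn_integral_eq_integral)
    qed (simp add: f_def)
    have "(\<Sum>n<N. \<integral>\<^sup>+c. f n c \<partial>\<mu>) \<le> ennreal t" for N
    proof -
      have "(\<Sum>n<N. \<integral>\<^sup>+c. f n c \<partial>\<mu>) = (\<Sum>n\<in>{..<N} \<inter> K. ennreal (g (v n)))"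
        unfolding fi by (simp add: sum.inter_restrict)
      also have "\<dots> = ennreal (\<Sum>n\<in>{..<N} \<inter> K. g (v n))" using g0 by simp
      also have "(\<Sum>n\<in>{..<N} \<inter> K. g (v n)) = (\<Sum>e\<in>v ` ({..<N} \<inter> K). g e)"
        by (subst sum.reindex) (auto intro: inj_on_subset[OF injv])
      also have "\<dots> \<le> t"
        using vE E0 g0 by (intro finite_sum_le_has_sum[OF sumg]) auto
      finally show ?thesis by (simp add: ennreal_leI)
    qed
    then have "(\<Sum>n. \<integral>\<^sup>+c. f n c \<partial>\<mu>) \<le> ennreal t"
      by (simp add: suminf_eq_SUP SUP_least)
    moreover have "(\<integral>\<^sup>+c. (\<Sum>n. f n c) \<partial>\<mu>) = (\<Sum>n. \<integral>\<^sup>+c. f n c \<partial>\<mu>)"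
      by (rule nn_integral_suminf) measurable
    ultimately show "(\<integral>\<^sup>+c. (\<Sum>n. f n c) \<partial>\<mu>) \<le> ennreal t" by simp
    fix x
    define \<phi> where "\<phi> c = cnj (kern F x c)" for c
    have \<phi>: "\<phi> \<in> L2 \<mu>" unfolding \<phi>_def[abs_def] by (intro L2_cnj kern_L2 F)
    have inner: "norm (l2_inner \<mu> \<phi> e) = norm (lam m F e (pr x))" if "e \<in> E" for e
    proof -
      have "lam m F e (pr x) = (LINT c|\<mu>. kern F x c * e c)"
        by (rule lam_eq_kern[OF F eint[OF that]])
      also have "\<dots> = l2_inner \<mu> e \<phi>" by (simp add: l2_inner_def \<phi>_def mult.commute)
      finally show ?thesis using l2_inner_commute[of \<mu> \<phi> e] by simp
    qed
    have "ennreal (LINT c|\<mu>. (norm (\<phi> c))\<^sup>2) \<le> (\<Sum>n. f n (pr x))"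
    proof (rule parseval_le[OF E \<phi> E0])
      fix e assume "e \<in> E - E0"
      then show "l2_inner \<mu> \<phi> e = 0" using inner[of e] dead[of e x] by simp
    next
      fix A assume A: "finite A" "A \<subseteq> E0"
      have vt: "v (to_nat_on E0 e) = e" if "e \<in> E0" for e using that ctb by (simp add: v_def)
      have inj: "inj_on (to_nat_on E0) A"
        using A(2) vt by (intro inj_on_inverseI[where g=v]) auto
      have "(\<Sum>e\<in>A. ennreal ((norm (l2_inner \<mu> \<phi> e))\<^sup>2)) = (\<Sum>e\<in>A. f (to_nat_on E0 e) (pr x))"
        using A E0 vt inner by (intro sum.cong refl) (auto simp: f_def K_def subset_eq)
      also have "\<dots> = (\<Sum>n\<in>to_nat_on E0 ` A. f n (pr x))" using inj by (simp add: sum.reindex)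
      also have "\<dots> \<le> (\<Sum>n. f n (pr x))" using A(1) by (intro sum_le_suminf) auto
      finally show "(\<Sum>e\<in>A. ennreal ((norm (l2_inner \<mu> \<phi> e))\<^sup>2)) \<le> (\<Sum>n. f n (pr x))" .
    qed
    then show "ennreal (LINT c|\<mu>. (norm (kern F x c))\<^sup>2) \<le> (\<Sum>n. f n (pr x))"
      by (simp add: \<phi>_def)
  qed
qed

end

section \<open>Spectral gap: points that the lattice does not connect are rare\<close>

lemma op_norm_on_bound:
  assumes T: "op_norm_on M V T \<le> ennreal \<beta>" "\<beta> \<ge> 0"
    and \<phi>: "(\<lambda>x. \<phi> x / of_real s) \<in> V" and s: "s > 0" "(LINT x|M. (norm (\<phi> x))\<^sup>2) \<le> s\<^sup>2"
    and hom: "\<And>x. T (\<lambda>x. \<phi> x / of_real s) x = T \<phi> x / of_real s"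
  shows "(LINT x|M. (norm (T \<phi> x))\<^sup>2) \<le> \<beta>\<^sup>2 * s\<^sup>2"
proof -
  have sq: "(norm (z / of_real s))\<^sup>2 = (norm z)\<^sup>2 / s\<^sup>2" for z :: complex
    using s by (simp add: norm_divide power_divide)
  have "l2_norm M (\<lambda>x. \<phi> x / of_real s) \<le> 1"
    using s unfolding l2_norm_def sq by simp
  then have "ennreal (l2_norm M (T (\<lambda>x. \<phi> x / of_real s))) \<le> op_norm_on M V T"
    unfolding op_norm_on_def using \<phi> by (intro SUP_upper) simp
  also have "\<dots> \<le> ennreal \<beta>" by (rule T)
  finally have "sqrt (LINT x|M. (norm (T \<phi> x / of_real s))\<^sup>2) \<le> \<beta>"
    using T(2) by (simp add: l2_norm_def hom)
  then have "(LINT x|M. (norm (T \<phi> x / of_real s))\<^sup>2) \<le> \<beta>\<^sup>2"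
    by (rule sqrt_le_D)
  then show ?thesis
    unfolding sq using s by (simp add: divide_le_eq)
qed

locale product_quotient =
  A: unimodular_haar m1 + B: unimodular_haar m2 + lattice_quotient "m1 \<Otimes>\<^sub>M m2" \<Gamma> \<mu>
  for m1 :: "'a::{topological_group_add,t2_space,second_countable_topology} measure"
    and m2 :: "'b::{topological_group_add,t2_space,second_countable_topology} measure"
    and \<Gamma> \<mu>
begin

context
  fixes F :: "'a \<times> 'b \<Rightarrow> complex" and \<psi> :: "'b \<Rightarrow> real" and \<beta> :: real
  assumes F: "F \<in> Cc" and F1: "(LINT g|(m1 \<Otimes>\<^sub>M m2). F g) = 1"
    and \<psi>: "\<psi> \<in> Cc" "\<And>g. 0 \<le> \<psi> g" "(LINT g|m2. \<psi> g) = 1"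
    and gap: "op_norm_on \<mu> (L2_0 \<mu>) (lam2 m2 (\<lambda>g. complex_of_real (\<psi> g))) \<le> ennreal \<beta>" "\<beta> \<ge> 0"
begin

private lemma \<psi>_meas [measurable]: "\<psi> \<in> borel_measurable borel"
  using \<psi>(1) by (auto simp: Cc_def intro: borel_measurable_continuous_onI)

private lemma F_meas [measurable]: "F \<in> borel_measurable borel"
  by (rule measurable_F[OF F])

private abbreviation "avg \<equiv> lam2 m2 (\<lambda>g. complex_of_real (\<psi> g)) :: (('a \<times> 'b) set \<Rightarrow> complex) \<Rightarrow> _"

private lemma avg_meas [measurable]:
  assumes [measurable]: "\<phi> \<in> borel_measurable \<mu>"
  shows "avg \<phi> \<in> borel_measurable \<mu>"
proof -
  have [measurable]: "(\<lambda>p. (0, snd p)) \<in> measurable (\<mu> \<Otimes>\<^sub>M m2) (borel :: ('a \<times> 'b) measure)"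
    by (subst borel_prod[symmetric]) measurable
  show ?thesis unfolding lam2_def by measurable
qed

private definition deviation :: "'a \<times> 'b \<Rightarrow> ('a \<times> 'b) set \<Rightarrow> complex" where
  "deviation y = (\<lambda>c. kern F y c - 1)"

private lemma deviation_meas [measurable]: "deviation y \<in> borel_measurable \<mu>"
  unfolding deviation_def using measurable_kern[OF F] by measurable

private lemma deviation_L2: "deviation y \<in> L2 \<mu>"
proof -
  obtain B where B: "\<And>c. c \<in> range pr \<Longrightarrow> norm (kern F y c) \<le> B"
    using kern_bounded[OF F, where x=y] by metis
  show ?thesis
  proof (rule L2_bounded[OF deviation_meas, where B="B + 1"])
    fix c assume "c \<in> space \<mu>"
    then have "norm (kern F y c) \<le> B" using B by simp
    then show "norm (deviation y c) \<le> B + 1"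
      unfolding deviation_def using norm_triangle_ineq4[of "kern F y c" 1] by simp
  qed
qed

private lemma prob_range: "prob (range pr) = 1"
  using prob_space unfolding space_mu .

private lemma deviation_mean: "(LINT c|\<mu>. deviation y c) = 0"
proof -
  have "integrable \<mu> (kern F y)" "(LINT c|\<mu>. kern F y c) = 1"
    using has_integral_kern[OF F, of y] F1 by (auto simp: has_bochner_integral_iff)
  then show ?thesis by (simp add: deviation_def prob_range)
qed

text \<open>The kernel has mean 1, so subtracting its mean lowers its squared norm by 1; in particular the
  squared norm of the kernel is at least 1.\<close>

private lemma deviation_norm: "(LINT c|\<mu>. (norm (deviation y c))\<^sup>2) = (LINT c|\<mu>. (norm (kern F y c))\<^sup>2) - 1"
proof -
  have k: "integrable \<mu> (kern F y)" "(LINT c|\<mu>. kern F y c) = 1"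
    using has_integral_kern[OF F, of y] F1 by (auto simp: has_bochner_integral_iff)
  have k2: "integrable \<mu> (\<lambda>c. (norm (kern F y c))\<^sup>2)" by (rule L2_D(2)[OF kern_L2[OF F]])
  have eq: "(norm (deviation y c))\<^sup>2 = (norm (kern F y c))\<^sup>2 - 2 * Re (kern F y c) + 1" for c
    by (simp add: deviation_def cmod_power2) (simp add: power2_eq_square algebra_simps)
  have "(LINT c|\<mu>. Re (kern F y c)) = 1"
    using k by (subst integral_Re) auto
  then show ?thesis unfolding eq using k k2 by (simp add: prob_range)
qed

private lemma avg_deviation_norm:
  "(LINT c|\<mu>. (norm (avg (deviation y) c))\<^sup>2) \<le> \<beta>\<^sup>2 * (LINT c|\<mu>. (norm (kern F y c))\<^sup>2)"
proof -
  define s where "s = sqrt (LINT c|\<mu>. (norm (kern F y c))\<^sup>2)"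
  have "0 \<le> (LINT c|\<mu>. (norm (deviation y c))\<^sup>2)" by (intro Bochner_Integration.integral_nonneg) auto
  then have ge1: "1 \<le> (LINT c|\<mu>. (norm (kern F y c))\<^sup>2)" using deviation_norm[of y] by simp
  then have s: "s > 0" "s\<^sup>2 = (LINT c|\<mu>. (norm (kern F y c))\<^sup>2)" by (auto simp: s_def)
  have "(LINT c|\<mu>. (norm (avg (deviation y) c))\<^sup>2) \<le> \<beta>\<^sup>2 * s\<^sup>2"
  proof (rule op_norm_on_bound[OF gap _ s(1)])
    have "(norm (deviation y c / of_real s))\<^sup>2 = (norm (deviation y c))\<^sup>2 / s\<^sup>2" for c
      using s(1) by (simp add: norm_divide power_divide)
    then show "(\<lambda>c. deviation y c / of_real s) \<in> L2_0 \<mu>"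
      using L2_D[OF deviation_L2[of y]] deviation_mean[of y] by (auto simp: L2_0_def L2_def)
    show "(LINT c|\<mu>. (norm (deviation y c))\<^sup>2) \<le> s\<^sup>2" using deviation_norm[of y] s(2) by simp
  qed (simp add: lam2_def)
  then show ?thesis by (simp add: s(2))
qed

private lemma avg_deviation_sq_integrable: "integrable \<mu> (\<lambda>c. (norm (avg (deviation y) c))\<^sup>2)"
proof -
  obtain B where B: "\<And>c. c \<in> range pr \<Longrightarrow> norm (kern F y c) \<le> B"
    using kern_bounded[OF F, where x=y] by metis
  have "norm (avg (deviation y) c) \<le> B + 1" if c: "c \<in> space \<mu>" for c
  proof -
    have le: "norm (deviation y (rshift g c)) \<le> B + 1" for g
    proof -
      have "norm (kern F y (rshift g c)) \<le> B" using B c by simp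
      then show ?thesis unfolding deviation_def using norm_triangle_ineq4[of "kern F y (rshift g c)" 1] by simp
    qed
    have "norm (avg (deviation y) c) \<le> (LINT g|m2. (B + 1) * \<psi> g)"
      unfolding lam2_def
    proof (rule order_trans[OF integral_norm_bound], rule integral_mono')
      show "integrable m2 (\<lambda>g. (B + 1) * \<psi> g)" using B.integrable_Cc[OF \<psi>(1)] by simp
      show "norm (complex_of_real (\<psi> g) * deviation y (rshift (0, g) c)) \<le> (B + 1) * \<psi> g" for g
        using le \<psi>(2) by (simp add: norm_mult mult.commute mult_left_mono)
      have "0 \<le> B + 1" using le[of 0] norm_ge_zero by (rule order_trans[rotated])
      then show "0 \<le> (B + 1) * \<psi> g" for g using \<psi>(2) by simp
    qed
    then show ?thesis using \<psi>(3) by simp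
  qed
  then show ?thesis
    by (intro L2_D(2) L2_bounded[where B="B + 1"]) measurable
qed

private definition exceptional :: "'a \<times> 'b \<Rightarrow> ('a \<times> 'b) set set" where
  "exceptional y = {c \<in> space \<mu>. 1 \<le> norm (avg (deviation y) c)}"

private lemma exceptional_measurable [measurable]: "exceptional y \<in> sets \<mu>"
  unfolding exceptional_def by measurable

private lemma emeasure_exceptional:
  "emeasure \<mu> (exceptional y) \<le> ennreal (\<beta>\<^sup>2) * ennreal (LINT c|\<mu>. (norm (kern F y c))\<^sup>2)"
proof -
  have "emeasure \<mu> (exceptional y) = (\<integral>\<^sup>+c. indicator (exceptional y) c \<partial>\<mu>)" by simp
  also have "\<dots> \<le> (\<integral>\<^sup>+c. ennreal ((norm (avg (deviation y) c))\<^sup>2) \<partial>\<mu>)"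
    by (intro nn_integral_mono) (auto simp: exceptional_def indicator_def)
  also have "\<dots> = ennreal (LINT c|\<mu>. (norm (avg (deviation y) c))\<^sup>2)"
    using avg_deviation_sq_integrable by (intro nn_integral_eq_integral) auto
  also have "\<dots> \<le> ennreal (\<beta>\<^sup>2 * (LINT c|\<mu>. (norm (kern F y c))\<^sup>2))"
    by (intro ennreal_leI avg_deviation_norm)
  finally show ?thesis by (simp add: ennreal_mult')
qed

text \<open>If no lattice translate of a point \<open>x + (0, g)\<close> with \<open>\<psi> g \<noteq> 0\<close> falls into the support of
  \<open>h \<mapsto> F (- y + h)\<close>, then averaging \<open>deviation y\<close> against \<open>\<psi>\<close> at \<open>\<Gamma>x\<close> sees only the constant \<open>-1\<close>.\<close>

private lemma unconnected_exceptional: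
  assumes "\<And>g h. \<psi> g \<noteq> 0 \<Longrightarrow> h \<in> pr (x + (0, g)) \<Longrightarrow> F (- y + h) = 0"
  shows "pr x \<in> exceptional y"
proof -
  have "complex_of_real (\<psi> g) * deviation y (rshift (0, g) (pr x)) = - complex_of_real (\<psi> g)" for g
  proof (cases "\<psi> g = 0")
    case False
    then have "{h \<in> pr (x + (0, g)). F (- y + h) \<noteq> 0} = {}" using assms by blast
    then have "kern F y (pr (x + (0, g))) = 0"
      unfolding kern_def periodize_def by (simp only: sum.empty)
    then show ?thesis by (simp add: deviation_def rshift_pr)
  qed simp
  then have "avg (deviation y) (pr x) = - complex_of_real (LINT g|m2. \<psi> g)"
    by (simp add: lam2_def)
  then show ?thesis using \<psi>(3) by (simp add: exceptional_def)
qed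

text \<open>Whether a pair is unconnected depends on the first coordinates only; letting the second coordinates
  range over \<open>V\<close> gives sets of positive measure in \<open>G\<close>.  For fixed \<open>y\<close> the points \<open>x\<close> project into the
  exceptional set of \<open>y\<close>, whose measure is at most \<open>\<beta>\<^sup>2 \<Theta>(\<Gamma>y)\<close>; integrating over \<open>y\<close> brings in the trace.  Each of
  the two passages from \<open>P \<times> Q\<close> to the quotient costs a factor \<open>n\<close>.\<close>

lemma unconnected_pairs_measure:
  fixes P :: "'a set" and V Q :: "'b set" and Bad :: "('a \<times> 'a) set" and n :: nat
  assumes tr: "has_trace \<mu> (lam (m1 \<Otimes>\<^sub>M m2) (convolve (m1 \<Otimes>\<^sub>M m2) (star F) F)) (complex_of_real t)"
    and P: "compact P" and V: "open V" "V \<subseteq> Q" "compact Q"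
    and n: "\<And>f. f \<in> borel_measurable \<mu> \<Longrightarrow>
      (\<integral>\<^sup>+x. f (pr x) * indicator (P \<times> Q) x \<partial>(m1 \<Otimes>\<^sub>M m2)) \<le> of_nat n * (\<integral>\<^sup>+c. f c \<partial>\<mu>)"
    and Bad: "Bad \<in> sets borel"
    and unconnected: "\<And>x1 y1 x2 y2 g h. (x1, y1) \<in> Bad \<Longrightarrow> x2 \<in> V \<Longrightarrow> y2 \<in> V \<Longrightarrow> \<psi> g \<noteq> 0 \<Longrightarrow>
      h \<in> pr (x1, x2 + g) \<Longrightarrow> F (- (y1, y2) + h) = 0"
  shows "emeasure (m1 \<Otimes>\<^sub>M m1) (Bad \<inter> P \<times> P) * (emeasure m2 V)\<^sup>2
    \<le> (of_nat n)\<^sup>2 * ennreal (\<beta>\<^sup>2) * ennreal t"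
proof -
  interpret AA: pair_sigma_finite m1 m1 ..
  interpret AB: pair_sigma_finite m1 m2 ..
  obtain \<Theta> :: "('a \<times> 'b) set \<Rightarrow> ennreal" where \<Theta> [measurable]: "\<Theta> \<in> borel_measurable \<mu>"
    and \<Theta>t: "(\<integral>\<^sup>+c. \<Theta> c \<partial>\<mu>) \<le> ennreal t"
    and \<Theta>k: "\<And>x. ennreal (LINT c|\<mu>. (norm (kern F x c))\<^sup>2) \<le> \<Theta> (pr x)"
    using trace_dominates_kernel[OF F tr] by metis
  have Pm [measurable]: "P \<in> sets borel" and Qm [measurable]: "Q \<in> sets borel"
    and Vm [measurable]: "V \<in> sets borel"
    using P V by (auto intro: borel_compact)
  define S where "S = Bad \<inter> P \<times> P"
  have m11: "sets (m1 \<Otimes>\<^sub>M m1) = sets borel"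
    using sets_pair_measure_cong[OF A.sets_m A.sets_m] unfolding borel_prod .
  have "P \<times> P \<in> sets (borel \<Otimes>\<^sub>M borel)" by (intro pair_measureI Pm)
  then have "P \<times> P \<in> sets borel" unfolding borel_prod .
  then have Sm [measurable]: "S \<in> sets (m1 \<Otimes>\<^sub>M m1)"
    using Bad unfolding m11 S_def by (rule sets.Int[rotated])
  define q where "q y1 = emeasure m1 ((\<lambda>x1. (x1, y1)) -` S)" for y1
  have qm [measurable]: "q \<in> borel_measurable m1"
    unfolding q_def using AA.measurable_emeasure_Pair2[OF Sm] .
  have slice: "(\<lambda>x1. (x1, y1)) -` S \<in> sets m1" for y1
    using sets_Pair2[OF Sm] .
  have pointwise: "q y1 * indicator V y2 * emeasure m2 V
      \<le> (of_nat n * ennreal (\<beta>\<^sup>2)) * (\<Theta> (pr (y1, y2)) * indicator (P \<times> Q) (y1, y2))" for y1 y2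
  proof (cases "y1 \<in> P \<and> y2 \<in> V")
    case False
    then have "q y1 = 0 \<or> indicator V y2 = (0::ennreal)" by (auto simp: q_def S_def vimage_def)
    then show ?thesis by auto
  next
    case True
    let ?T = "(\<lambda>x1. (x1, y1)) -` S"
    have "q y1 * emeasure m2 V = emeasure (m1 \<Otimes>\<^sub>M m2) (?T \<times> V)"
      unfolding q_def using slice by (intro B.emeasure_pair_measure_Times[symmetric]) auto
    also have "\<dots> = (\<integral>\<^sup>+x. indicator (?T \<times> V) x \<partial>(m1 \<Otimes>\<^sub>M m2))"
      using slice[of y1] by (intro nn_integral_indicator[symmetric] pair_measureI) auto
    also have "\<dots> \<le> (\<integral>\<^sup>+x. indicator (exceptional (y1, y2)) (pr x) * indicator (P \<times> Q) x \<partial>(m1 \<Otimes>\<^sub>M m2))"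
    proof (rule nn_integral_mono)
      fix x :: "'a \<times> 'b"
      obtain x1 x2 where x: "x = (x1, x2)" by (cases x)
      show "indicator (?T \<times> V) x \<le> (indicator (exceptional (y1, y2)) (pr x) * indicator (P \<times> Q) x :: ennreal)"
      proof (cases "x \<in> ?T \<times> V")
        case True
        then have x1: "(x1, y1) \<in> Bad" "x1 \<in> P" "x2 \<in> V" by (auto simp: x S_def split: if_splits)
        have "pr x \<in> exceptional (y1, y2)"
        proof (rule unconnected_exceptional)
          fix g h assume "\<psi> g \<noteq> 0" "h \<in> pr (x + (0, g))"
          then show "F (- (y1, y2) + h) = 0"
            using unconnected[OF x1(1,3), of y2 g h] \<open>y1 \<in> P \<and> y2 \<in> V\<close> by (simp add: x)
        qed
        then show ?thesis using x1 V(2) by (auto simp: x indicator_def)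
      qed simp
    qed
    also have "\<dots> \<le> of_nat n * (\<integral>\<^sup>+c. indicator (exceptional (y1, y2)) c \<partial>\<mu>)"
      by (rule n) measurable
    also have "\<dots> = of_nat n * emeasure \<mu> (exceptional (y1, y2))" by simp
    also have "\<dots> \<le> of_nat n * (ennreal (\<beta>\<^sup>2) * \<Theta> (pr (y1, y2)))"
      by (intro mult_left_mono order_trans[OF emeasure_exceptional] \<Theta>k) auto
    finally show ?thesis using True V(2) by (auto simp: mult.assoc)
  qed
  have "emeasure (m1 \<Otimes>\<^sub>M m1) S * (emeasure m2 V)\<^sup>2 = (\<integral>\<^sup>+y1. q y1 \<partial>m1) * emeasure m2 V * emeasure m2 V"
    unfolding q_def using Sm by (simp add: AA.emeasure_pair_measure_alt2 power2_eq_square mult.assoc)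
  also have "\<dots> = (\<integral>\<^sup>+y1. (\<integral>\<^sup>+y2. q y1 * indicator V y2 * emeasure m2 V \<partial>m2) \<partial>m1)"
    by (simp add: nn_integral_cmult nn_integral_multc)
  also have "\<dots> = (\<integral>\<^sup>+y. q (fst y) * indicator V (snd y) * emeasure m2 V \<partial>(m1 \<Otimes>\<^sub>M m2))"
  proof -
    have "(\<lambda>y. q (fst y) * indicator V (snd y) * emeasure m2 V) \<in> borel_measurable (m1 \<Otimes>\<^sub>M m2)"
      by (intro borel_measurable_times_ennreal borel_measurable_const measurable_compose[OF measurable_fst qm]
          measurable_compose[OF measurable_snd borel_measurable_indicator]) (simp add: B.sets_m)
    from B.nn_integral_fst[OF this] show ?thesis by simp
  qed
  also have "\<dots> \<le> (\<integral>\<^sup>+y. (of_nat n * ennreal (\<beta>\<^sup>2)) * (\<Theta> (pr y) * indicator (P \<times> Q) y) \<partial>(m1 \<Otimes>\<^sub>M m2))"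
    by (intro nn_integral_mono) (metis pointwise prod.collapse)
  also have "\<dots> = (of_nat n * ennreal (\<beta>\<^sup>2)) * (\<integral>\<^sup>+y. \<Theta> (pr y) * indicator (P \<times> Q) y \<partial>(m1 \<Otimes>\<^sub>M m2))"
  proof (rule nn_integral_cmult)
    have "P \<times> Q \<in> sets (m1 \<Otimes>\<^sub>M m2)" by (intro pair_measureI) (simp_all add: Pm Qm)
    moreover have "(\<lambda>y. \<Theta> (pr y)) \<in> borel_measurable (m1 \<Otimes>\<^sub>M m2)"
      using measurable_compose[OF measurable_pr \<Theta>] by (simp add: measurable_cong_sets[OF sets_m refl])
    ultimately show "(\<lambda>y. \<Theta> (pr y) * indicator (P \<times> Q) y) \<in> borel_measurable (m1 \<Otimes>\<^sub>M m2)"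
      by (intro borel_measurable_times_ennreal borel_measurable_indicator)
  qed
  also have "\<dots> \<le> (of_nat n * ennreal (\<beta>\<^sup>2)) * (of_nat n * ennreal t)"
    by (intro mult_left_mono order_trans[OF n[OF \<Theta>]] \<Theta>t) auto
  finally show ?thesis by (simp add: S_def power2_eq_square mult_ac)
qed

end

end

section \<open>Invariant metrics on \<open>G/K\<close>\<close>

locale invariant_metric =
  fixes K :: "'g::topological_group_add set" and D :: "'g set \<Rightarrow> 'g set \<Rightarrow> real"
  assumes subgroup_K: "subgroup_add K" and metric: "proper_invariant_metric K D"
begin

definition d :: "'g \<Rightarrow> 'g \<Rightarrow> real" where "d x y = D (lcoset K x) (lcoset K y)"

lemma metric_space: "Metric_space (range (lcoset K)) D"
  using metric by (simp add: proper_invariant_metric_def)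

lemma d_commute: "d x y = d y x"
  unfolding d_def using metric_space by (simp add: Metric_space_def)

lemma d_triangle: "d x z \<le> d x y + d y z"
  unfolding d_def using metric_space by (simp add: Metric_space_def)

lemma d_refl [simp]: "d x x = 0"
  unfolding d_def using metric_space by (simp add: Metric_space_def)

lemma lshift_lcoset: "lshift g (lcoset K x) = lcoset K (g + x)"
  unfolding lshift_def lcoset_def by (auto simp: image_image add.assoc)

lemma d_left: "d (g + x) (g + y) = d x y"
  using metric unfolding d_def proper_invariant_metric_def lshift_lcoset[symmetric] by blast

lemma lcoset_0: "lcoset K 0 = K"
  by (simp add: lcoset_def)

lemma lifted_ball_iff: "g \<in> lifted_ball K D r \<longleftrightarrow> d g 0 \<le> r"
  by (simp add: lifted_ball_def d_def lcoset_0)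

lemma open_ball_d: "open {x'. d x x' < \<epsilon>}"
proof -
  interpret Metric_space "range (lcoset K)" D by (rule metric_space)
  have "openin (quotient_topology (lcoset K)) (mball (lcoset K x) \<epsilon>)"
    using metric openin_mball[of "lcoset K x" \<epsilon>] by (simp add: proper_invariant_metric_def)
  then have "open (lcoset K -` mball (lcoset K x) \<epsilon>)" by (simp add: openin_quotient_topology)
  also have "lcoset K -` mball (lcoset K x) \<epsilon> = {x'. d x x' < \<epsilon>}" by (auto simp: d_def)
  finally show ?thesis .
qed

lemma open_d_less: "open {p. d (fst p) (snd p) < \<rho>}"
proof (rule open_prod_intro)
  fix p assume p: "p \<in> {p. d (fst p) (snd p) < \<rho>}"
  define \<epsilon> where "\<epsilon> = (\<rho> - d (fst p) (snd p)) / 2"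
  have \<epsilon>: "\<epsilon> + \<epsilon> + d (fst p) (snd p) = \<rho>" by (simp add: \<epsilon>_def)
  let ?N = "{x. d (fst p) x < \<epsilon>} \<times> {y. d (snd p) y < \<epsilon>}"
  have "open {x. d (fst p) x < \<epsilon>}" "open {y. d (snd p) y < \<epsilon>}" by (rule open_ball_d)+
  moreover have "p \<in> ?N" using p by (auto simp: \<epsilon>_def mem_Times_iff)
  moreover have "?N \<subseteq> {p. d (fst p) (snd p) < \<rho>}"
  proof (intro subsetI CollectI)
    fix q assume "q \<in> ?N"
    then have "d (fst p) (fst q) < \<epsilon>" "d (snd p) (snd q) < \<epsilon>" by (auto simp: mem_Times_iff)
    moreover have "d (fst q) (snd q) \<le> d (fst q) (fst p) + (d (fst p) (snd p) + d (snd p) (snd q))"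
      using d_triangle[of "fst q" "snd q" "fst p"] d_triangle[of "fst p" "snd q" "snd p"] by linarith
    ultimately show "d (fst q) (snd q) < \<rho>"
      unfolding d_commute[of "fst q" "fst p"] using \<epsilon> by linarith
  qed
  ultimately show "\<exists>A B. open A \<and> open B \<and> p \<in> A \<times> B \<and> A \<times> B \<subseteq> {p. d (fst p) (snd p) < \<rho>}"
    by (intro exI conjI)
qed

end


section \<open>Almost every pair is eventually connected\<close>

text \<open>The strict inequality in the first coordinate makes this a closed set, hence measurable.\<close>

definition unconnected ::
  "'a::group_add set \<Rightarrow> ('a set \<Rightarrow> 'a set \<Rightarrow> real) \<Rightarrow> 'b::group_add set \<Rightarrow> ('b set \<Rightarrow> 'b set \<Rightarrow> real) \<Rightarrow>
     ('a \<times> 'b) set \<Rightarrow> real \<Rightarrow> real \<Rightarrow> ('a \<times> 'a) set" where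
  "unconnected K1 D1 K2 D2 \<Gamma> \<rho> \<sigma> = {(x, y). \<forall>(\<gamma>1, \<gamma>2)\<in>\<Gamma>.
     \<not> (D1 (lcoset K1 (\<gamma>1 + x)) (lcoset K1 y) < \<rho> \<and> D2 (lcoset K2 \<gamma>2) K2 \<le> \<sigma>)}"

locale metric_product_quotient =
  product_quotient m1 m2 \<Gamma> \<mu> + M1: invariant_metric K1 D1 + M2: invariant_metric K2 D2
  for m1 :: "'a::{topological_group_add,t2_space,second_countable_topology} measure"
    and m2 :: "'b::{topological_group_add,t2_space,second_countable_topology} measure"
    and \<Gamma> \<mu> and K1 :: "'a set" and D1 :: "'a set \<Rightarrow> 'a set \<Rightarrow> real"
    and K2 :: "'b set" and D2 :: "'b set \<Rightarrow> 'b set \<Rightarrow> real"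
begin

lemma closed_unconnected: "closed (unconnected K1 D1 K2 D2 \<Gamma> \<rho> \<sigma>)"
proof -
  have "- unconnected K1 D1 K2 D2 \<Gamma> \<rho> \<sigma> =
      (\<Union>\<gamma>\<in>{\<gamma>\<in>\<Gamma>. M2.d (snd \<gamma>) 0 \<le> \<sigma>}. (\<lambda>p. (fst \<gamma> + fst p, snd p)) -` {p. M1.d (fst p) (snd p) < \<rho>})"
    by (force simp: unconnected_def M1.d_def M2.d_def M2.lcoset_0)
  also have "open \<dots>"
    by (intro open_UN ballI open_vimage M1.open_d_less continuous_intros)
  finally show ?thesis by (simp add: closed_def)
qed

text \<open>A non-zero value at \<open>h = (\<gamma>1, \<gamma>2) + (x1, x2 + g)\<close> would bring \<open>\<gamma>1 + x1\<close> close to \<open>y1\<close> and \<open>\<gamma>2 + x2 + g\<close>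
  close to \<open>y2\<close>.  The summand 2 pays for the distances of \<open>x2\<close> and \<open>y2\<close> from the identity.\<close>

lemma unconnected_kernel_zero:
  assumes f1: "supp f1 \<subseteq> lifted_ball K1 D1 \<rho>1" "\<rho>1 < \<rho>"
    and f2: "supp f2 \<subseteq> lifted_ball K2 D2 \<sigma>1" and g: "g \<in> lifted_ball K2 D2 \<sigma>2"
    and le: "\<sigma>1 + \<sigma>2 + 2 \<le> \<sigma>"
    and xy: "(x1, y1) \<in> unconnected K1 D1 K2 D2 \<Gamma> \<rho> \<sigma>"
    and x2: "M2.d x2 0 \<le> 1" and y2: "M2.d y2 0 \<le> 1"
    and h: "h \<in> pr (x1, x2 + g)"
  shows "tensor f1 f2 (- (y1, y2) + h) = 0"
proof (rule ccontr)
  assume nz: "tensor f1 f2 (- (y1, y2) + h) \<noteq> 0"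
  obtain \<gamma>1 \<gamma>2 where \<gamma>: "(\<gamma>1, \<gamma>2) \<in> \<Gamma>" "h = (\<gamma>1 + x1, \<gamma>2 + (x2 + g))"
    using h by (auto simp: rcoset_def plus_prod_def)
  have "f1 (- y1 + (\<gamma>1 + x1)) \<noteq> 0" "f2 (- y2 + (\<gamma>2 + (x2 + g))) \<noteq> 0"
    using nz by (auto simp: \<gamma>(2) tensor_def plus_prod_def uminus_prod_def)
  then have "- y1 + (\<gamma>1 + x1) \<in> supp f1" "- y2 + (\<gamma>2 + (x2 + g)) \<in> supp f2"
    using zero_outside_supp by metis+
  then have "M1.d (- y1 + (\<gamma>1 + x1)) 0 \<le> \<rho>1" and "M2.d (- y2 + (\<gamma>2 + (x2 + g))) 0 \<le> \<sigma>1"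
    using f1(1) f2 by (auto simp: M1.lifted_ball_iff M2.lifted_ball_iff subset_iff)
  then have d1: "M1.d (\<gamma>1 + x1) y1 \<le> \<rho>1" and d2: "M2.d (\<gamma>2 + (x2 + g)) y2 \<le> \<sigma>1"
    using M1.d_left[of y1 "- y1 + (\<gamma>1 + x1)" 0] M2.d_left[of y2 "- y2 + (\<gamma>2 + (x2 + g))" 0]
    by simp_all
  have "M2.d \<gamma>2 (\<gamma>2 + (x2 + g)) = M2.d 0 (x2 + g)" using M2.d_left[of \<gamma>2 0 "x2 + g"] by simp
  also have "\<dots> \<le> M2.d 0 x2 + M2.d x2 (x2 + g)" by (rule M2.d_triangle)
  also have "M2.d x2 (x2 + g) = M2.d g 0" using M2.d_left[of x2 0 g] M2.d_commute[of 0 g] by simp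
  also have "M2.d 0 x2 = M2.d x2 0" by (rule M2.d_commute)
  also have "M2.d x2 0 + M2.d g 0 \<le> 1 + \<sigma>2"
    using x2 g by (simp add: M2.lifted_ball_iff)
  finally have "M2.d \<gamma>2 (\<gamma>2 + (x2 + g)) \<le> 1 + \<sigma>2" by simp
  then have "M2.d \<gamma>2 0 \<le> \<sigma>"
    using M2.d_triangle[of \<gamma>2 0 "\<gamma>2 + (x2 + g)"] M2.d_triangle[of "\<gamma>2 + (x2 + g)" 0 y2] d2 y2 le
    by linarith
  then show False
    using xy \<gamma>(1) d1 f1(2) by (auto simp: unconnected_def M1.d_def M2.d_def M2.lcoset_0)
qed

text \<open>By Borel-Cantelli, it suffices that the product of the squared spectral norm \<open>\<beta>\<^sup>2\<close> and the trace is
  summable along the scales \<open>n\<close>.\<close>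

lemma eventually_connected:
  fixes \<psi> :: "nat \<Rightarrow> 'b \<Rightarrow> real" and f1 :: "nat \<Rightarrow> 'a \<Rightarrow> complex" and f2 :: "nat \<Rightarrow> 'b \<Rightarrow> complex"
    and \<beta> t \<rho>1 \<rho> \<sigma>1 \<sigma>2 \<sigma> b :: "nat \<Rightarrow> real"
  assumes P: "compact P"
    and \<psi>: "\<And>n. \<psi> n \<in> Cc" "\<And>n g. 0 \<le> \<psi> n g" "\<And>n. (LINT g|m2. \<psi> n g) = 1"
      "\<And>n. supp (\<psi> n) \<subseteq> lifted_ball K2 D2 (\<sigma>2 n)"
    and gap: "\<And>n. op_norm_on \<mu> (L2_0 \<mu>) (lam2 m2 (\<lambda>g. complex_of_real (\<psi> n g))) \<le> ennreal (\<beta> n)"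
      "\<And>n. 0 \<le> \<beta> n"
    and F: "\<And>n. tensor (f1 n) (f2 n) \<in> Cc" "\<And>n. (LINT g|(m1 \<Otimes>\<^sub>M m2). tensor (f1 n) (f2 n) g) = 1"
    and f1: "\<And>n. supp (f1 n) \<subseteq> lifted_ball K1 D1 (\<rho>1 n)" "\<And>n. \<rho>1 n < \<rho> n"
    and f2: "\<And>n. supp (f2 n) \<subseteq> lifted_ball K2 D2 (\<sigma>1 n)" "\<And>n. \<sigma>1 n + \<sigma>2 n + 2 \<le> \<sigma> n"
    and tr: "\<And>n. has_trace \<mu> (lam (m1 \<Otimes>\<^sub>M m2) (convolve (m1 \<Otimes>\<^sub>M m2)
        (star (tensor (f1 n) (f2 n))) (tensor (f1 n) (f2 n)))) (complex_of_real (t n))"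
    and b: "summable b" "\<And>n. (\<beta> n)\<^sup>2 * t n \<le> b n" "\<And>n. 0 \<le> b n"
  shows "AE p in m1 \<Otimes>\<^sub>M m1. p \<in> P \<times> P \<longrightarrow>
    eventually (\<lambda>n. p \<notin> unconnected K1 D1 K2 D2 \<Gamma> (\<rho> n) (\<sigma> n)) sequentially"
proof -
  let ?Bad = "\<lambda>n. unconnected K1 D1 K2 D2 \<Gamma> (\<rho> n) (\<sigma> n)"
  have "\<exists>U L. open U \<and> compact L \<and> (0::'b) \<in> U \<and> U \<subseteq> L"
    using B.lc unfolding locally_compact_space_def by simp
  then obtain U Q where U: "open U" "compact Q" "(0::'b) \<in> U" "U \<subseteq> Q" by (elim exE conjE)
  \<comment> \<open>The range of the second coordinates: relatively compact and within distance 1 of the identity coset.\<close>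
  define V where "V = U \<inter> {x. M2.d 0 x < 1}"
  have V: "open V" "V \<subseteq> Q" "0 \<in> V"
    using U M2.open_ball_d[of 0 1] by (auto simp: V_def)
  have dV: "M2.d x 0 \<le> 1" if "x \<in> V" for x
    using that M2.d_commute[of x 0] by (simp add: V_def)
  have "V \<noteq> {}" using V(3) by auto
  then have Vpos: "0 < emeasure m2 V" by (rule B.emeasure_open_pos[OF V(1)])
  have "emeasure m2 V \<le> emeasure m2 Q"
    using V(2) U(2) by (intro emeasure_mono) (auto simp: borel_compact)
  also have "\<dots> < \<infinity>" by (rule B.emeasure_compact[OF U(2)])
  finally have Vfin: "emeasure m2 V < \<infinity>" .
  define v where "v = measure m2 V"
  have ev: "emeasure m2 V = ennreal v"
    unfolding v_def using Vfin by (intro emeasure_eq_ennreal_measure) (simp add: less_top)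
  have v: "v > 0" using Vpos unfolding ev by simp
  have "compact (P \<times> Q)" using P U(2) by (rule compact_Times)
  then obtain k :: nat where k: "\<And>f :: ('a \<times> 'b) set \<Rightarrow> ennreal. f \<in> borel_measurable \<mu> \<Longrightarrow>
      (\<integral>\<^sup>+x. f (pr x) * indicator (P \<times> Q) x \<partial>(m1 \<Otimes>\<^sub>M m2)) \<le> of_nat k * (\<integral>\<^sup>+c. f c \<partial>\<mu>)"
    using nn_unfold_compact by metis
  have Bad: "?Bad n \<in> sets borel" for n using closed_unconnected by (rule borel_closed)
  have m11: "sets (m1 \<Otimes>\<^sub>M m1) = sets borel"
    using sets_pair_measure_cong[OF A.sets_m A.sets_m] unfolding borel_prod .
  have "P \<in> sets borel" using P by (rule borel_compact)
  then have "P \<times> P \<in> sets (borel \<Otimes>\<^sub>M borel)" by (intro pair_measureI)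
  then have PP: "P \<times> P \<in> sets borel" unfolding borel_prod .
  have BP: "?Bad n \<inter> P \<times> P \<in> sets (m1 \<Otimes>\<^sub>M m1)" for n
    unfolding m11 using Bad PP by (rule sets.Int)
  let ?M = "\<lambda>n. (real k)\<^sup>2 / v\<^sup>2 * b n"
  have bound: "emeasure (m1 \<Otimes>\<^sub>M m1) (?Bad n \<inter> P \<times> P) \<le> ennreal (?M n)" for n
  proof -
    have "emeasure (m1 \<Otimes>\<^sub>M m1) (?Bad n \<inter> P \<times> P) * (emeasure m2 V)\<^sup>2
        \<le> (of_nat k)\<^sup>2 * ennreal ((\<beta> n)\<^sup>2) * ennreal (t n)"
    proof (rule unconnected_pairs_measure[OF F(1,2) \<psi>(1,2,3) gap tr P V(1,2) U(2) k Bad])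
      fix x1 y1 x2 y2 g h
      assume *: "(x1, y1) \<in> ?Bad n" "x2 \<in> V" "y2 \<in> V" "\<psi> n g \<noteq> 0" "h \<in> pr (x1, x2 + g)"
      have "g \<in> lifted_ball K2 D2 (\<sigma>2 n)"
        using *(4) \<psi>(4) zero_outside_supp[of g "\<psi> n"] by blast
      then show "tensor (f1 n) (f2 n) (- (y1, y2) + h) = 0"
        using * dV by (intro unconnected_kernel_zero[OF f1 f2(1) _ f2(2)]) auto
    qed
    also have "(of_nat k)\<^sup>2 * ennreal ((\<beta> n)\<^sup>2) * ennreal (t n) \<le> ennreal ((real k)\<^sup>2 * b n)"
    proof -
      have "(of_nat k)\<^sup>2 * ennreal ((\<beta> n)\<^sup>2) * ennreal (t n) = ennreal ((real k)\<^sup>2 * ((\<beta> n)\<^sup>2 * t n))"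
        by (simp add: ennreal_mult' ennreal_power[symmetric] ennreal_of_nat_eq_real_of_nat mult.assoc)
      also have "\<dots> \<le> ennreal ((real k)\<^sup>2 * b n)"
        using b(2) by (intro ennreal_leI mult_left_mono) auto
      finally show ?thesis .
    qed
    finally have le: "emeasure (m1 \<Otimes>\<^sub>M m1) (?Bad n \<inter> P \<times> P) * ennreal (v\<^sup>2) \<le> ennreal ((real k)\<^sup>2 * b n)"
      using v by (simp add: ev ennreal_power)
    have "emeasure (m1 \<Otimes>\<^sub>M m1) (?Bad n \<inter> P \<times> P)
        = emeasure (m1 \<Otimes>\<^sub>M m1) (?Bad n \<inter> P \<times> P) * ennreal (v\<^sup>2) * ennreal (1 / v\<^sup>2)"
      using v by (simp add: mult.assoc ennreal_mult[symmetric])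
    also have "\<dots> \<le> ennreal ((real k)\<^sup>2 * b n) * ennreal (1 / v\<^sup>2)"
      by (intro mult_right_mono le) auto
    also have "\<dots> = ennreal (?M n)"
      using b(3) by (simp add: ennreal_mult[symmetric])
    finally show ?thesis .
  qed
  have M0: "0 \<le> ?M n" for n using b(3) by simp
  have "AE p in m1 \<Otimes>\<^sub>M m1. eventually (\<lambda>n. p \<in> space (m1 \<Otimes>\<^sub>M m1) - ?Bad n \<inter> P \<times> P) sequentially"
  proof (rule borel_cantelli_AE1[OF BP])
    show "emeasure (m1 \<Otimes>\<^sub>M m1) (?Bad n \<inter> P \<times> P) < \<infinity>" for n
      using bound[of n] by (rule le_less_trans) simp
    show "summable (\<lambda>n. measure (m1 \<Otimes>\<^sub>M m1) (?Bad n \<inter> P \<times> P))"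
    proof (rule summable_comparison_test')
      show "summable ?M" using b(1) by (rule summable_mult)
      show "norm (measure (m1 \<Otimes>\<^sub>M m1) (?Bad n \<inter> P \<times> P)) \<le> ?M n" if "0 \<le> n" for n
        using enn2real_mono[OF bound[of n]] M0[of n] by (simp add: measure_def)
    qed
  qed
  then show ?thesis
  proof (rule AE_mp, intro AE_I2 impI)
    fix p assume ev: "eventually (\<lambda>n. p \<in> space (m1 \<Otimes>\<^sub>M m1) - ?Bad n \<inter> P \<times> P) sequentially"
      and p: "p \<in> P \<times> P"
    show "eventually (\<lambda>n. p \<notin> ?Bad n) sequentially"
      using ev by (rule eventually_mono) (use p in blast)
  qed
qed

end

theorem theorem2p1:
  fixes K1 :: "'a::{topological_group_add,t2_space,second_countable_topology} set"
    and K2 :: "'b::{topological_group_add,t2_space,second_countable_topology} set"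
    and m1 :: "'a measure" and m2 :: "'b measure"
    and D1 :: "'a set \<Rightarrow> 'a set \<Rightarrow> real" and D2 :: "'b set \<Rightarrow> 'b set \<Rightarrow> real"
    and \<Gamma> :: "('a \<times> 'b) set"
    and \<mu> :: "('a \<times> 'b) set measure"
    and \<r> :: "real \<Rightarrow> real"
  assumes "locally_compact_space (euclidean :: 'a topology)" "\<not> compact (UNIV :: 'a set)"
    and "locally_compact_space (euclidean :: 'b topology)" "\<not> compact (UNIV :: 'b set)"
    and "unimodular TYPE('a)" "unimodular TYPE('b)"
    and "haar_measure m1" "haar_measure m2"
    and "subgroup_add K1" "compact K1" "gelfand_pair m1 K1"
    and "subgroup_add K2" "compact K2" "gelfand_pair m2 K2"
    and "proper_invariant_metric K1 D1" "proper_invariant_metric K2 D2"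
    and "uniform_lattice \<Gamma>" "irreducible_in_product \<Gamma>"
    and "induced_measure \<Gamma> (m1 \<Otimes>\<^sub>M m2) \<mu>" "prob_space \<mu>"
    and "\<And>R. 1 < R \<Longrightarrow> 0 < \<r> R \<and> \<r> R < 1" "antimono_on {1<..} \<r>"
    and SG: "\<exists>w>0. \<exists>C>0. \<exists>\<psi> :: real \<Rightarrow> 'b \<Rightarrow> real. \<forall>R>1.
        \<psi> R \<in> Cc \<and> (\<forall>g. 0 \<le> \<psi> R g) \<and> bi_invariant K2 (\<psi> R) \<and>
        supp (\<psi> R) \<subseteq> lifted_ball K2 D2 R \<and>
        (LINT g|m2. \<psi> R g) = 1 \<and>
        op_norm_on \<mu> (L2_0 \<mu>) (lam2 m2 (\<lambda>g. complex_of_real (\<psi> R g)))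
          \<le> ennreal (C * exp (- w * R))"
    and T: "\<exists>c. \<forall>\<delta>>0. \<exists>(f1 :: real \<Rightarrow> 'a \<Rightarrow> complex) (f2 :: real \<Rightarrow> 'b \<Rightarrow> complex).
        (\<forall>R>1.
          f1 (\<r> R) \<in> Cc \<and> f2 R \<in> Cc \<and>
          tensor (f1 (\<r> R)) (f2 R) \<in> Cc \<and>
          bi_invariant (K1 \<times> K2) (tensor (f1 (\<r> R)) (f2 R)) \<and>
          supp (f1 (\<r> R)) \<subseteq> lifted_ball K1 D1 (\<r> R) \<and>
          supp (f2 R) \<subseteq> lifted_ball K2 D2 R \<and>
          (LINT g|(m1 \<Otimes>\<^sub>M m2). tensor (f1 (\<r> R)) (f2 R) g) = 1) \<and>
        (\<exists>C\<^sub>\<delta>>0. \<forall>\<^sub>F R in at_top. \<exists>t::real.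
          has_trace \<mu> (lam (m1 \<Otimes>\<^sub>M m2)
            (convolve (m1 \<Otimes>\<^sub>M m2) (star (tensor (f1 (\<r> R)) (f2 R))) (tensor (f1 (\<r> R)) (f2 R))))
            (complex_of_real t) \<and>
          t \<le> C\<^sub>\<delta> * exp (c * \<delta> * R))"
  shows "\<forall>\<delta>>0. AE (x1, y1) in m1 \<Otimes>\<^sub>M m1. \<exists>R0\<ge>1. \<forall>R>R0. \<exists>(\<gamma>1, \<gamma>2)\<in>\<Gamma>.
      D1 (lcoset K1 (\<gamma>1 + x1)) (lcoset K1 y1) \<le> 2 * \<r> R \<and>
      D2 (lcoset K2 \<gamma>2) K2 \<le> (1 + \<delta>) * R"
proof (intro allI impI)
  fix \<delta> :: real assume \<delta>: "\<delta> > 0"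
  have H1: "unimodular_haar m1" and H2: "unimodular_haar m2"
    using assms(1,3,5-8) by (auto intro: unimodular_haarI)
  then have H: "unimodular_haar (m1 \<Otimes>\<^sub>M m2)" by (rule unimodular_haar_pair)
  interpret A: unimodular_haar m1 by (rule H1)
  interpret metric_product_quotient m1 m2 \<Gamma> \<mu> K1 D1 K2 D2
  proof -
    have lat: "subgroup_add \<Gamma>" "discrete \<Gamma>"
      using assms(17) by (auto simp: uniform_lattice_def lattice_subgroup_def)
    have "lattice_quotient (m1 \<Otimes>\<^sub>M m2) \<Gamma> \<mu>"
      using H lat assms(19,20) by (simp add: lattice_quotient_def lattice_quotient_axioms_def)
    then show "metric_product_quotient m1 m2 \<Gamma> \<mu> K1 D1 K2 D2"
      using H1 H2 assms(9,12,15,16)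
      by (simp add: metric_product_quotient_def product_quotient_def invariant_metric_def)
  qed
  obtain w C and \<psi> :: "real \<Rightarrow> 'b \<Rightarrow> real" where w: "w > 0" and C: "C > 0"
    and \<psi>: "\<forall>R>1. \<psi> R \<in> Cc \<and> (\<forall>g. 0 \<le> \<psi> R g) \<and> bi_invariant K2 (\<psi> R) \<and>
        supp (\<psi> R) \<subseteq> lifted_ball K2 D2 R \<and> (LINT g|m2. \<psi> R g) = 1 \<and>
        op_norm_on \<mu> (L2_0 \<mu>) (lam2 m2 (\<lambda>g. complex_of_real (\<psi> R g))) \<le> ennreal (C * exp (- w * R))"
    using SG by (elim exE conjE) blast
  obtain c where c: "\<forall>\<delta>>0. \<exists>(f1 :: real \<Rightarrow> 'a \<Rightarrow> complex) (f2 :: real \<Rightarrow> 'b \<Rightarrow> complex).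
        (\<forall>R>1.
          f1 (\<r> R) \<in> Cc \<and> f2 R \<in> Cc \<and>
          tensor (f1 (\<r> R)) (f2 R) \<in> Cc \<and>
          bi_invariant (K1 \<times> K2) (tensor (f1 (\<r> R)) (f2 R)) \<and>
          supp (f1 (\<r> R)) \<subseteq> lifted_ball K1 D1 (\<r> R) \<and>
          supp (f2 R) \<subseteq> lifted_ball K2 D2 R \<and>
          (LINT g|(m1 \<Otimes>\<^sub>M m2). tensor (f1 (\<r> R)) (f2 R) g) = 1) \<and>
        (\<exists>C\<^sub>\<delta>>0. \<forall>\<^sub>F R in at_top. \<exists>t::real.
          has_trace \<mu> (lam (m1 \<Otimes>\<^sub>M m2)
            (convolve (m1 \<Otimes>\<^sub>M m2) (star (tensor (f1 (\<r> R)) (f2 R))) (tensor (f1 (\<r> R)) (f2 R))))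
            (complex_of_real t) \<and>
          t \<le> C\<^sub>\<delta> * exp (c * \<delta> * R))"
    using T by (elim exE)
  \<comment> \<open>With \<open>\<psi>\<close> taken at radius \<open>\<delta>R/4\<close>, the squared spectral norm decays at the rate \<open>w\<delta>/2\<close>.  The choice
    of \<open>\<delta>'\<close> lets the trace use up at most half of it.\<close>
  define \<delta>' where "\<delta>' = w * \<delta> / (4 * (\<bar>c\<bar> + 1))"
  have \<delta>': "\<delta>' > 0" using w \<delta> by (simp add: \<delta>'_def)
  have "c * \<delta>' \<le> (\<bar>c\<bar> + 1) * \<delta>'" using \<delta>' by (intro mult_right_mono) auto
  also have "\<dots> = w * \<delta> / 4"
  proof -
    have "e * (w * \<delta> / (4 * e)) = w * \<delta> / 4" if "e > 0" for e :: real using that by simp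
    from this[of "\<bar>c\<bar> + 1"] show ?thesis by (simp add: \<delta>'_def del: distrib_left_numeral)
  qed
  finally have c\<delta>': "c * \<delta>' \<le> w * \<delta> / 4" .
  from c[rule_format, OF \<delta>'] obtain f1 :: "real \<Rightarrow> 'a \<Rightarrow> complex" and f2 :: "real \<Rightarrow> 'b \<Rightarrow> complex" and C\<^sub>\<delta>
    where f: "\<forall>R>1.
          f1 (\<r> R) \<in> Cc \<and> f2 R \<in> Cc \<and>
          tensor (f1 (\<r> R)) (f2 R) \<in> Cc \<and>
          bi_invariant (K1 \<times> K2) (tensor (f1 (\<r> R)) (f2 R)) \<and>
          supp (f1 (\<r> R)) \<subseteq> lifted_ball K1 D1 (\<r> R) \<and>
          supp (f2 R) \<subseteq> lifted_ball K2 D2 R \<and>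
          (LINT g|(m1 \<Otimes>\<^sub>M m2). tensor (f1 (\<r> R)) (f2 R) g) = 1"
      and C\<^sub>\<delta>: "C\<^sub>\<delta> > 0"
      and tr_ev: "\<forall>\<^sub>F R in at_top. \<exists>t::real. has_trace \<mu> (lam (m1 \<Otimes>\<^sub>M m2)
            (convolve (m1 \<Otimes>\<^sub>M m2) (star (tensor (f1 (\<r> R)) (f2 R))) (tensor (f1 (\<r> R)) (f2 R))))
            (complex_of_real t) \<and> t \<le> C\<^sub>\<delta> * exp (c * \<delta>' * R)"
    by (elim exE conjE)
  obtain R1 where R1: "\<And>R. R \<ge> R1 \<Longrightarrow> \<exists>t::real. has_trace \<mu> (lam (m1 \<Otimes>\<^sub>M m2)
            (convolve (m1 \<Otimes>\<^sub>M m2) (star (tensor (f1 (\<r> R)) (f2 R))) (tensor (f1 (\<r> R)) (f2 R))))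
            (complex_of_real t) \<and> t \<le> C\<^sub>\<delta> * exp (c * \<delta>' * R)"
    using tr_ev unfolding eventually_at_top_linorder by (elim exE) blast
  \<comment> \<open>From \<open>8/\<delta>\<close> on, the bounded loss 2 in the second radius is at most \<open>\<delta>R/4\<close>, and \<open>\<psi>\<close> is available at the
    radius \<open>\<delta>R/4 > 1\<close>.\<close>
  define N where "N = nat \<lceil>max R1 (max 2 (8 / \<delta>))\<rceil>"
  define s where "s n = real (n + N)" for n
  have s: "R1 \<le> s n" "2 \<le> s n" "8 / \<delta> \<le> s n" for n
  proof -
    have "max R1 (max 2 (8 / \<delta>)) \<le> real N" unfolding N_def by linarith
    then show "R1 \<le> s n" "2 \<le> s n" "8 / \<delta> \<le> s n" by (auto simp: s_def)
  qed
  then have s8: "8 \<le> \<delta> * s n" for n using \<delta> by (simp add: divide_le_eq mult.commute)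
  have s1: "1 < s n" and s4: "1 < \<delta> / 4 * s n" for n using s(2)[of n] s8[of n] by auto
  obtain t where t: "\<And>n. has_trace \<mu> (lam (m1 \<Otimes>\<^sub>M m2)
            (convolve (m1 \<Otimes>\<^sub>M m2) (star (tensor (f1 (\<r> (s n))) (f2 (s n)))) (tensor (f1 (\<r> (s n))) (f2 (s n)))))
            (complex_of_real (t n))" "\<And>n. t n \<le> C\<^sub>\<delta> * exp (c * \<delta>' * s n)"
    using R1[OF s(1)] by metis
  define a where "a = w * \<delta> / 4"
  have a: "a > 0" using w \<delta> by (simp add: a_def)
  define b where "b n = C\<^sup>2 * C\<^sub>\<delta> * exp (- a * s n)" for n
  have bs: "summable b"
  proof -
    have "b = (\<lambda>n. (C\<^sup>2 * C\<^sub>\<delta> * exp (- a * real N)) * exp (- a) ^ n)"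
      by (simp add: fun_eq_iff b_def s_def algebra_simps exp_of_nat_mult[symmetric] exp_add[symmetric])
    moreover have "summable (\<lambda>n. exp (- a) ^ n)" using a by (intro summable_geometric) simp
    then have "summable (\<lambda>n. (C\<^sup>2 * C\<^sub>\<delta> * exp (- a * real N)) * exp (- a) ^ n)"
      by (rule summable_mult)
    ultimately show ?thesis by (simp only:)
  qed
  have bt: "(C * exp (- w * (\<delta> / 4 * s n)))\<^sup>2 * t n \<le> b n" for n
  proof -
    have "exp (c * \<delta>' * s n) \<le> exp (a * s n)"
      using c\<delta>' s(2)[of n] unfolding a_def by (simp add: mult_right_mono)
    then have "t n \<le> C\<^sub>\<delta> * exp (a * s n)"
      using t(2)[of n] C\<^sub>\<delta> by (meson less_imp_le mult_left_mono order_trans)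
    then have "(C * exp (- w * (\<delta> / 4 * s n)))\<^sup>2 * t n
        \<le> (C * exp (- w * (\<delta> / 4 * s n)))\<^sup>2 * (C\<^sub>\<delta> * exp (a * s n))"
      by (rule mult_left_mono) simp
    also have "\<dots> = C\<^sup>2 * C\<^sub>\<delta> * (exp (- a * s n) * exp (- a * s n) * exp (a * s n))"
      by (simp add: power2_eq_square a_def mult.assoc)
    also have "exp (- a * s n) * exp (- a * s n) * exp (a * s n) = exp (- a * s n)"
      by (simp add: exp_add[symmetric])
    finally show ?thesis by (simp add: b_def)
  qed
  define \<sigma> where "\<sigma> n = (1 + \<delta> / 2) * s n" for n
  let ?U = "\<lambda>n. unconnected K1 D1 K2 D2 \<Gamma> (2 * \<r> (s n)) (\<sigma> n)"
  obtain L :: "nat \<Rightarrow> 'a set" where L: "\<And>n. compact (L n)" "(\<Union>n. L n) = UNIV" "\<And>n. L n \<subseteq> L (Suc n)"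
    using compact_exhaustion[OF assms(1)] by metis
  have "AE p in m1 \<Otimes>\<^sub>M m1. p \<in> L j \<times> L j \<longrightarrow> eventually (\<lambda>n. p \<notin> ?U n) sequentially" for j
  proof (rule eventually_connected[OF L(1)])
    show "\<psi> (\<delta> / 4 * s n) \<in> Cc" "0 \<le> \<psi> (\<delta> / 4 * s n) g" "(LINT g|m2. \<psi> (\<delta> / 4 * s n) g) = 1"
        "supp (\<psi> (\<delta> / 4 * s n)) \<subseteq> lifted_ball K2 D2 (\<delta> / 4 * s n)"
        "op_norm_on \<mu> (L2_0 \<mu>) (lam2 m2 (\<lambda>g. complex_of_real (\<psi> (\<delta> / 4 * s n) g)))
          \<le> ennreal (C * exp (- w * (\<delta> / 4 * s n)))" for n g
      using \<psi>[rule_format, OF s4[of n]] by blast+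
    show "0 \<le> C * exp (- w * (\<delta> / 4 * s n))" for n using C by simp
    show "tensor (f1 (\<r> (s n))) (f2 (s n)) \<in> Cc"
        "(LINT g|(m1 \<Otimes>\<^sub>M m2). tensor (f1 (\<r> (s n))) (f2 (s n)) g) = 1"
        "supp (f1 (\<r> (s n))) \<subseteq> lifted_ball K1 D1 (\<r> (s n))"
        "supp (f2 (s n)) \<subseteq> lifted_ball K2 D2 (s n)" for n
      using f[rule_format, OF s1[of n]] by blast+
    show "\<r> (s n) < 2 * \<r> (s n)" for n using assms(21)[OF s1[of n]] by simp
    show "s n + \<delta> / 4 * s n + 2 \<le> \<sigma> n" for n
      using s8[of n] by (simp add: \<sigma>_def algebra_simps)
    show "0 \<le> b n" for n using C\<^sub>\<delta> by (simp add: b_def)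
  qed (rule t(1) bs bt)+
  then have "AE p in m1 \<Otimes>\<^sub>M m1. \<forall>j. p \<in> L j \<times> L j \<longrightarrow> eventually (\<lambda>n. p \<notin> ?U n) sequentially"
    by (intro AE_all_countable[THEN iffD2] allI)
  then show "AE (x1, y1) in m1 \<Otimes>\<^sub>M m1. \<exists>R0\<ge>1. \<forall>R>R0. \<exists>(\<gamma>1, \<gamma>2)\<in>\<Gamma>.
      D1 (lcoset K1 (\<gamma>1 + x1)) (lcoset K1 y1) \<le> 2 * \<r> R \<and> D2 (lcoset K2 \<gamma>2) K2 \<le> (1 + \<delta>) * R"
  proof (rule AE_mp, intro AE_I2 impI)
    fix p :: "'a \<times> 'a"
    assume ev: "\<forall>j. p \<in> L j \<times> L j \<longrightarrow> eventually (\<lambda>n. p \<notin> ?U n) sequentially"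
    obtain x y where p: "p = (x, y)" by (cases p)
    have "x \<in> (\<Union>n. L n)" "y \<in> (\<Union>n. L n)" unfolding L(2) by auto
    then obtain i j where ij: "x \<in> L i" "y \<in> L j" by blast
    have "L i \<subseteq> L (max i j)" "L j \<subseteq> L (max i j)"
      by (rule lift_Suc_mono_le[of L, OF L(3)], simp)+
    then have "p \<in> L (max i j) \<times> L (max i j)" unfolding p using ij by blast
    then obtain M where M: "\<And>n. n \<ge> M \<Longrightarrow> p \<notin> ?U n"
      using ev unfolding eventually_sequentially by blast
    define R0 where "R0 = max (real (M + N)) (max 1 (2 / \<delta> + 1))"
    have "\<exists>(\<gamma>1, \<gamma>2)\<in>\<Gamma>. D1 (lcoset K1 (\<gamma>1 + x)) (lcoset K1 y) \<le> 2 * \<r> R \<and>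
        D2 (lcoset K2 \<gamma>2) K2 \<le> (1 + \<delta>) * R" if R: "R > R0" for R
    proof -
      \<comment> \<open>Real scales are reduced to integer ones: the second radius absorbs the rounding, and the first
        one only shrinks because \<open>\<r>\<close> is non-increasing.\<close>
      have RR: "R > real (M + N)" "R > 1" "R > 2 / \<delta> + 1" using R by (auto simp: R0_def)
      define n where "n = nat \<lceil>R\<rceil> - N"
      have "nat \<lceil>R\<rceil> \<ge> M + N" using RR(1) by linarith
      then have n: "n \<ge> M" "s n = real (nat \<lceil>R\<rceil>)" by (auto simp: n_def s_def)
      have sR: "R \<le> s n" "s n \<le> R + 1" unfolding n(2) using RR(2) by linarith+
      obtain \<gamma>1 \<gamma>2 where \<gamma>: "(\<gamma>1, \<gamma>2) \<in> \<Gamma>" "D1 (lcoset K1 (\<gamma>1 + x)) (lcoset K1 y) < 2 * \<r> (s n)"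
          "D2 (lcoset K2 \<gamma>2) K2 \<le> \<sigma> n"
        using M[OF n(1)] unfolding p unconnected_def by blast
      have "\<r> (s n) \<le> \<r> R"
        using assms(22) RR(2) sR(1) by (auto simp: monotone_on_def)
      then have "D1 (lcoset K1 (\<gamma>1 + x)) (lcoset K1 y) \<le> 2 * \<r> R" using \<gamma>(2) by linarith
      moreover have "\<sigma> n \<le> (1 + \<delta>) * R"
      proof -
        have "\<sigma> n \<le> (1 + \<delta> / 2) * (R + 1)"
          unfolding \<sigma>_def using sR(2) \<delta> by (intro mult_left_mono) auto
        moreover have "2 + \<delta> \<le> \<delta> * R"
        proof -
          have "\<delta> * (2 / \<delta> + 1) \<le> \<delta> * R" using RR(3) \<delta> by (intro mult_left_mono) auto
          then show ?thesis using \<delta> by (simp add: distrib_left)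
        qed
        moreover have "(1 + \<delta> / 2) * (R + 1) = R + \<delta> * R / 2 + 1 + \<delta> / 2"
          by (simp add: algebra_simps)
        moreover have "(1 + \<delta>) * R = R + \<delta> * R" by (simp add: algebra_simps)
        ultimately show ?thesis by linarith
      qed
      ultimately show ?thesis using \<gamma>(1,3) by (intro bexI[of _ "(\<gamma>1, \<gamma>2)"]) auto
    qed
    then have "\<exists>R0\<ge>1. \<forall>R>R0. \<exists>(\<gamma>1, \<gamma>2)\<in>\<Gamma>. D1 (lcoset K1 (\<gamma>1 + x)) (lcoset K1 y) \<le> 2 * \<r> R \<and>
        D2 (lcoset K2 \<gamma>2) K2 \<le> (1 + \<delta>) * R"
      by (intro exI[of _ R0]) (simp add: R0_def)
    then show "case p of (x1, y1) \<Rightarrow> \<exists>R0\<ge>1. \<forall>R>R0. \<exists>(\<gamma>1, \<gamma>2)\<in>\<Gamma>.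
      D1 (lcoset K1 (\<gamma>1 + x1)) (lcoset K1 y1) \<le> 2 * \<r> R \<and> D2 (lcoset K2 \<gamma>2) K2 \<le> (1 + \<delta>) * R"
      by (simp add: p)
  qed
qed

end
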